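(* Let $-A$ be the generator of a uniformly bounded cosine function $\mathrm{Cos}$ on a Banach space $X$, and let $B=\Phi(|t|)$ be the operator obtained from the cosine-function functional calculus $\Phi$. Then $A^{1/2}=B$.
   Context: A cosine function on a complex Banach space $X$ is a strongly continuous map $\mathrm{Cos}:\mathbb{R}\to\mathcal{L}(X)$ with $\mathrm{Cos}(0)=I$ and $\mathrm{Cos}(t+s)+\mathrm{Cos}(t-s)=2\,\mathrm{Cos}(t)\mathrm{Cos}(s)$ for all $t,s\in\mathbb{R}$; it is bounded if $\sup_t\|\mathrm{Cos}(t)\|<\infty$. That $-A$ generates the bounded cosine function $\mathrm{Cos}$ means $\lambda R(\lambda^2,-A)x=\int_0^\infty e^{-\lambda t}\mathrm{Cos}(t)x\,dt$ for all $\lambda>0$, $x\in X$, where $R(\mu,C)=(\mu-C)^{-1}$. The calculus $\Phi$: $\mathbb{R}_+=[0,\infty)$; $\mathbf{M}(\mathbb{R})$ is the space of complex regular Borel measures on $\mathbb{R}$. For $\mu\in\mathbf{M}(\mathbb{R})$ put $T_\mu x=\int_{\mathbb{R}}\mathrm{Cos}(s)x\,\mu(ds)$ and $(\mathcal{C}\mu)(t)=\int_{\mathbb{R}}\cos(st)\,\mu(ds)$ for $t\in\mathbb{R}$. Functions on $\mathbb{R}_+$ are identified with their even extensions to $\mathbb{R}$. Put $\mathcal{E}(\mathbb{R}_+)=\{\mathcal{C}\mu:\mu\in\mathbf{M}(\mathbb{R})\}$ and, for $f=\mathcal{C}\mu\in\mathcal{E}(\mathbb{R}_+)$, $\Phi(f):=T_\mu\in\mathcal{L}(X)$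 (well defined). A function $f:\mathbb{R}_+\to\mathbb{C}$ is called regularizable if there is $e\in\mathcal{E}(\mathbb{R}_+)$ with $ef\in\mathcal{E}(\mathbb{R}_+)$ and $\Phi(e)$ injective; then $\Phi(f):=\Phi(e)^{-1}\Phi(ef)$ with its natural domain, a closed operator independent of the choice of $e$. The function $|t|$ is regularizable (by $(1+t^2)^{-1}$), so $B=\Phi(|t|)$ is defined. The operator $A$ is sectorial of angle $0$, and $A^{1/2}$ denotes its square root in the sense of the classical theory of fractional powers of sectorial operators (the unique sectorial operator $C$ of angle $<\pi/2$ with $C^2=A$). An operator $C$ is sectorial of angle $\omega\in[0,\pi)$ if $\sigma(C)\subset\overline{S_\omega}$ and $\sup\{\|\lambda R(\lambda,C)\|:\lambda\notin\overline{S_{\omega'}}\}<\infty$ for every $\omega'\in(\omega,\pi)$, where $S_\omega=\{z\ne0:|\arg z|<\omega\}$ for $\omega>0$ and $S_0=(0,\infty)$. *)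

theory Defs
  imports "HOL-Analysis.Analysis"
begin

class complex_banach = banach +
  fixes scaleC :: "complex \<Rightarrow> 'a \<Rightarrow> 'a" (infixr "*\<^sub>C" 75)
  assumes scaleC_add_right: "a *\<^sub>C (x + y) = a *\<^sub>C x + a *\<^sub>C y"
    and scaleC_add_left: "(a + b) *\<^sub>C x = a *\<^sub>C x + b *\<^sub>C x"
    and scaleC_scaleC: "a *\<^sub>C b *\<^sub>C x = (a * b) *\<^sub>C x"
    and scaleR_scaleC: "r *\<^sub>R x = complex_of_real r *\<^sub>C x"
    and norm_scaleC: "norm (a *\<^sub>C x) = cmod a * norm x"

instantiation complex :: complex_banach
begin

definition scaleC_complex :: "complex \<Rightarrow> complex \<Rightarrow> complex" where
  "scaleC_complex a x = a * x"

instance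
  by standard
    (simp_all add: scaleC_complex_def algebra_simps scaleR_conv_of_real norm_mult)

end

section \<open>Unbounded operators\<close>

text \<open>
  An operator is represented by its graph, so that equality of operators includes equality of
  their domains. In \<open>S O T\<close> the operator \<open>S\<close> is applied first.
\<close>

type_synonym 'a operator = "('a \<times> 'a) set"

definition linear_operator :: "'a::complex_banach operator \<Rightarrow> bool" where
  "linear_operator C \<longleftrightarrow>
     single_valued C \<and> (0, 0) \<in> C \<and>
     (\<forall>x y x' y'. (x, y) \<in> C \<longrightarrow> (x', y') \<in> C \<longrightarrow> (x + x', y + y') \<in> C) \<and>
     (\<forall>a x y. (x, y) \<in> C \<longrightarrow> (a *\<^sub>C x, a *\<^sub>C y) \<in> C)"

definition op_graph :: "('a \<Rightarrow> 'a) \<Rightarrow> 'a operator" where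
  "op_graph T = {(x, T x) | x. True}"

definition neg_op :: "'a::complex_banach operator \<Rightarrow> 'a operator" where
  "neg_op C = {(x, - y) | x y. (x, y) \<in> C}"

definition shift_op :: "complex \<Rightarrow> 'a::complex_banach operator \<Rightarrow> 'a operator" where
  "shift_op \<mu> C = {(x, \<mu> *\<^sub>C x - y) | x y. (x, y) \<in> C}"

definition resolvent_set :: "'a::complex_banach operator \<Rightarrow> complex set" where
  "resolvent_set C =
     {\<mu>. \<exists>R :: 'a \<Rightarrow>\<^sub>L 'a. (shift_op \<mu> C)\<inverse> = op_graph (blinfun_apply R)}"

definition resolvent :: "complex \<Rightarrow> 'a::complex_banach operator \<Rightarrow> 'a \<Rightarrow>\<^sub>L 'a" where
  "resolvent \<mu> C = (THE R. (shift_op \<mu> C)\<inverse> = op_graph (blinfun_apply R))"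

definition spectrum :: "'a::complex_banach operator \<Rightarrow> complex set" where
  "spectrum C = - resolvent_set C"

section \<open>Sectorial operators and square roots\<close>

definition sector :: "real \<Rightarrow> complex set" where
  "sector \<omega> = (if \<omega> = 0 then complex_of_real ` {0<..} else {z. z \<noteq> 0 \<and> \<bar>Arg z\<bar> < \<omega>})"

definition sectorial :: "real \<Rightarrow> 'a::complex_banach operator \<Rightarrow> bool" where
  "sectorial \<omega> C \<longleftrightarrow>
     0 \<le> \<omega> \<and> \<omega> < pi \<and> linear_operator C \<and>
     spectrum C \<subseteq> closure (sector \<omega>) \<and>
     (\<forall>\<omega>'. \<omega> < \<omega>' \<longrightarrow> \<omega>' < pi \<longrightarrow>
        bdd_above ((\<lambda>z. cmod z * norm (resolvent z C)) ` (- closure (sector \<omega>'))))"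

definition sqrt_op :: "'a::complex_banach operator \<Rightarrow> 'a operator" where
  "sqrt_op A = (THE C. (\<exists>\<omega>. \<omega> < pi / 2 \<and> sectorial \<omega> C) \<and> C O C = A)"

section \<open>Complex Borel measures on the real line\<close>

text \<open>
  A complex measure is a countably additive set function on the Borel sets; its values on other
  sets are irrelevant. On the real line it is automatically regular and of finite variation.
\<close>

definition complex_borel_measure :: "(real set \<Rightarrow> complex) \<Rightarrow> bool" where
  "complex_borel_measure \<mu> \<longleftrightarrow>
     (\<forall>A :: nat \<Rightarrow> real set. range A \<subseteq> sets borel \<longrightarrow> disjoint_family A \<longrightarrow>
        (\<lambda>n. \<mu> (A n)) sums \<mu> (\<Union>n. A n))"

definition total_variation :: "(real set \<Rightarrow> complex) \<Rightarrow> real measure" where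
  "total_variation \<mu> = measure_of UNIV (sets borel)
     (\<lambda>E. SUP P \<in> {P. finite P \<and> P \<subseteq> sets borel \<and> partition_on E P}.
        \<Sum>A\<in>P. ennreal (cmod (\<mu> A)))"

text \<open>
  The Bochner integral with respect to a complex measure. The definition follows
  \<^const>\<open>has_bochner_integral\<close>, which is not applicable to a non-separable space because
  of its type class constraint.
\<close>

definition simple_cm_integral :: "(real set \<Rightarrow> complex) \<Rightarrow> (real \<Rightarrow> 'a::complex_banach) \<Rightarrow> 'a" where
  "simple_cm_integral \<mu> s = (\<Sum>v\<in>range s. \<mu> (s -` {v}) *\<^sub>C v)"

definition has_cm_integral ::
    "(real set \<Rightarrow> complex) \<Rightarrow> (real \<Rightarrow> 'a::complex_banach) \<Rightarrow> 'a \<Rightarrow> bool" where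
  "has_cm_integral \<mu> f y \<longleftrightarrow>
     f \<in> borel_measurable borel \<and>
     (\<exists>s :: nat \<Rightarrow> real \<Rightarrow> 'a.
        (\<forall>i. simple_function borel (s i)) \<and>
        (\<lambda>i. \<integral>\<^sup>+ x. ennreal (norm (f x - s i x)) \<partial>total_variation \<mu>) \<longlonglongrightarrow> 0 \<and>
        (\<lambda>i. simple_cm_integral \<mu> (s i)) \<longlonglongrightarrow> y)"

definition cm_integral :: "(real set \<Rightarrow> complex) \<Rightarrow> (real \<Rightarrow> 'a::complex_banach) \<Rightarrow> 'a" where
  "cm_integral \<mu> f = (THE y. has_cm_integral \<mu> f y)"

section \<open>Cosine functions and their functional calculus\<close>

text \<open>
  The space of \<^typ>\<open>'a \<Rightarrow>\<^sub>L 'b\<close> consists of real-linear maps, hence the explicit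
  complex homogeneity.
\<close>

definition cosine_function :: "(real \<Rightarrow> 'a::complex_banach \<Rightarrow>\<^sub>L 'a) \<Rightarrow> bool" where
  "cosine_function Cos \<longleftrightarrow>
     (\<forall>t a x. Cos t (a *\<^sub>C x) = a *\<^sub>C Cos t x) \<and>
     (\<forall>x. continuous_on UNIV (\<lambda>t. Cos t x)) \<and>
     Cos 0 = id_blinfun \<and>
     (\<forall>t s. Cos (t + s) + Cos (t - s) = 2 *\<^sub>R (Cos t o\<^sub>L Cos s))"

definition bounded_cosine_function :: "(real \<Rightarrow> 'a::complex_banach \<Rightarrow>\<^sub>L 'a) \<Rightarrow> bool" where
  "bounded_cosine_function Cos \<longleftrightarrow> cosine_function Cos \<and> bounded (range Cos)"

text \<open>
  The integrand of the Laplace transform is continuous and, for bounded \<open>Cos\<close>, absolutely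
  integrable, so its Henstock-Kurzweil integral is the Bochner integral.
\<close>

definition generates_cosine ::
    "'a::complex_banach operator \<Rightarrow> (real \<Rightarrow> 'a \<Rightarrow>\<^sub>L 'a) \<Rightarrow> bool" where
  "generates_cosine C Cos \<longleftrightarrow>
     linear_operator C \<and>
     (\<forall>r::real. r > 0 \<longrightarrow>
        complex_of_real (r\<^sup>2) \<in> resolvent_set C \<and>
        (\<forall>x. ((\<lambda>t. exp (- (r * t)) *\<^sub>R Cos t x) has_integral
               r *\<^sub>R resolvent (complex_of_real (r\<^sup>2)) C x) {0..}))"

definition cosine_transform :: "(real set \<Rightarrow> complex) \<Rightarrow> real \<Rightarrow> complex" where
  "cosine_transform \<mu> t = cm_integral \<mu> (\<lambda>s. complex_of_real (cos (s * t)))"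

definition cos_average ::
    "(real \<Rightarrow> 'a::complex_banach \<Rightarrow>\<^sub>L 'a) \<Rightarrow> (real set \<Rightarrow> complex) \<Rightarrow> 'a \<Rightarrow> 'a" where
  "cos_average Cos \<mu> x = cm_integral \<mu> (\<lambda>s. Cos s x)"

text \<open>Functions on \<open>[0, \<infinity>)\<close> are represented by their even extensions to the real line.\<close>

definition elementary_functions :: "(real \<Rightarrow> complex) set" where
  "elementary_functions = {cosine_transform \<mu> | \<mu>. complex_borel_measure \<mu>}"

definition elementary_calculus ::
    "(real \<Rightarrow> 'a::complex_banach \<Rightarrow>\<^sub>L 'a) \<Rightarrow> (real \<Rightarrow> complex) \<Rightarrow> 'a \<Rightarrow> 'a" where
  "elementary_calculus Cos f =
     cos_average Cos (SOME \<mu>. complex_borel_measure \<mu> \<and> cosine_transform \<mu> = f)"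

definition regularizer ::
    "(real \<Rightarrow> 'a::complex_banach \<Rightarrow>\<^sub>L 'a) \<Rightarrow> (real \<Rightarrow> complex) \<Rightarrow> (real \<Rightarrow> complex) \<Rightarrow> bool" where
  "regularizer Cos f e \<longleftrightarrow>
     e \<in> elementary_functions \<and> (\<lambda>t. e t * f t) \<in> elementary_functions \<and>
     inj (elementary_calculus Cos e)"

definition calculus ::
    "(real \<Rightarrow> 'a::complex_banach \<Rightarrow>\<^sub>L 'a) \<Rightarrow> (real \<Rightarrow> complex) \<Rightarrow> 'a operator" where
  "calculus Cos f =
     (let e = (SOME e. regularizer Cos f e)
      in op_graph (elementary_calculus Cos (\<lambda>t. e t * f t)) O
           (op_graph (elementary_calculus Cos e))\<inverse>)"

end

theory Submission
  imports Defs
begin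

text \<open>
  Let \<open>\<Phi>\<close> be the calculus. The functions \<open>1 / (m + \<bar>t\<bar>)\<close> with \<open>m > 0\<close> and \<open>1 / (q\<^sup>2 + t\<^sup>2)\<close> with \<open>Re q > 0\<close> are cosine
  transforms of explicit measures. Because \<open>\<Phi>\<close> is multiplicative, the corresponding operators \<open>N m\<close> and \<open>Q q\<close>
  satisfy every algebraic identity that holds between the functions. Hence they are the resolvents
  \<open>(m + B)\<^sup>-\<^sup>1\<close> and \<open>(q\<^sup>2 + A)\<^sup>-\<^sup>1\<close> of \<open>B = \<Phi>(\<bar>t\<bar>)\<close> (lemma \<open>calculus_abs\<close>) and of \<open>A\<close>, and one such identity gives \<open>B\<^sup>2 = A\<close> (lemma
  \<open>B_square\<close>). The total masses of the measures bound these resolvents, and the factorization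
  \<open>B\<^sup>2 - z\<^sup>2 = (B - z) (B + z)\<close> turns the bounds into sectoriality of \<open>B\<close> (lemma \<open>sectorial_B\<close>). It remains to know that \<open>A\<close> has
  at most one sectorial square root of angle less than \<open>\<pi> / 2\<close>.

  That \<open>\<Phi>\<close> is well defined and multiplicative is derived from approximation by cosine polynomials.
  If \<open>P(s)\<close>, a sum of terms \<open>cos (\<theta> s) c\<close>, is close to \<open>Cos s x\<close> on a long interval and bounded elsewhere, then the
  integral of \<open>P\<close> against \<open>\<mu>\<close>, which is the sum of the terms \<open>f(\<theta>) c\<close> for the transform \<open>f\<close> of \<open>\<mu>\<close>, is close to \<open>\<Phi>(f) x\<close>.
  Such polynomials exist for every \<open>x\<close>, so \<open>\<Phi>(f)\<close> depends on \<open>f\<close> only; and the property is inherited by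
  products, through the functional equation of \<open>Cos\<close> (lemmas \<open>represents_unique\<close> and \<open>represents_mult\<close>). For an arbitrary complex
  measure \<open>\<mu>\<close> this rests on the finiteness of its total variation (lemma \<open>variation_finite\<close>).

  Uniqueness of the square root is a form of Liouville's theorem. If \<open>B\<^sup>2 = C\<^sup>2\<close>, then the difference of the
  resolvents of \<open>B\<close> and \<open>C\<close> on the right half plane takes the same values at \<open>i r\<close> and \<open>- i r\<close>. As a function of
  \<open>z\<^sup>2\<close> it is therefore defined on the whole punctured plane, and its growth forces it to vanish. The lemma
  \<open>resolvents_agree\<close> carries this out by means over half circles, without a theory of vector-valued
  holomorphic functions.
\<close>

section \<open>Total variation of complex measures\<close>

lemma complex_borel_measure_empty:
  assumes "complex_borel_measure \<mu>"
  shows "\<mu> {} = 0"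
proof -
  have "(\<lambda>n::nat. \<mu> {}) sums \<mu> (\<Union>n::nat. {})"
    using assms unfolding complex_borel_measure_def
    by (elim allE[of _ "\<lambda>n::nat. {}"]) (auto simp: disjoint_family_on_def)
  then have "(\<lambda>n::nat. \<mu> {}) \<longlonglongrightarrow> 0"
    using sums_summable summable_LIMSEQ_zero by blast
  then show ?thesis
    by (simp add: LIMSEQ_const_iff)
qed

lemma complex_borel_measure_finite_Union:
  assumes "complex_borel_measure \<mu>" "finite I"
    "\<And>i. i \<in> I \<Longrightarrow> A i \<in> sets borel" "disjoint_family_on A I"
  shows "\<mu> (\<Union>i\<in>I. A i) = (\<Sum>i\<in>I. \<mu> (A i))"
proof -
  obtain f :: "nat \<Rightarrow> _" where f: "bij_betw f {..<card I} I"
    using ex_bij_betw_nat_finite[OF assms(2)] by (auto simp: atLeast0LessThan)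
  define B where "B n = (if n < card I then A (f n) else {})" for n
  have fI: "f n \<in> I" if "n < card I" for n
    using f that by (auto simp: bij_betw_def)
  have "range B \<subseteq> sets borel"
    using assms(3) fI by (auto simp: B_def)
  moreover have "disjoint_family B"
  proof -
    have "B m \<inter> B n = {}" if "m \<noteq> n" for m n
    proof (cases "m < card I \<and> n < card I")
      case True
      then have "f m \<noteq> f n" using f that by (auto simp: bij_betw_def inj_on_def)
      with True fI assms(4) show ?thesis by (simp add: B_def disjoint_family_on_def)
    qed (auto simp: B_def)
    then show ?thesis by (simp add: disjoint_family_on_def)
  qed
  ultimately have "(\<lambda>n. \<mu> (B n)) sums \<mu> (\<Union>n. B n)"
    using assms(1) unfolding complex_borel_measure_def by blast
  moreover have "(\<Union>n. B n) = (\<Union>i\<in>I. A i)"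
  proof -
    have "(\<Union>n. B n) = (\<Union>n<card I. A (f n))"
      by (auto simp: B_def split: if_splits)
    also have "\<dots> = (\<Union>i\<in>f ` {..<card I}. A i)" by blast
    also have "f ` {..<card I} = I" using f by (simp add: bij_betw_def)
    finally show ?thesis .
  qed
  moreover have "(\<lambda>n. \<mu> (B n)) sums (\<Sum>n<card I. \<mu> (B n))"
    by (rule sums_finite) (auto simp: B_def complex_borel_measure_empty[OF assms(1)])
  moreover have "(\<Sum>n<card I. \<mu> (B n)) = (\<Sum>i\<in>I. \<mu> (A i))"
    using sum.reindex_bij_betw[OF f, of "\<lambda>i. \<mu> (A i)"] by (simp add: B_def cong: sum.cong_simp)
  ultimately show ?thesis
    using sums_unique2 by metis
qed

text \<open>
  The set function behind \<^const>\<open>total_variation\<close>. It is studied by itself first, because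
  \<^const>\<open>measure_of\<close> returns the null measure unless its argument is countably additive.
\<close>

definition variation :: "(real set \<Rightarrow> complex) \<Rightarrow> real set \<Rightarrow> ennreal" where
  "variation \<mu> E = (SUP P \<in> {P. finite P \<and> P \<subseteq> sets borel \<and> partition_on E P}.
        \<Sum>A\<in>P. ennreal (cmod (\<mu> A)))"

text \<open>
  Disjoint families bound the variation from below even if they contain empty sets or do not exhaust
  \<open>E\<close>: the empty members are dropped and the remainder of \<open>E\<close> completes a partition.
\<close>

lemma variation_ge:
  assumes \<mu>: "complex_borel_measure \<mu>" and "finite I" "E \<in> sets borel"
    "\<And>i. i \<in> I \<Longrightarrow> A i \<in> sets borel" "\<And>i. i \<in> I \<Longrightarrow> A i \<subseteq> E" "disjoint_family_on A I"
  shows "(\<Sum>i\<in>I. ennreal (cmod (\<mu> (A i)))) \<le> variation \<mu> E"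
proof -
  define J where "J = {i\<in>I. A i \<noteq> {}}"
  define R where "R = E - (\<Union>i\<in>I. A i)"
  define P where "P = A ` J \<union> (if R = {} then {} else {R})"
  have inj: "inj_on A J"
    using assms(6) unfolding inj_on_def disjoint_family_on_def J_def by auto
  have finJ: "finite J" using assms(2) by (simp add: J_def)
  have "partition_on E P"
  proof (rule partition_onI)
    show "\<Union>P = E"
    proof
      show "\<Union>P \<subseteq> E"
        using assms(5) by (auto simp: P_def R_def J_def split: if_splits)
      show "E \<subseteq> \<Union>P"
      proof
        fix x assume "x \<in> E"
        show "x \<in> \<Union>P"
        proof (cases "\<exists>i\<in>I. x \<in> A i")
          case True
          then show ?thesis by (auto simp: P_def J_def)
        next
          case False
          then have "x \<in> R" using \<open>x \<in> E\<close> by (auto simp: R_def)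
          then show ?thesis by (auto simp: P_def)
        qed
      qed
    qed
    show "{} \<notin> P"
      by (auto simp: P_def J_def split: if_splits)
    show "disjnt p q" if "p \<in> P" "q \<in> P" "p \<noteq> q" for p q
    proof -
      have "disjnt (A i) (A j)" if "i \<in> J" "j \<in> J" "A i \<noteq> A j" for i j
        using assms(6) that by (cases "i = j") (auto simp: disjoint_family_on_def J_def disjnt_def)
      moreover have "disjnt (A i) R" "disjnt R (A i)" if "i \<in> J" for i
        using that by (auto simp: R_def J_def disjnt_def)
      ultimately show ?thesis
        using that by (auto simp: P_def split: if_splits)
    qed
  qed
  moreover have "finite P" "P \<subseteq> sets borel"
    using assms finJ by (auto simp: P_def J_def R_def)
  ultimately have le: "(\<Sum>A\<in>P. ennreal (cmod (\<mu> A))) \<le> variation \<mu> E"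
    unfolding variation_def by (intro SUP_upper) auto
  have "(\<Sum>i\<in>I. ennreal (cmod (\<mu> (A i)))) = (\<Sum>i\<in>J. ennreal (cmod (\<mu> (A i))))"
    by (rule sum.mono_neutral_right)
      (auto simp: assms(2) J_def complex_borel_measure_empty[OF \<mu>])
  also have "\<dots> = (\<Sum>A\<in>A ` J. ennreal (cmod (\<mu> A)))"
    by (simp add: sum.reindex[OF inj])
  also have "\<dots> \<le> (\<Sum>A\<in>P. ennreal (cmod (\<mu> A)))"
    by (rule sum_mono2) (use \<open>finite P\<close> in \<open>auto simp: P_def\<close>)
  finally show ?thesis using le by order
qed

lemma variation_le:
  assumes "\<And>P. finite P \<Longrightarrow> P \<subseteq> sets borel \<Longrightarrow> partition_on E P \<Longrightarrow>
      (\<Sum>A\<in>P. ennreal (cmod (\<mu> A))) \<le> c"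
  shows "variation \<mu> E \<le> c"
  unfolding variation_def using assms by (intro SUP_least) auto

lemma cmod_le_variation:
  assumes "complex_borel_measure \<mu>" "E \<in> sets borel"
  shows "ennreal (cmod (\<mu> E)) \<le> variation \<mu> E"
  using variation_ge[OF assms(1), of "{()}" E "\<lambda>_. E"] assms(2)
  by (auto simp: disjoint_family_on_def)

lemma variation_subadditive:
  assumes \<mu>: "complex_borel_measure \<mu>"
    and E: "\<And>i. E i \<in> sets borel" "disjoint_family E"
  shows "variation \<mu> (\<Union>i::nat. E i) \<le> (\<Sum>i. variation \<mu> (E i))"
proof (rule variation_le)
  fix P assume P: "finite P" "P \<subseteq> sets borel" "partition_on (\<Union>i. E i) P"
  have dP: "disjoint_family_on (\<lambda>A. A \<inter> F) P" for F
    using P(3) unfolding partition_on_def disjoint_family_on_def disjoint_def by auto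
  have "ennreal (cmod (\<mu> A)) \<le> (\<Sum>i. ennreal (cmod (\<mu> (A \<inter> E i))))" if A: "A \<in> P" for A
  proof -
    have "(\<lambda>i. \<mu> (A \<inter> E i)) sums \<mu> (\<Union>i. A \<inter> E i)"
      using \<mu> E P(2) A unfolding complex_borel_measure_def disjoint_family_on_def
      by (elim allE[of _ "\<lambda>i. A \<inter> E i"]) (auto intro!: sets.Int)
    moreover have "(\<Union>i. A \<inter> E i) = A"
      using P(3) A by (auto simp: partition_on_def)
    ultimately have "(\<lambda>n. cmod (\<Sum>i<n. \<mu> (A \<inter> E i))) \<longlonglongrightarrow> cmod (\<mu> A)"
      by (simp add: sums_def tendsto_norm)
    then have lim: "(\<lambda>n. ennreal (cmod (\<Sum>i<n. \<mu> (A \<inter> E i)))) \<longlonglongrightarrow> ennreal (cmod (\<mu> A))"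
      by simp
    show ?thesis
    proof (rule LIMSEQ_le_const2[OF lim], intro exI allI impI)
      fix n
      have "ennreal (cmod (\<Sum>i<n. \<mu> (A \<inter> E i))) \<le> ennreal (\<Sum>i<n. cmod (\<mu> (A \<inter> E i)))"
        by (intro ennreal_leI norm_sum)
      also have "\<dots> = (\<Sum>i<n. ennreal (cmod (\<mu> (A \<inter> E i))))"
        by (simp add: sum_ennreal)
      also have "\<dots> \<le> (\<Sum>i. ennreal (cmod (\<mu> (A \<inter> E i))))"
        by (rule sum_le_suminf) auto
      finally show "ennreal (cmod (\<Sum>i<n. \<mu> (A \<inter> E i))) \<le> (\<Sum>i. ennreal (cmod (\<mu> (A \<inter> E i))))" .
    qed
  qed
  then have "(\<Sum>A\<in>P. ennreal (cmod (\<mu> A))) \<le> (\<Sum>A\<in>P. \<Sum>i. ennreal (cmod (\<mu> (A \<inter> E i))))"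
    by (rule sum_mono)
  also have "\<dots> = (\<Sum>i. \<Sum>A\<in>P. ennreal (cmod (\<mu> (A \<inter> E i))))"
    by (rule suminf_sum[symmetric]) auto
  also have "\<dots> \<le> (\<Sum>i. variation \<mu> (E i))"
    using P(2) E by (intro suminf_le variation_ge[OF \<mu> P(1)] dP) auto
  finally show "(\<Sum>A\<in>P. ennreal (cmod (\<mu> A))) \<le> (\<Sum>i. variation \<mu> (E i))" .
qed

lemma variation_finite_superadditive:
  assumes \<mu>: "complex_borel_measure \<mu>"
    and "\<And>i. i \<in> I \<Longrightarrow> E i \<in> sets borel" "\<And>i. i \<in> I \<Longrightarrow> E i \<subseteq> F"
    and F: "F \<in> sets borel" and "finite I" "disjoint_family_on E I"
  shows "(\<Sum>i\<in>I. variation \<mu> (E i)) \<le> variation \<mu> F"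
  using assms(5,2,3,6) F
proof (induction I arbitrary: F rule: finite_induct)
  case (insert j I)
  have "variation \<mu> (E j) + variation \<mu> (F - E j) \<le> variation \<mu> F"
  proof -
    have *: "(\<Sum>A\<in>P. ennreal (cmod (\<mu> A))) + (\<Sum>A\<in>Q. ennreal (cmod (\<mu> A))) \<le> variation \<mu> F"
      if P: "finite P" "P \<subseteq> sets borel" "partition_on (E j) P"
        and Q: "finite Q" "Q \<subseteq> sets borel" "partition_on (F - E j) Q" for P Q
    proof -
      have PQ: "P \<inter> Q = {}"
      proof -
        have "A = {}" if "A \<in> P" "A \<in> Q" for A
          using that partition_onD1[OF P(3)] partition_onD1[OF Q(3)] by blast
        then show ?thesis
          using partition_onD3[OF P(3)] by blast
      qed
      have "disjoint (P \<union> Q)"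
        using P(3) Q(3) unfolding partition_on_def by (intro disjoint_union) auto
      then have dis: "disjoint_family_on (\<lambda>A. A) (P \<union> Q)"
        by (auto simp: disjoint_family_on_def disjoint_def)
      have "(\<Sum>A\<in>P \<union> Q. ennreal (cmod (\<mu> A))) \<le> variation \<mu> F"
      proof (intro variation_ge[OF \<mu>] dis)
        fix A assume "A \<in> P \<union> Q"
        then show "A \<subseteq> F" "A \<in> sets borel"
          using P Q insert.prems(2)[of j] partition_onD1[OF P(3)] partition_onD1[OF Q(3)] by auto
      qed (use P Q insert.prems in auto)
      then show ?thesis
        using PQ P(1) Q(1) by (simp add: sum.union_disjoint del: sum_ennreal)
    qed
    have ne: "{P. finite P \<and> P \<subseteq> sets borel \<and> partition_on G P} \<noteq> {}"
      if "G \<in> sets borel" for G :: "real set"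
    proof (cases "G = {}")
      case True
      then show ?thesis by (auto intro!: exI[of _ "{}"] simp: partition_on_def)
    next
      case False
      then show ?thesis using that by (auto intro!: exI[of _ "{G}"] simp: partition_on_def)
    qed
    have "F - E j \<in> sets borel" "E j \<in> sets borel" using insert.prems by auto
    note ne1 = ne[OF this(1)] and ne2 = ne[OF this(2)]
    have le: "(\<Sum>A\<in>P. ennreal (cmod (\<mu> A))) + variation \<mu> (F - E j) \<le> variation \<mu> F"
      if "finite P" "P \<subseteq> sets borel" "partition_on (E j) P" for P
      unfolding variation_def[of \<mu> "F - E j"] ennreal_SUP_add_right[OF ne1]
      by (rule SUP_least) (use *[OF that] in blast)
    show ?thesis
      unfolding variation_def[of \<mu> "E j"] ennreal_SUP_add_left[OF ne2, symmetric]
      by (rule SUP_least) (use le in blast)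
  qed
  moreover have "(\<Sum>i\<in>I. variation \<mu> (E i)) \<le> variation \<mu> (F - E j)"
    using insert.prems insert.hyps
    by (intro insert.IH) (auto simp: disjoint_family_on_def)
  ultimately show ?case
    using insert.hyps by (simp, meson add_left_mono order_trans)
qed auto

lemma variation_countably_additive:
  assumes \<mu>: "complex_borel_measure \<mu>"
  shows "countably_additive (sets borel) (variation \<mu>)"
  unfolding countably_additive_def
proof (intro allI impI antisym)
  fix E :: "nat \<Rightarrow> real set"
  assume E: "range E \<subseteq> sets borel" "disjoint_family E" "(\<Union>i. E i) \<in> sets borel"
  show "variation \<mu> (\<Union>i. E i) \<le> (\<Sum>i. variation \<mu> (E i))"
    using E by (intro variation_subadditive[OF \<mu>]) auto
  show "(\<Sum>i. variation \<mu> (E i)) \<le> variation \<mu> (\<Union>i. E i)"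
    using E
    by (intro suminf_le_const variation_finite_superadditive[OF \<mu>] summableI)
      (auto simp: disjoint_family_on_def)
qed

lemma
  shows sets_total_variation [simp, measurable_cong]: "sets (total_variation \<mu>) = sets borel"
    and space_total_variation [simp]: "space (total_variation \<mu>) = UNIV"
proof -
  show *: "sets (total_variation \<mu>) = sets borel"
    unfolding total_variation_def using sets.sigma_sets_eq[of "borel::real measure"] by simp
  show "space (total_variation \<mu>) = UNIV"
    using sets_eq_imp_space_eq[OF *] by simp
qed

lemma emeasure_total_variation:
  assumes "complex_borel_measure \<mu>" "E \<in> sets borel"
  shows "emeasure (total_variation \<mu>) E = variation \<mu> E"
proof (rule emeasure_measure_of[where \<Omega> = UNIV and A = "sets borel"])
  show "total_variation \<mu> = measure_of UNIV (sets borel) (variation \<mu>)"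
    unfolding total_variation_def variation_def ..
  have "variation \<mu> {} = 0"
  proof (rule antisym[OF variation_le])
    fix P :: "real set set" assume "partition_on {} P"
    then have "P = {}" by (auto simp: partition_on_def)
    then show "(\<Sum>A\<in>P. ennreal (cmod (\<mu> A))) \<le> 0" by simp
  qed simp
  then show "positive (sets (total_variation \<mu>)) (variation \<mu>)"
    by (simp add: positive_def)
qed (use assms variation_countably_additive in auto)

text \<open>
  The positive and the negative real parts and the positive and the negative imaginary parts add up to
  at least the sum of the moduli, so one of these four partial sums has a quarter of it.
\<close>

lemma large_partial_sum:
  fixes z :: "'b \<Rightarrow> complex"
  assumes "finite P"
  shows "\<exists>S\<subseteq>P. (\<Sum>p\<in>P. cmod (z p)) \<le> 4 * cmod (\<Sum>p\<in>S. z p)"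
proof -
  define S1 where "S1 = {p\<in>P. Re (z p) > 0}"
  define S2 where "S2 = {p\<in>P. Re (z p) < 0}"
  define S3 where "S3 = {p\<in>P. Im (z p) > 0}"
  define S4 where "S4 = {p\<in>P. Im (z p) < 0}"
  have fin: "finite S1" "finite S2" "finite S3" "finite S4"
    using assms by (auto simp: S1_def S2_def S3_def S4_def)
  have "(\<Sum>p\<in>P. \<bar>Re (z p)\<bar>) = (\<Sum>p\<in>S1. Re (z p)) - (\<Sum>p\<in>S2. Re (z p))"
    unfolding S1_def S2_def using assms
    by (simp add: sum.inter_filter sum_subtractf[symmetric] abs_if)
      (rule sum.cong; auto)
  also have "\<dots> \<le> cmod (\<Sum>p\<in>S1. z p) + cmod (\<Sum>p\<in>S2. z p)"
    using abs_Re_le_cmod[of "\<Sum>p\<in>S1. z p"] abs_Re_le_cmod[of "\<Sum>p\<in>S2. z p"] by simp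
  finally have re: "(\<Sum>p\<in>P. \<bar>Re (z p)\<bar>) \<le> cmod (\<Sum>p\<in>S1. z p) + cmod (\<Sum>p\<in>S2. z p)" .
  have "(\<Sum>p\<in>P. \<bar>Im (z p)\<bar>) = (\<Sum>p\<in>S3. Im (z p)) - (\<Sum>p\<in>S4. Im (z p))"
    unfolding S3_def S4_def using assms
    by (simp add: sum.inter_filter sum_subtractf[symmetric] abs_if)
      (rule sum.cong; auto)
  also have "\<dots> \<le> cmod (\<Sum>p\<in>S3. z p) + cmod (\<Sum>p\<in>S4. z p)"
    using abs_Im_le_cmod[of "\<Sum>p\<in>S3. z p"] abs_Im_le_cmod[of "\<Sum>p\<in>S4. z p"] by simp
  finally have im: "(\<Sum>p\<in>P. \<bar>Im (z p)\<bar>) \<le> cmod (\<Sum>p\<in>S3. z p) + cmod (\<Sum>p\<in>S4. z p)" .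
  have "(\<Sum>p\<in>P. cmod (z p)) \<le> (\<Sum>p\<in>P. \<bar>Re (z p)\<bar> + \<bar>Im (z p)\<bar>)"
    by (intro sum_mono cmod_le)
  with re im have sum: "(\<Sum>p\<in>P. cmod (z p)) \<le> cmod (\<Sum>p\<in>S1. z p) + cmod (\<Sum>p\<in>S2. z p)
      + cmod (\<Sum>p\<in>S3. z p) + cmod (\<Sum>p\<in>S4. z p)"
    by (simp add: sum.distrib)
  have sub: "S1 \<subseteq> P" "S2 \<subseteq> P" "S3 \<subseteq> P" "S4 \<subseteq> P"
    by (auto simp: S1_def S2_def S3_def S4_def)
  show ?thesis
  proof (rule ccontr)
    assume "\<not> ?thesis"
    then have "\<And>S. S \<subseteq> P \<Longrightarrow> 4 * cmod (\<Sum>p\<in>S. z p) < (\<Sum>p\<in>P. cmod (z p))"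
      by (meson not_le)
    from this[OF sub(1)] this[OF sub(2)] this[OF sub(3)] this[OF sub(4)] sum show False
      by linarith
  qed
qed

text \<open>
  A partition of very large total mass contains a subfamily whose union \<open>A\<close> satisfies
  \<open>\<bar>\<mu> A\<bar> > 1 + \<bar>\<mu> E\<bar>\<close>. Then \<open>\<mu>\<close> exceeds \<open>1\<close> in modulus on \<open>A\<close> as well as on \<open>E - A\<close>, and one of the two
  sets still has infinite variation.
\<close>

lemma variation_infinite_split:
  assumes \<mu>: "complex_borel_measure \<mu>" and E: "E \<in> sets borel" and inf: "variation \<mu> E = \<infinity>"
  shows "\<exists>A\<in>sets borel. A \<subseteq> E \<and> cmod (\<mu> (E - A)) > 1 \<and> variation \<mu> A = \<infinity>"
proof -
  have "ennreal (4 * (1 + cmod (\<mu> E))) < variation \<mu> E"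
    using inf by simp
  then obtain P where P: "finite P" "P \<subseteq> sets borel" "partition_on E P"
    "ennreal (4 * (1 + cmod (\<mu> E))) < (\<Sum>A\<in>P. ennreal (cmod (\<mu> A)))"
    unfolding variation_def less_SUP_iff by auto
  obtain S where S: "S \<subseteq> P" "(\<Sum>A\<in>P. cmod (\<mu> A)) \<le> 4 * cmod (\<Sum>A\<in>S. \<mu> A)"
    using large_partial_sum[OF P(1)] by blast
  define A where "A = \<Union>S"
  have A: "A \<in> sets borel" "A \<subseteq> E"
    using S(1) P finite_subset[OF S(1) P(1)] by (auto simp: A_def partition_on_def)
  have dis: "disjoint_family_on (\<lambda>A. A) S"
    using P(3) S(1) by (auto simp: disjoint_family_on_def partition_on_def disjoint_def)
  have \<mu>A: "\<mu> A = (\<Sum>A\<in>S. \<mu> A)"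
    using complex_borel_measure_finite_Union[OF \<mu> finite_subset[OF S(1) P(1)], of "\<lambda>A. A"]
      dis S(1) P(2) by (auto simp: A_def)
  have "4 * (1 + cmod (\<mu> E)) < (\<Sum>A\<in>P. cmod (\<mu> A))"
    using P(4) by (simp add: sum_ennreal ennreal_less_iff del: ennreal_plus)
  then have big: "1 + cmod (\<mu> E) < cmod (\<mu> A)"
    using S(2) \<mu>A by simp
  have "\<mu> E = \<mu> A + \<mu> (E - A)"
  proof -
    have sets: "(if b then A else E - A) \<in> sets borel" for b
      using A E by auto
    have dis: "disjoint_family_on (\<lambda>b. if b then A else E - A) {True, False}"
      by (auto simp: disjoint_family_on_def)
    have "E = (\<Union>b\<in>{True, False}. if b then A else E - A)"
      using A by auto
    then show ?thesis
      using complex_borel_measure_finite_Union[OF \<mu> _ sets dis] by simp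
  qed
  then have big': "1 < cmod (\<mu> (E - A))"
    using big norm_triangle_ineq4[of "\<mu> E" "\<mu> (E - A)"] by simp
  have "variation \<mu> E \<le> variation \<mu> A + variation \<mu> (E - A)"
  proof -
    have "emeasure (total_variation \<mu>) E
        = emeasure (total_variation \<mu>) A + emeasure (total_variation \<mu>) (E - A)"
      using A E by (subst plus_emeasure) (auto simp: Un_absorb1)
    then show ?thesis
      using A E by (simp add: emeasure_total_variation[OF \<mu>])
  qed
  then have "variation \<mu> A = \<infinity> \<or> variation \<mu> (E - A) = \<infinity>"
    using inf by (auto simp: top_unique)
  then show ?thesis
  proof
    assume "variation \<mu> A = \<infinity>"
    then show ?thesis using A big' by auto
  next
    assume "variation \<mu> (E - A) = \<infinity>"
    moreover have "E - (E - A) = A" using A by auto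
    moreover have "1 < cmod (\<mu> A)"
      using big norm_ge_zero[of "\<mu> E"] by linarith
    ultimately show ?thesis using A E by (intro bexI[of _ "E - A"]) auto
  qed
qed

text \<open>
  If the variation were infinite, then splitting repeatedly would produce disjoint sets on which
  \<open>\<mu>\<close> exceeds \<open>1\<close> in modulus; but the values of \<open>\<mu>\<close> on disjoint sets form a convergent series.
\<close>

lemma variation_finite:
  assumes \<mu>: "complex_borel_measure \<mu>"
  shows "variation \<mu> UNIV < \<infinity>"
proof (rule ccontr)
  assume "\<not> ?thesis"
  then have inf: "variation \<mu> UNIV = \<infinity>" by (simp only: infinity_ennreal_def top.not_eq_extremum not_less top_unique)
  define ok where "ok E \<longleftrightarrow> E \<in> sets borel \<and> variation \<mu> E = \<infinity>" for E
  have "\<exists>E::nat \<Rightarrow> real set. (\<forall>n. ok (E n) \<and> (E (Suc n) \<subseteq> E n \<and> cmod (\<mu> (E n - E (Suc n))) > 1))"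
  proof (rule dependent_nat_choice[where P = "\<lambda>n. ok" and Q = "\<lambda>n E A. A \<subseteq> E \<and> cmod (\<mu> (E - A)) > 1"])
    show "\<exists>E. ok E" using inf by (auto simp: ok_def)
    show "\<exists>A. ok A \<and> A \<subseteq> E \<and> cmod (\<mu> (E - A)) > 1" if "ok E" for E and n :: nat
      using variation_infinite_split[OF \<mu>, of E] that by (auto simp: ok_def)
  qed
  then obtain E :: "nat \<Rightarrow> real set" where E: "\<And>n. ok (E n)" "\<And>n. E (Suc n) \<subseteq> E n"
    "\<And>n. cmod (\<mu> (E n - E (Suc n))) > 1"
    by blast
  have dec: "decseq E" by (rule decseq_SucI) (rule E)
  have "disjoint_family (\<lambda>n. E n - E (Suc n))"
  proof -
    have "(E m - E (Suc m)) \<inter> (E n - E (Suc n)) = {}" if "m < n" for m n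
      using decseqD[OF dec, of "Suc m" n] that by auto
    then show ?thesis
      unfolding disjoint_family_on_def by (metis Int_commute linorder_neqE_nat)
  qed
  moreover have "range (\<lambda>n. E n - E (Suc n)) \<subseteq> sets borel"
    using E(1) by (auto simp: ok_def)
  ultimately have "(\<lambda>n. \<mu> (E n - E (Suc n))) sums \<mu> (\<Union>n. E n - E (Suc n))"
    using \<mu> unfolding complex_borel_measure_def by (elim allE[of _ "\<lambda>n. E n - E (Suc n)"]) auto
  then have "(\<lambda>n. \<mu> (E n - E (Suc n))) \<longlonglongrightarrow> 0"
    using sums_summable summable_LIMSEQ_zero by blast
  then have "eventually (\<lambda>n. cmod (\<mu> (E n - E (Suc n))) < 1) sequentially"
    by (drule_tac tendstoD[where e=1]) auto
  then show False
    using E(3) by (auto simp: eventually_sequentially) (meson less_asym order_refl)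
qed

lemma finite_measure_total_variation:
  assumes "complex_borel_measure \<mu>"
  shows "finite_measure (total_variation \<mu>)"
  by standard (use variation_finite[OF assms] in \<open>simp add: emeasure_total_variation[OF assms] less_top\<close>)

section \<open>Integration of bounded continuous functions\<close>

lemma scaleC_zero_left [simp]: "0 *\<^sub>C (x::'a::complex_banach) = 0"
  using scaleR_scaleC[of 0 x] by simp

lemma scaleC_zero_right [simp]: "a *\<^sub>C (0::'a::complex_banach) = 0"
  using norm_scaleC[of a "0::'a"] by simp

lemma scaleC_one [simp]: "1 *\<^sub>C (x::'a::complex_banach) = x"
  using scaleR_scaleC[of 1 x] by simp

lemma scaleC_minus_left [simp]: "(- a) *\<^sub>C (x::'a::complex_banach) = - (a *\<^sub>C x)"
  using scaleC_add_left[of a "- a" x] by (simp add: add_eq_0_iff2)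

lemma scaleC_minus_right [simp]: "a *\<^sub>C (- x::'a::complex_banach) = - (a *\<^sub>C x)"
  using scaleC_add_right[of a x "- x"] by (simp add: add_eq_0_iff2)

lemma scaleC_diff_left: "(a - b) *\<^sub>C (x::'a::complex_banach) = a *\<^sub>C x - b *\<^sub>C x"
  using scaleC_add_left[of a "- b" x] by simp

lemma scaleC_diff_right: "a *\<^sub>C (x - y::'a::complex_banach) = a *\<^sub>C x - a *\<^sub>C y"
  using scaleC_add_right[of a x "- y"] by simp

lemma scaleC_sum_left: "(\<Sum>i\<in>I. f i) *\<^sub>C (x :: 'a::complex_banach) = (\<Sum>i\<in>I. f i *\<^sub>C x)"
  by (induction I rule: infinite_finite_induct) (auto simp: scaleC_add_left)

lemma scaleC_cancel: "a \<noteq> 0 \<Longrightarrow> a *\<^sub>C x = a *\<^sub>C (y::'a::complex_banach) \<longleftrightarrow> x = y"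
  by (metis scaleC_one scaleC_scaleC left_inverse)

lemma bounded_bilinear_scaleC: "bounded_bilinear (scaleC :: complex \<Rightarrow> 'a::complex_banach \<Rightarrow> 'a)"
proof
  show "\<exists>K. \<forall>a (b::'a). norm (a *\<^sub>C b) \<le> norm a * norm b * K"
    by (rule exI[of _ 1]) (simp add: norm_scaleC)
  show "(r *\<^sub>R a) *\<^sub>C b = r *\<^sub>R (a *\<^sub>C b)" "a *\<^sub>C (r *\<^sub>R b) = r *\<^sub>R (a *\<^sub>C b)" for r a and b :: 'a
    by (simp_all add: scaleR_scaleC[where ?'a = 'a] scaleC_scaleC scaleR_conv_of_real mult.commute)
qed (simp_all add: scaleC_add_left scaleC_add_right)

lemma simple_function_vimage:
  assumes "simple_function borel (s :: real \<Rightarrow> 'b)"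
  shows "finite (range s)" "s -` {v} \<in> sets borel"
proof -
  show "finite (range s)" using assms by (simp add: simple_function_def)
  show "s -` {v} \<in> sets borel"
  proof (cases "v \<in> range s")
    case False
    then have "s -` {v} = {}" by auto
    then show ?thesis by simp
  qed (use assms in \<open>auto simp: simple_function_def\<close>)
qed

text \<open>
  The integral of a simple function may be computed over any finer partition. Applied to the pair of
  two simple functions this gives linearity.
\<close>

lemma simple_cm_integral_comp:
  assumes \<mu>: "complex_borel_measure \<mu>" and g: "simple_function borel (g :: real \<Rightarrow> 'b)"
  shows "simple_cm_integral \<mu> (\<lambda>x. h (g x)) = (\<Sum>p\<in>range g. \<mu> (g -` {p}) *\<^sub>C h p)"
proof -
  note fin = simple_function_vimage(1)[OF g] and meas = simple_function_vimage(2)[OF g]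
  have "\<mu> ((\<lambda>x. h (g x)) -` {v}) = (\<Sum>p\<in>{p \<in> range g. h p = v}. \<mu> (g -` {p}))" for v
  proof -
    have "(\<lambda>x. h (g x)) -` {v} = (\<Union>p\<in>{p \<in> range g. h p = v}. g -` {p})" by auto
    then show ?thesis
      using fin meas
      by (simp only:) (rule complex_borel_measure_finite_Union[OF \<mu>]; auto simp: disjoint_family_on_def)
  qed
  then have "simple_cm_integral \<mu> (\<lambda>x. h (g x)) =
      (\<Sum>v\<in>h ` range g. (\<Sum>p\<in>{p \<in> range g. h p = v}. \<mu> (g -` {p})) *\<^sub>C v)"
    unfolding simple_cm_integral_def by (simp add: image_image)
  also have "\<dots> = (\<Sum>v\<in>h ` range g. \<Sum>p\<in>{p \<in> range g. h p = v}. \<mu> (g -` {p}) *\<^sub>C h p)"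
    by (simp add: scaleC_sum_left)
  also have "\<dots> = (\<Sum>p\<in>range g. \<mu> (g -` {p}) *\<^sub>C h p)"
    by (rule sum.image_gen[symmetric]) (rule fin)
  finally show ?thesis .
qed

lemma simple_cm_integral_diff:
  assumes \<mu>: "complex_borel_measure \<mu>"
    and s: "simple_function borel s" and t: "simple_function borel t"
  shows "simple_cm_integral \<mu> (\<lambda>x. s x - t x) = simple_cm_integral \<mu> s - simple_cm_integral \<mu> t"
proof -
  have g: "simple_function borel (\<lambda>x. (s x, t x))"
    using s t by (rule simple_function_Pair)
  show ?thesis
    using simple_cm_integral_comp[OF \<mu> g, of fst] simple_cm_integral_comp[OF \<mu> g, of snd]
      simple_cm_integral_comp[OF \<mu> g, of "\<lambda>p. fst p - snd p"]
    by (simp add: scaleC_diff_right sum_subtractf)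
qed

lemma norm_simple_cm_integral_le:
  assumes \<mu>: "complex_borel_measure \<mu>" and s: "simple_function borel s"
  shows "ennreal (norm (simple_cm_integral \<mu> s)) \<le> (\<integral>\<^sup>+x. ennreal (norm (s x)) \<partial>total_variation \<mu>)"
proof -
  note fin = simple_function_vimage(1)[OF s] and meas = simple_function_vimage(2)[OF s]
  have "ennreal (norm (simple_cm_integral \<mu> s))
      \<le> ennreal (\<Sum>v\<in>range s. cmod (\<mu> (s -` {v})) * norm v)"
    unfolding simple_cm_integral_def
    by (intro ennreal_leI order_trans[OF norm_sum]) (simp add: norm_scaleC)
  also have "\<dots> = (\<Sum>v\<in>range s. ennreal (norm v) * ennreal (cmod (\<mu> (s -` {v}))))"
    by (simp add: sum_ennreal[symmetric] ennreal_mult mult.commute del: sum_ennreal)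
  also have "\<dots> \<le> (\<Sum>v\<in>range s. ennreal (norm v) * emeasure (total_variation \<mu>) (s -` {v}))"
    using meas
    by (intro sum_mono mult_left_mono) (auto simp: emeasure_total_variation[OF \<mu>] cmod_le_variation[OF \<mu>])
  also have "\<dots> = (\<integral>\<^sup>+x. (\<Sum>v\<in>range s. ennreal (norm v) * indicator (s -` {v}) x) \<partial>total_variation \<mu>)"
    using meas by (subst nn_integral_sum) (auto simp: nn_integral_cmult_indicator)
  also have "(\<lambda>x. (\<Sum>v\<in>range s. ennreal (norm v) * indicator (s -` {v}) x)) = (\<lambda>x. ennreal (norm (s x)))"
  proof
    fix x
    have "(\<Sum>v\<in>range s. ennreal (norm v) * indicator (s -` {v}) x)
        = (\<Sum>v\<in>range s. if v = s x then ennreal (norm v) else 0)"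
      by (rule sum.cong) auto
    then show "(\<Sum>v\<in>range s. ennreal (norm v) * indicator (s -` {v}) x) = ennreal (norm (s x))"
      using fin by simp
  qed
  finally show ?thesis .
qed

lemma borel_measurable_norm_diff_simple:
  fixes f :: "real \<Rightarrow> 'a::real_normed_vector"
  assumes f: "f \<in> borel_measurable borel" and s: "simple_function borel s"
  shows "(\<lambda>x. norm (f x - s x)) \<in> borel_measurable borel"
proof -
  note fin = simple_function_vimage(1)[OF s] and meas = simple_function_vimage(2)[OF s]
  have "norm (f x - s x) = (\<Sum>v\<in>range s. indicator (s -` {v}) x * norm (f x - v))" for x
  proof -
    have "(\<Sum>v\<in>range s. indicator (s -` {v}) x * norm (f x - v))
        = (\<Sum>v\<in>range s. if v = s x then norm (f x - v) else 0)"
      by (rule sum.cong) auto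
    then show ?thesis using fin by simp
  qed
  moreover have "(\<lambda>x. norm (f x - v)) \<in> borel_measurable borel" for v
    by (rule measurable_compose[OF f])
      (intro borel_measurable_continuous_onI continuous_intros)
  then have "(\<lambda>x. \<Sum>v\<in>range s. indicator (s -` {v}) x * norm (f x - v)) \<in> borel_measurable borel"
    using meas by (intro borel_measurable_sum borel_measurable_times) auto
  ultimately show ?thesis by presburger
qed

lemma simple_cm_integral_dist:
  assumes \<mu>: "complex_borel_measure \<mu>" and f: "f \<in> borel_measurable borel"
    and s: "simple_function borel s" and t: "simple_function borel t"
  shows "ennreal (norm (simple_cm_integral \<mu> s - simple_cm_integral \<mu> t))
    \<le> (\<integral>\<^sup>+x. ennreal (norm (f x - s x)) \<partial>total_variation \<mu>)
      + (\<integral>\<^sup>+x. ennreal (norm (f x - t x)) \<partial>total_variation \<mu>)"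
proof -
  have st: "simple_function borel (\<lambda>x. s x - t x)"
    using simple_function_compose2[OF s t] .
  have "ennreal (norm (simple_cm_integral \<mu> s - simple_cm_integral \<mu> t))
      \<le> (\<integral>\<^sup>+x. ennreal (norm (s x - t x)) \<partial>total_variation \<mu>)"
    using norm_simple_cm_integral_le[OF \<mu> st] by (simp add: simple_cm_integral_diff[OF \<mu> s t])
  also have "\<dots> \<le> (\<integral>\<^sup>+x. ennreal (norm (f x - s x)) + ennreal (norm (f x - t x)) \<partial>total_variation \<mu>)"
  proof (rule nn_integral_mono)
    fix x
    have "norm (s x - t x) \<le> norm (f x - s x) + norm (f x - t x)"
      using norm_triangle_ineq4[of "f x - t x" "f x - s x"] by simp
    then show "ennreal (norm (s x - t x)) \<le> ennreal (norm (f x - s x)) + ennreal (norm (f x - t x))"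
      unfolding ennreal_plus[OF norm_ge_zero norm_ge_zero, symmetric] by (rule ennreal_leI)
  qed
  also have "\<dots> = (\<integral>\<^sup>+x. ennreal (norm (f x - s x)) \<partial>total_variation \<mu>)
      + (\<integral>\<^sup>+x. ennreal (norm (f x - t x)) \<partial>total_variation \<mu>)"
    using borel_measurable_norm_diff_simple[OF f s] borel_measurable_norm_diff_simple[OF f t]
    by (intro nn_integral_add) (auto intro!: measurable_compose[OF _ measurable_ennreal])
  finally show ?thesis .
qed

lemma has_cm_integral_unique:
  assumes \<mu>: "complex_borel_measure \<mu>" and y: "has_cm_integral \<mu> f y" and z: "has_cm_integral \<mu> f z"
  shows "y = z"
proof -
  obtain s where f: "f \<in> borel_measurable borel" and s: "\<And>i. simple_function borel (s i)"
    "(\<lambda>i. \<integral>\<^sup>+ x. ennreal (norm (f x - s i x)) \<partial>total_variation \<mu>) \<longlonglongrightarrow> 0"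
    "(\<lambda>i. simple_cm_integral \<mu> (s i)) \<longlonglongrightarrow> y"
    using y unfolding has_cm_integral_def by blast
  obtain t where t: "\<And>i. simple_function borel (t i)"
    "(\<lambda>i. \<integral>\<^sup>+ x. ennreal (norm (f x - t i x)) \<partial>total_variation \<mu>) \<longlonglongrightarrow> 0"
    "(\<lambda>i. simple_cm_integral \<mu> (t i)) \<longlonglongrightarrow> z"
    using z unfolding has_cm_integral_def by blast
  have "(\<lambda>i. ennreal (norm (simple_cm_integral \<mu> (s i) - simple_cm_integral \<mu> (t i)))) \<longlonglongrightarrow> ennreal (norm (y - z))"
    using s(3) t(3) by (intro tendsto_intros)
  moreover have "(\<lambda>i. (\<integral>\<^sup>+ x. ennreal (norm (f x - s i x)) \<partial>total_variation \<mu>)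
      + (\<integral>\<^sup>+ x. ennreal (norm (f x - t i x)) \<partial>total_variation \<mu>)) \<longlonglongrightarrow> 0 + 0"
    using s(2) t(2) by (intro tendsto_add)
  ultimately have "ennreal (norm (y - z)) \<le> 0 + 0"
    by (rule LIMSEQ_le) (use simple_cm_integral_dist[OF \<mu> f s(1) t(1)] in auto)
  then show ?thesis by simp
qed

definition bounded_continuous :: "(real \<Rightarrow> 'a::real_normed_vector) \<Rightarrow> bool" where
  "bounded_continuous f \<longleftrightarrow> continuous_on UNIV f \<and> bounded (range f)"

lemma bounded_continuousI:
  assumes "continuous_on UNIV f" "\<And>x. norm (f x) \<le> K"
  shows "bounded_continuous f"
  using assms by (auto simp: bounded_continuous_def bounded_iff)

lemma bounded_continuousE:
  assumes "bounded_continuous f"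
  obtains K where "continuous_on UNIV f" "K \<ge> 0" "\<And>x. norm (f x) \<le> K"
  using assms by (auto simp: bounded_continuous_def bounded_pos intro: less_imp_le)

lemma bounded_continuous_diff:
  assumes "bounded_continuous f" "bounded_continuous g"
  shows "bounded_continuous (\<lambda>x. f x - g x)"
  using assms unfolding bounded_continuous_def
  by (auto intro!: continuous_intros bounded_minus_comp)

lemma bounded_continuous_add:
  assumes "bounded_continuous f" "bounded_continuous g"
  shows "bounded_continuous (\<lambda>x. f x + g x)"
  using assms unfolding bounded_continuous_def
  by (auto intro!: continuous_intros bounded_plus_comp)

lemma bounded_continuous_linear:
  assumes "bounded_linear T" "bounded_continuous f"
  shows "bounded_continuous (\<lambda>x. T (f x))"
  using bounded_linear_image[OF _ assms(1), of "range f"] bounded_linear.continuous_on[OF assms(1), of UNIV f] assms(2)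
  by (simp add: bounded_continuous_def image_image)

text \<open>
  The functions \<open>step i f\<close> sample \<open>f\<close> at the points of mesh \<open>1 / (i + 1)\<close> in \<open>[-i, i]\<close>; outside this
  interval, where \<open>grid\<close> is \<^const>\<open>None\<close>, they vanish. They depend linearly on \<open>f\<close>, commute with linear maps and are
  the same for every measure, so that the properties of the integral can be read off from one sequence.
\<close>

definition grid :: "nat \<Rightarrow> real \<Rightarrow> int option" where
  "grid i x = (if \<bar>x\<bar> \<le> real i then Some \<lfloor>(real i + 1) * x\<rfloor> else None)"

definition grid_value :: "nat \<Rightarrow> (real \<Rightarrow> 'a::zero) \<Rightarrow> int option \<Rightarrow> 'a" where
  "grid_value i f p = (case p of None \<Rightarrow> 0 | Some k \<Rightarrow> f (real_of_int k / (real i + 1)))"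

definition step :: "nat \<Rightarrow> (real \<Rightarrow> 'a::zero) \<Rightarrow> real \<Rightarrow> 'a" where
  "step i f x = grid_value i f (grid i x)"

lemma simple_function_grid: "simple_function borel (grid i)"
  unfolding simple_function_def
proof safe
  define k where "k = (int i + 1) * int i"
  have k: "real_of_int k = (real i + 1) * real i" by (simp add: k_def)
  have "range (grid i) \<subseteq> insert None (Some ` {- k - 1 .. k + 1})"
  proof safe
    fix x assume *: "grid i x \<notin> Some ` {- k - 1 .. k + 1}"
    show "grid i x = None"
    proof (rule ccontr)
      assume "\<not> ?thesis"
      then have x: "\<bar>x\<bar> \<le> real i" and g: "grid i x = Some \<lfloor>(real i + 1) * x\<rfloor>"
        by (auto simp: grid_def split: if_splits)
      have "\<bar>(real i + 1) * x\<bar> \<le> (real i + 1) * real i"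
        using x by (simp add: abs_mult mult_left_mono)
      then have "(real i + 1) * x \<le> real_of_int k" "- real_of_int k \<le> (real i + 1) * x"
        unfolding k abs_le_iff by linarith+
      then have "\<lfloor>(real i + 1) * x\<rfloor> \<in> {- k - 1 .. k + 1}"
        unfolding atLeastAtMost_iff le_floor_iff floor_le_iff of_int_diff of_int_minus of_int_add of_int_1
        by linarith
      with * g show False by auto
    qed
  qed
  then have "finite (range (grid i))"
    by (rule finite_subset) simp
  then show "finite (grid i ` space borel)" by simp
  have "grid i -` {p} \<in> sets borel" for p
  proof (cases p)
    case None
    then have "grid i -` {p} = {x. \<not> \<bar>x\<bar> \<le> real i}" by (auto simp: grid_def)
    then show ?thesis by simp
  next
    case (Some k)
    then have "grid i -` {p} = {x. \<bar>x\<bar> \<le> real i \<and> \<lfloor>(real i + 1) * x\<rfloor> = k}"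
      by (auto simp: grid_def split: if_splits)
    also have "\<dots> \<in> sets borel" by measurable
    finally show ?thesis .
  qed
  then show "grid i -` {grid i x} \<inter> space borel \<in> sets borel" for x
    by simp
qed

lemma simple_function_step: "simple_function borel (step i f)"
  unfolding step_def[abs_def]
  using simple_function_compose[OF simple_function_grid, of "grid_value i f"] by (simp add: o_def)

lemma step_tendsto:
  fixes f :: "real \<Rightarrow> 'a::real_normed_vector"
  assumes "continuous_on UNIV f"
  shows "(\<lambda>i. step i f x) \<longlonglongrightarrow> f x"
proof -
  have "(\<lambda>i. real_of_int \<lfloor>(real i + 1) * x\<rfloor> / (real i + 1)) \<longlonglongrightarrow> x"
  proof (rule LIMSEQ_norm_0[of "\<lambda>i. real_of_int \<lfloor>(real i + 1) * x\<rfloor> / (real i + 1) - x", THEN LIM_zero_cancel])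
    fix n
    have "real_of_int \<lfloor>(real n + 1) * x\<rfloor> \<le> (real n + 1) * x"
      "(real n + 1) * x < real_of_int \<lfloor>(real n + 1) * x\<rfloor> + 1" by linarith+
    moreover have "real_of_int \<lfloor>(real n + 1) * x\<rfloor> / (real n + 1) - x
        = - (((real n + 1) * x - real_of_int \<lfloor>(real n + 1) * x\<rfloor>) / (real n + 1))"
      by (simp add: field_simps)
    ultimately show "norm (real_of_int \<lfloor>(real n + 1) * x\<rfloor> / (real n + 1) - x) < 1 / real (Suc n)"
      using divide_strict_right_mono[of "(real n + 1) * x - real_of_int \<lfloor>(real n + 1) * x\<rfloor>" 1 "real n + 1"]
      by (simp add: add.commute)
  qed
  then have "(\<lambda>i. f (real_of_int \<lfloor>(real i + 1) * x\<rfloor> / (real i + 1))) \<longlonglongrightarrow> f x"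
    using assms by (intro continuous_on_tendsto_compose[OF assms]) auto
  moreover have "eventually (\<lambda>i. step i f x = f (real_of_int \<lfloor>(real i + 1) * x\<rfloor> / (real i + 1))) sequentially"
    using eventually_ge_at_top[of "nat \<lceil>\<bar>x\<bar>\<rceil>"]
    by eventually_elim (auto simp: step_def grid_def grid_value_def nat_le_iff ceiling_le_iff)
  ultimately show ?thesis
    by (simp add: tendsto_cong)
qed

lemma norm_step_le:
  assumes "\<And>x. norm (f x) \<le> K"
  shows "norm (step i f x) \<le> K"
  using assms order_trans[OF norm_ge_zero assms[of 0]]
  by (auto simp: step_def grid_value_def split: option.splits)

text \<open>
  Dominated convergence, since the total variation is a finite measure.
\<close>

lemma step_L1:
  assumes \<mu>: "complex_borel_measure \<mu>" and f: "bounded_continuous f"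
  shows "(\<lambda>i. \<integral>\<^sup>+x. ennreal (norm (f x - step i f x)) \<partial>total_variation \<mu>) \<longlonglongrightarrow> 0"
proof -
  interpret finite_measure "total_variation \<mu>" by (rule finite_measure_total_variation[OF \<mu>])
  obtain K where K: "continuous_on UNIV f" "K \<ge> 0" "\<And>x. norm (f x) \<le> K"
    using bounded_continuousE[OF f] by metis
  have "(\<lambda>i. \<integral>\<^sup>+x. ennreal (norm (f x - step i f x)) \<partial>total_variation \<mu>)
      \<longlonglongrightarrow> (\<integral>\<^sup>+x. 0 \<partial>total_variation \<mu>)"
  proof (rule nn_integral_dominated_convergence[where w = "\<lambda>_. ennreal (2 * K)"])
    show "(\<lambda>x. ennreal (norm (f x - step i f x))) \<in> borel_measurable (total_variation \<mu>)" for i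
      using borel_measurable_norm_diff_simple[OF borel_measurable_continuous_onI[OF K(1)] simple_function_step]
      by (auto intro!: measurable_compose[OF _ measurable_ennreal])
    show "AE x in total_variation \<mu>. ennreal (norm (f x - step j f x)) \<le> ennreal (2 * K)" for j
    proof (intro AE_I2 ennreal_leI)
      fix x
      show "norm (f x - step j f x) \<le> 2 * K"
        using norm_triangle_ineq4[of "f x" "step j f x"] norm_step_le[of f K j x, OF K(3)] K(3)[of x]
        by linarith
    qed
    show "(\<integral>\<^sup>+ x. ennreal (2 * K) \<partial>total_variation \<mu>) < \<infinity>"
      using emeasure_finite[of UNIV] by (simp add: ennreal_mult_less_top top.not_eq_extremum del: emeasure_finite)
    show "AE x in total_variation \<mu>. (\<lambda>i. ennreal (norm (f x - step i f x))) \<longlonglongrightarrow> 0"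
    proof (rule AE_I2)
      fix x
      have "(\<lambda>i. norm (f x - step i f x)) \<longlonglongrightarrow> norm (f x - f x)"
        by (intro tendsto_intros step_tendsto K)
      then show "(\<lambda>i. ennreal (norm (f x - step i f x))) \<longlonglongrightarrow> 0"
        using tendsto_ennrealI[of "\<lambda>i. norm (f x - step i f x)" 0 sequentially] by simp
    qed
  qed auto
  then show ?thesis by simp
qed

lemma cm_integral_tendsto:
  assumes \<mu>: "complex_borel_measure \<mu>" and f: "bounded_continuous f"
  shows "(\<lambda>i. simple_cm_integral \<mu> (step i f)) \<longlonglongrightarrow> cm_integral \<mu> f"
proof -
  have meas: "f \<in> borel_measurable borel"
    using f by (intro borel_measurable_continuous_onI) (simp add: bounded_continuous_def)
  define e where "e i = (\<integral>\<^sup>+x. ennreal (norm (f x - step i f x)) \<partial>total_variation \<mu>)" for i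
  have e: "e \<longlonglongrightarrow> 0" unfolding e_def using step_L1[OF \<mu> f] .
  have "Cauchy (\<lambda>i. simple_cm_integral \<mu> (step i f))"
  proof (rule metric_CauchyI)
    fix r :: real assume "r > 0"
    then have "eventually (\<lambda>i. e i < ennreal (r / 2)) sequentially"
      using e by (intro order_tendstoD) auto
    then obtain N where N: "\<And>i. i \<ge> N \<Longrightarrow> e i < ennreal (r / 2)"
      by (auto simp: eventually_sequentially)
    have "dist (simple_cm_integral \<mu> (step m f)) (simple_cm_integral \<mu> (step n f)) < r"
      if "m \<ge> N" "n \<ge> N" for m n
    proof -
      have "ennreal (norm (simple_cm_integral \<mu> (step m f) - simple_cm_integral \<mu> (step n f))) \<le> e m + e n"
        unfolding e_def by (rule simple_cm_integral_dist[OF \<mu> meas simple_function_step simple_function_step])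
      also have "\<dots> < ennreal (r / 2) + ennreal (r / 2)"
        using N that by (intro add_strict_mono)
      also have "\<dots> = ennreal r" using \<open>r > 0\<close> by (simp add: ennreal_plus[symmetric] del: ennreal_plus)
      finally show ?thesis by (simp add: dist_norm ennreal_less_iff)
    qed
    then show "\<exists>M. \<forall>m\<ge>M. \<forall>n\<ge>M. dist (simple_cm_integral \<mu> (step m f)) (simple_cm_integral \<mu> (step n f)) < r"
      by blast
  qed
  then obtain y where y: "(\<lambda>i. simple_cm_integral \<mu> (step i f)) \<longlonglongrightarrow> y"
    using Cauchy_convergent_iff convergent_def by blast
  have has: "has_cm_integral \<mu> f y"
    unfolding has_cm_integral_def
    by (intro conjI exI[of _ "\<lambda>i. step i f"] allI meas simple_function_step step_L1[OF \<mu> f] y)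
  then have "cm_integral \<mu> f = y"
    unfolding cm_integral_def using has_cm_integral_unique[OF \<mu>] by blast
  with y show ?thesis by simp
qed

lemma norm_cm_integral_le_nn:
  assumes \<mu>: "complex_borel_measure \<mu>" and f: "bounded_continuous f"
  shows "ennreal (norm (cm_integral \<mu> f)) \<le> (\<integral>\<^sup>+x. ennreal (norm (f x)) \<partial>total_variation \<mu>)"
proof -
  have meas: "f \<in> borel_measurable borel"
    using f by (intro borel_measurable_continuous_onI) (simp add: bounded_continuous_def)
  have s0: "simple_function borel (\<lambda>_. 0 :: 'a)" by simp
  have "simple_cm_integral \<mu> (\<lambda>_. 0 :: 'a) = 0"
    by (simp add: simple_cm_integral_def)
  then have *: "ennreal (norm (simple_cm_integral \<mu> (step i f)))
    \<le> (\<integral>\<^sup>+x. ennreal (norm (f x - step i f x)) \<partial>total_variation \<mu>) + (\<integral>\<^sup>+x. ennreal (norm (f x)) \<partial>total_variation \<mu>)" for i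
    using simple_cm_integral_dist[OF \<mu> meas simple_function_step s0, of i f] by simp
  have "(\<lambda>i. ennreal (norm (simple_cm_integral \<mu> (step i f)))) \<longlonglongrightarrow> ennreal (norm (cm_integral \<mu> f))"
    by (intro tendsto_intros cm_integral_tendsto assms)
  moreover have "(\<lambda>i. (\<integral>\<^sup>+x. ennreal (norm (f x - step i f x)) \<partial>total_variation \<mu>) + (\<integral>\<^sup>+x. ennreal (norm (f x)) \<partial>total_variation \<mu>))
      \<longlonglongrightarrow> 0 + (\<integral>\<^sup>+x. ennreal (norm (f x)) \<partial>total_variation \<mu>)"
    by (intro tendsto_add step_L1 assms tendsto_const)
  ultimately have "ennreal (norm (cm_integral \<mu> f)) \<le> 0 + (\<integral>\<^sup>+x. ennreal (norm (f x)) \<partial>total_variation \<mu>)"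
    by (rule LIMSEQ_le) (use * in auto)
  then show ?thesis by simp
qed

lemma norm_cm_integral_le:
  assumes \<mu>: "complex_borel_measure \<mu>" and f: "bounded_continuous f"
    and S: "S \<in> sets borel" and le: "\<And>x. x \<notin> S \<Longrightarrow> norm (f x) \<le> d" "\<And>x. norm (f x) \<le> K" and "d \<ge> 0"
  shows "norm (cm_integral \<mu> f) \<le> d * measure (total_variation \<mu>) UNIV + K * measure (total_variation \<mu>) S"
proof -
  interpret finite_measure "total_variation \<mu>" by (rule finite_measure_total_variation[OF \<mu>])
  have K: "K \<ge> 0" using le(2)[of 0] norm_ge_zero order_trans by blast
  have "ennreal (norm (cm_integral \<mu> f)) \<le> (\<integral>\<^sup>+x. ennreal (norm (f x)) \<partial>total_variation \<mu>)"
    by (rule norm_cm_integral_le_nn[OF \<mu> f])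
  also have "\<dots> \<le> (\<integral>\<^sup>+x. ennreal d * indicator UNIV x + ennreal K * indicator S x \<partial>total_variation \<mu>)"
  proof (rule nn_integral_mono)
    fix x
    show "ennreal (norm (f x)) \<le> ennreal d * indicator UNIV x + ennreal K * indicator S x"
      using le[of x] \<open>d \<ge> 0\<close> K
      by (cases "x \<in> S") (auto intro!: ennreal_leI simp: ennreal_plus[symmetric] simp del: ennreal_plus)
  qed
  also have "\<dots> = ennreal d * emeasure (total_variation \<mu>) UNIV + ennreal K * emeasure (total_variation \<mu>) S"
    using S by (subst nn_integral_add) (auto simp: nn_integral_cmult_indicator)
  also have "\<dots> = ennreal (d * measure (total_variation \<mu>) UNIV + K * measure (total_variation \<mu>) S)"
    using \<open>d \<ge> 0\<close> K by (simp add: emeasure_eq_measure ennreal_mult ennreal_plus)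
  finally show ?thesis
    using \<open>d \<ge> 0\<close> K by (subst (asm) ennreal_le_iff) auto
qed

lemma total_variation_tail:
  assumes \<mu>: "complex_borel_measure \<mu>" and "e > 0"
  shows "\<exists>L\<ge>0. measure (total_variation \<mu>) (- {-L..L}) < e"
proof -
  interpret finite_measure "total_variation \<mu>" by (rule finite_measure_total_variation[OF \<mu>])
  have "(\<lambda>n. measure (total_variation \<mu>) (- {- real n..real n})) \<longlonglongrightarrow>
      measure (total_variation \<mu>) (\<Inter>n. - {- real n..real n})"
    by (rule finite_Lim_measure_decseq) (auto simp: decseq_def)
  moreover have "(\<Inter>n. - {- real n..real n}) = {}"
  proof (intro equals0I)
    fix x :: real assume "x \<in> (\<Inter>n. - {- real n..real n})"
    then have "x \<notin> {- real (nat \<lceil>\<bar>x\<bar>\<rceil>)..real (nat \<lceil>\<bar>x\<bar>\<rceil>)}" by blast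
    then show False by (auto simp: not_le) linarith+
  qed
  ultimately have "eventually (\<lambda>n. measure (total_variation \<mu>) (- {- real n..real n}) < e) sequentially"
    using \<open>e > 0\<close> by (intro order_tendstoD) auto
  then show ?thesis
    by (auto simp: eventually_sequentially intro: exI[of _ "real _"])
qed

lemma cm_integral_linear:
  assumes \<mu>: "complex_borel_measure \<mu>" and f: "bounded_continuous f"
    and T: "bounded_linear T" "\<And>a x. T (a *\<^sub>C x) = a *\<^sub>C T x"
  shows "cm_integral \<mu> (\<lambda>x. T (f x)) = T (cm_integral \<mu> f)"
proof -
  interpret T: bounded_linear T by fact
  have "step i (\<lambda>x. T (f x)) = (\<lambda>x. T (step i f x))" for i
    by (auto simp: step_def fun_eq_iff grid_value_def T.zero split: option.splits)
  then have "simple_cm_integral \<mu> (step i (\<lambda>x. T (f x))) = T (simple_cm_integral \<mu> (step i f))" for i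
    using simple_cm_integral_comp[OF \<mu> simple_function_step, of T i f]
    by (simp add: simple_cm_integral_def T.sum T(2))
  then have "(\<lambda>i. T (simple_cm_integral \<mu> (step i f))) \<longlonglongrightarrow> cm_integral \<mu> (\<lambda>x. T (f x))"
    using cm_integral_tendsto[OF \<mu> bounded_continuous_linear[OF T(1) f]] by simp
  moreover have "(\<lambda>i. T (simple_cm_integral \<mu> (step i f))) \<longlonglongrightarrow> T (cm_integral \<mu> f)"
    by (intro T.tendsto cm_integral_tendsto \<mu> f)
  ultimately show ?thesis by (rule LIMSEQ_unique)
qed

lemma cm_integral_diff:
  assumes \<mu>: "complex_borel_measure \<mu>" and f: "bounded_continuous f" and g: "bounded_continuous g"
  shows "cm_integral \<mu> (\<lambda>x. f x - g x) = cm_integral \<mu> f - cm_integral \<mu> g"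
proof -
  have "step i (\<lambda>x. f x - g x) = (\<lambda>x. step i f x - step i g x)" for i
    by (auto simp: step_def fun_eq_iff grid_value_def split: option.splits)
  then have "(\<lambda>i. simple_cm_integral \<mu> (step i f) - simple_cm_integral \<mu> (step i g))
      \<longlonglongrightarrow> cm_integral \<mu> (\<lambda>x. f x - g x)"
    using cm_integral_tendsto[OF \<mu> bounded_continuous_diff[OF f g]]
    by (simp add: simple_cm_integral_diff[OF \<mu> simple_function_step simple_function_step])
  moreover have "(\<lambda>i. simple_cm_integral \<mu> (step i f) - simple_cm_integral \<mu> (step i g))
      \<longlonglongrightarrow> cm_integral \<mu> f - cm_integral \<mu> g"
    by (intro tendsto_intros cm_integral_tendsto \<mu> f g)
  ultimately show ?thesis by (rule LIMSEQ_unique)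
qed

lemma complex_borel_measure_diff:
  assumes "complex_borel_measure \<mu>" "complex_borel_measure \<nu>"
  shows "complex_borel_measure (\<lambda>E. \<mu> E - \<nu> E)"
  using assms unfolding complex_borel_measure_def by (simp add: sums_diff)

lemma cm_integral_diff_measure:
  assumes \<mu>: "complex_borel_measure \<mu>" and \<nu>: "complex_borel_measure \<nu>" and f: "bounded_continuous f"
  shows "cm_integral (\<lambda>E. \<mu> E - \<nu> E) f = cm_integral \<mu> f - cm_integral \<nu> f"
proof -
  have "simple_cm_integral (\<lambda>E. \<mu> E - \<nu> E) s = simple_cm_integral \<mu> s - simple_cm_integral \<nu> s" for s :: "real \<Rightarrow> 'a"
    by (simp add: simple_cm_integral_def scaleC_diff_left sum_subtractf)
  then have "(\<lambda>i. simple_cm_integral \<mu> (step i f) - simple_cm_integral \<nu> (step i f))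
      \<longlonglongrightarrow> cm_integral (\<lambda>E. \<mu> E - \<nu> E) f"
    using cm_integral_tendsto[OF complex_borel_measure_diff[OF \<mu> \<nu>] f] by simp
  moreover have "(\<lambda>i. simple_cm_integral \<mu> (step i f) - simple_cm_integral \<nu> (step i f))
      \<longlonglongrightarrow> cm_integral \<mu> f - cm_integral \<nu> f"
    by (intro tendsto_intros cm_integral_tendsto \<mu> \<nu> f)
  ultimately show ?thesis by (rule LIMSEQ_unique)
qed

section \<open>Cosine polynomials\<close>

text \<open>
  A list of pairs \<open>(\<theta>, c)\<close> stands for the vector-valued cosine polynomial with the terms \<open>cos (\<theta> s) c\<close>, and
  \<open>ceval f\<close> replaces each factor \<open>cos (\<theta> s)\<close> by \<open>f \<theta>\<close>. With lists, repeated frequencies are allowed and addition is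
  concatenation.
\<close>

definition ceval :: "(real \<Rightarrow> complex) \<Rightarrow> (real \<times> 'a::complex_banach) list \<Rightarrow> 'a" where
  "ceval f ps = (\<Sum>(\<theta>, c)\<leftarrow>ps. f \<theta> *\<^sub>C c)"

abbreviation cpoly :: "(real \<times> 'a::complex_banach) list \<Rightarrow> real \<Rightarrow> 'a" where
  "cpoly ps s \<equiv> ceval (\<lambda>\<theta>. complex_of_real (cos (s * \<theta>))) ps"

lemma ceval_Nil [simp]: "ceval f [] = 0"
  by (simp add: ceval_def)

lemma ceval_Cons [simp]: "ceval f (p # ps) = f (fst p) *\<^sub>C snd p + ceval f ps"
  by (simp add: ceval_def split_beta)

lemma ceval_append [simp]: "ceval f (ps @ qs) = ceval f ps + ceval f qs"
  by (simp add: ceval_def)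

lemma ceval_map_weight: "ceval f (map (\<lambda>(\<theta>, c). (\<theta>, g \<theta> *\<^sub>C c)) ps) = ceval (\<lambda>\<theta>. f \<theta> * g \<theta>) ps"
  by (induction ps) (auto simp: scaleC_scaleC)

lemma ceval_map_scale: "ceval f (map (\<lambda>(\<theta>, c). (\<theta>, a *\<^sub>C c)) ps) = a *\<^sub>C ceval f ps"
  by (induction ps) (auto simp: scaleC_scaleC scaleC_add_right mult.commute)

lemma ceval_scale: "ceval (\<lambda>\<theta>. a * f \<theta>) ps = a *\<^sub>C ceval f ps"
  by (induction ps) (auto simp: scaleC_scaleC[symmetric] scaleC_add_right)

lemma ceval_add: "ceval (\<lambda>\<theta>. f \<theta> + g \<theta>) ps = ceval f ps + ceval g ps"
  by (induction ps) (auto simp: scaleC_add_left)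

definition cosine_polynomial :: "(real \<Rightarrow> 'a::complex_banach) \<Rightarrow> bool" where
  "cosine_polynomial h \<longleftrightarrow> (\<exists>ps. \<forall>s. h s = cpoly ps s)"

lemma cosine_polynomial_const: "cosine_polynomial (\<lambda>s. c)"
  unfolding cosine_polynomial_def by (rule exI[of _ "[(0, c)]"]) simp

lemma cosine_polynomial_add:
  assumes "cosine_polynomial g" "cosine_polynomial h"
  shows "cosine_polynomial (\<lambda>s. g s + h s)"
  using assms unfolding cosine_polynomial_def by (metis ceval_append)

lemma cosine_polynomial_scaleR:
  assumes "cosine_polynomial h"
  shows "cosine_polynomial (\<lambda>s. r *\<^sub>R h s)"
  using assms unfolding cosine_polynomial_def scaleR_scaleC by (metis ceval_map_scale)

lemma cosine_polynomial_sum: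
  assumes "\<And>i. i \<in> I \<Longrightarrow> cosine_polynomial (h i)"
  shows "cosine_polynomial (\<lambda>s. \<Sum>i\<in>I. h i s)"
  using assms
  by (induction I rule: infinite_finite_induct)
    (auto intro: cosine_polynomial_const cosine_polynomial_add)

lemma cosine_polynomial_cos_mult:
  assumes "cosine_polynomial h"
  shows "cosine_polynomial (\<lambda>s. cos (s * \<tau>) *\<^sub>R h s)"
proof -
  obtain ps where h: "\<And>s. h s = cpoly ps s"
    using assms unfolding cosine_polynomial_def by blast
  have "\<exists>qs. \<forall>s. cos (s * \<tau>) *\<^sub>R cpoly ps s = cpoly qs s"
  proof (induction ps)
    case Nil
    show ?case by (rule exI[of _ "[]"]) simp
  next
    case (Cons p ps)
    then obtain qs where qs: "\<And>s. cos (s * \<tau>) *\<^sub>R cpoly ps s = cpoly qs s" by blast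
    obtain \<theta> c where p: "p = (\<theta>, c)" by (cases p)
    have "cos (s * \<tau>) *\<^sub>R (complex_of_real (cos (s * \<theta>)) *\<^sub>C c)
        = complex_of_real (cos (s * (\<theta> + \<tau>))) *\<^sub>C ((1 / 2) *\<^sub>R c)
          + complex_of_real (cos (s * (\<theta> - \<tau>))) *\<^sub>C ((1 / 2) *\<^sub>R c)" for s
    proof -
      have "cos (s * \<tau>) * cos (s * \<theta>) = cos (s * (\<theta> + \<tau>)) * (1 / 2) + cos (s * (\<theta> - \<tau>)) * (1 / 2)"
        by (simp add: distrib_left right_diff_distrib cos_add cos_diff field_simps)
      then show ?thesis
        unfolding scaleR_scaleC[symmetric] scaleR_scaleR scaleR_add_left[symmetric] by simp
    qed
    then have "cos (s * \<tau>) *\<^sub>R cpoly (p # ps) s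
        = cpoly ((\<theta> + \<tau>, (1 / 2) *\<^sub>R c) # (\<theta> - \<tau>, (1 / 2) *\<^sub>R c) # qs) s" for s
      by (simp add: p scaleR_add_right qs)
    then show ?case by blast
  qed
  then show ?thesis unfolding cosine_polynomial_def h .
qed

text \<open>
  The classical proof by the variance of the binomial distribution uses only norms of the values.
\<close>

lemma Bernstein_Weierstrass_vector:
  fixes f :: "real \<Rightarrow> 'a::real_normed_vector"
  assumes contf: "continuous_on {0..1} f" and e: "0 < e"
  shows "\<exists>n. \<forall>x\<in>{0..1}. norm (f x - (\<Sum>k\<le>n. Bernstein n k x *\<^sub>R f (k / n))) \<le> e"
proof -
  have "bounded (f ` {0..1})"
    using compact_continuous_image compact_imp_bounded contf by blast
  then obtain M where M: "\<And>x. x \<in> {0..1} \<Longrightarrow> norm (f x) \<le> M"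
    by (force simp add: bounded_iff)
  have "0 \<le> M" using order_trans[OF norm_ge_zero M[of 0]] by simp
  have uc: "uniformly_continuous_on {0..1} f"
    using compact_uniformly_continuous contf by blast
  have "\<exists>d>0. \<forall>x\<in>{0..1}. \<forall>y\<in>{0..1}. dist y x < d \<longrightarrow> dist (f y) (f x) < e / 2"
    using uc[unfolded uniformly_continuous_on_def, rule_format, OF half_gt_zero[OF e]] .
  then obtain d where d: "d > 0"
    and d': "\<forall>x\<in>{0..1}. \<forall>y\<in>{0..1}. dist y x < d \<longrightarrow> dist (f y) (f x) < e / 2"
    by (elim exE conjE)
  define n where "n = Suc (nat \<lceil>4 * M / (e * d\<^sup>2)\<rceil>)"
  have n: "real n > 0" "4 * M / (e * d\<^sup>2) \<le> real n"
    unfolding n_def of_nat_Suc using real_nat_ceiling_ge[of "4 * M / (e * d\<^sup>2)"] by linarith+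
  have "norm (f x - (\<Sum>k\<le>n. Bernstein n k x *\<^sub>R f (k / n))) \<le> e" if x: "x \<in> {0..1}" for x
  proof -
    have var: "(\<Sum>k\<le>n. (x - k / n)\<^sup>2 * Bernstein n k x) = x * (1 - x) / n"
    proof -
      have "(\<Sum>k\<le>n. (k - n * x)\<^sup>2 * Bernstein n k x)
          = (\<Sum>k\<le>n. real k * (real k - 1) * Bernstein n k x + (1 - 2 * (n * x)) * (real k * Bernstein n k x)
              + (n * x)\<^sup>2 * Bernstein n k x)"
        by (rule sum.cong) (auto simp: algebra_simps power2_eq_square)
      also have "\<dots> = n * x * (1 - x)"
        by (simp add: sum.distrib sum_distrib_left[symmetric] del: sum_distrib_left)
          (simp add: algebra_simps power2_eq_square)
      finally have "(\<Sum>k\<le>n. (k - n * x)\<^sup>2 * Bernstein n k x) / n\<^sup>2 = x * (1 - x) / n"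
        by (simp add: power2_eq_square)
      moreover have "(\<Sum>k\<le>n. (k - n * x)\<^sup>2 * Bernstein n k x) / n\<^sup>2 = (\<Sum>k\<le>n. (x - k / n)\<^sup>2 * Bernstein n k x)"
        unfolding sum_divide_distrib
      proof (rule sum.cong[OF refl])
        fix k
        have "(real k - n * x) = - n * (x - k / n)" using n(1) by (simp add: field_simps)
        then show "(k - n * x)\<^sup>2 * Bernstein n k x / n\<^sup>2 = (x - k / n)\<^sup>2 * Bernstein n k x"
          using n(1) by (simp add: power_mult_distrib)
      qed
      ultimately show ?thesis by simp
    qed
    have le: "norm (f x - f (k / n)) \<le> e / 2 + 2 * M / d\<^sup>2 * (x - k / n)\<^sup>2" if k: "k \<le> n" for k
    proof -
      have kn: "k / n \<in> {0..1}" using k n by (auto simp: field_split_simps)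
      show ?thesis
      proof (cases "\<bar>x - k / n\<bar> < d")
        case True
        then have "norm (f x - f (k / n)) < e / 2" using d' kn x by (simp add: dist_norm norm_minus_commute abs_minus_commute)
        then show ?thesis using \<open>0 \<le> M\<close> by (simp add: add_increasing2)
      next
        case False
        then have "1 \<le> (x - k / n)\<^sup>2 / d\<^sup>2"
          using d abs_le_square_iff[of d "x - k / n"] by simp
        then have "2 * M * 1 \<le> 2 * M * ((x - k / n)\<^sup>2 / d\<^sup>2)"
          using \<open>0 \<le> M\<close> by (intro mult_left_mono) auto
        moreover have "norm (f x - f (k / n)) \<le> 2 * M"
          using norm_triangle_ineq4[of "f x" "f (k / n)"] M[OF x] M[OF kn] by linarith
        ultimately show ?thesis using e by simp
      qed
    qed
    have "f x = (\<Sum>k\<le>n. Bernstein n k x *\<^sub>R f x)"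
      by (simp add: scaleR_sum_left[symmetric])
    then have "f x - (\<Sum>k\<le>n. Bernstein n k x *\<^sub>R f (k / n)) = (\<Sum>k\<le>n. Bernstein n k x *\<^sub>R (f x - f (k / n)))"
      by (simp add: scaleR_diff_right sum_subtractf)
    also have "norm \<dots> \<le> (\<Sum>k\<le>n. Bernstein n k x * (e / 2 + 2 * M / d\<^sup>2 * (x - k / n)\<^sup>2))"
    proof (rule sum_norm_le)
      fix k assume "k \<in> {..n}"
      then show "norm (Bernstein n k x *\<^sub>R (f x - f (k / n))) \<le> Bernstein n k x * (e / 2 + 2 * M / d\<^sup>2 * (x - k / n)\<^sup>2)"
        using le[of k] Bernstein_nonneg[of x n k] x by (simp add: mult_left_mono)
    qed
    also have "\<dots> = (\<Sum>k\<le>n. e / 2 * Bernstein n k x + 2 * M / d\<^sup>2 * ((x - k / n)\<^sup>2 * Bernstein n k x))"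
      by (rule sum.cong) (auto simp: algebra_simps)
    also have "\<dots> = e / 2 + 2 * M / d\<^sup>2 * (x * (1 - x) / n)"
      by (simp only: sum.distrib sum_distrib_left[symmetric] sum_Bernstein var mult_1_right)
    also have "\<dots> \<le> e / 2 + 2 * M / d\<^sup>2 * (1 / n)"
    proof -
      have "x * (1 - x) \<le> 1" using x mult_le_one[of x "1 - x"] by simp
      then show ?thesis
        using \<open>0 \<le> M\<close> by (intro add_left_mono mult_left_mono divide_right_mono) auto
    qed
    also have "\<dots> \<le> e / 2 + e / 2"
    proof -
      have "4 * M \<le> real n * (e * d\<^sup>2)"
        using n(2) e d by (simp add: pos_divide_le_eq)
      then have "2 * M / d\<^sup>2 * (1 / n) \<le> e / 2"
        using n(1) d by (simp add: field_simps)
      then show ?thesis by simp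
    qed
    finally show ?thesis by simp
  qed
  then show ?thesis by blast
qed

lemma cosine_polynomial_Bernstein:
  "cosine_polynomial (\<lambda>s. Bernstein n k ((1 + cos (s * \<tau>)) / 2) *\<^sub>R c)"
proof -
  have up: "cosine_polynomial (\<lambda>s. ((1 + cos (s * \<tau>)) / 2) *\<^sub>R h s)"
    and um: "cosine_polynomial (\<lambda>s. (1 - (1 + cos (s * \<tau>)) / 2) *\<^sub>R h s)"
    if h: "cosine_polynomial h" for h :: "real \<Rightarrow> 'a"
  proof -
    have "cosine_polynomial (\<lambda>s. (1 / 2) *\<^sub>R (h s + r *\<^sub>R (cos (s * \<tau>) *\<^sub>R h s)))" for r
      by (intro cosine_polynomial_scaleR cosine_polynomial_add cosine_polynomial_cos_mult h)
    moreover have "(1 / 2) *\<^sub>R (h s + r *\<^sub>R (cos (s * \<tau>) *\<^sub>R h s)) = ((1 + r * cos (s * \<tau>)) / 2) *\<^sub>R h s"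
      for r s
      by (simp add: scaleR_add_right scaleR_add_left add_divide_distrib)
    ultimately have *: "cosine_polynomial (\<lambda>s. ((1 + r * cos (s * \<tau>)) / 2) *\<^sub>R h s)" for r
      by simp
    show "cosine_polynomial (\<lambda>s. ((1 + cos (s * \<tau>)) / 2) *\<^sub>R h s)"
      using *[of 1] by simp
    have "(1 + -1 * cos (s * \<tau>)) / 2 = 1 - (1 + cos (s * \<tau>)) / 2" for s
      by (simp add: field_simps)
    then show "cosine_polynomial (\<lambda>s. (1 - (1 + cos (s * \<tau>)) / 2) *\<^sub>R h s)"
      using *[of "-1"] by (simp only:)
  qed
  have "cosine_polynomial (\<lambda>s. (((1 + cos (s * \<tau>)) / 2) ^ i * (1 - (1 + cos (s * \<tau>)) / 2) ^ j) *\<^sub>R c)" for i j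
  proof (induction i)
    case 0
    show ?case
    proof (induction j)
      case (Suc j)
      from um[OF this] show ?case by (simp add: mult.assoc)
    qed (simp add: cosine_polynomial_const)
  next
    case (Suc i)
    from up[OF this] show ?case by (simp add: mult.assoc)
  qed
  from cosine_polynomial_scaleR[OF this[of k "n - k"], of "real (n choose k)"]
  show ?thesis by (simp add: Bernstein_def mult.assoc)
qed

text \<open>
  On \<open>[-L, L]\<close> an even function is a continuous function of \<open>u = (1 + cos (\<pi> s / L)) / 2\<close>, and Bernstein
  polynomials in \<open>u\<close> are cosine polynomials. These are periodic, so outside the interval they take
  no values that they do not take inside; this is what keeps them bounded on the whole line.
\<close>

lemma cosine_polynomial_approx:
  fixes G :: "real \<Rightarrow> 'a::complex_banach"
  assumes cont: "continuous_on UNIV G" and even: "\<And>s. G (- s) = G s" and L: "L > 0" and e: "e > 0"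
  obtains ps where "\<And>s. \<bar>s\<bar> \<le> L \<Longrightarrow> norm (cpoly ps s - G s) \<le> e"
    and "\<And>s. \<exists>s'. \<bar>s'\<bar> \<le> L \<and> cpoly ps s = cpoly ps s'"
proof -
  define u where "u s = (1 + cos (s * (pi / L))) / 2" for s
  define fold where "fold s = L / pi * arccos (cos (s * (pi / L)))" for s
  define H where "H x = G (L / pi * arccos (2 * x - 1))" for x
  have u: "u s \<in> {0..1}" for s
  proof -
    have "(1 + c) / 2 \<in> {0..1}" if "- 1 \<le> c" "c \<le> 1" for c :: real
      using that by auto
    from this[OF cos_ge_minus_one cos_le_one] show ?thesis unfolding u_def .
  qed
  have Hu: "H (u s) = G (fold s)" for s
  proof -
    have "2 * ((1 + c) / 2) - 1 = c" for c :: real by (simp add: field_simps)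
    then show ?thesis by (simp only: H_def u_def fold_def)
  qed
  have fold_eq: "fold s = \<bar>s\<bar>" if "\<bar>s\<bar> \<le> L" for s
  proof -
    have "cos (s * (pi / L)) = cos (\<bar>s\<bar> * (pi / L))"
      by (cases "s \<ge> 0") auto
    moreover have "arccos (cos (\<bar>s\<bar> * (pi / L))) = \<bar>s\<bar> * (pi / L)"
      using that L by (intro arccos_cos) (auto simp: field_simps)
    ultimately show ?thesis using L by (simp add: fold_def)
  qed
  have fold_le: "\<bar>fold s\<bar> \<le> L" "cos (fold s * (pi / L)) = cos (s * (pi / L))" for s
    using L arccos_lbound[of "cos (s * (pi / L))"] arccos_ubound[of "cos (s * (pi / L))"]
    by (simp_all add: fold_def abs_mult field_simps cos_arccos_abs abs_of_nonneg)
  have "continuous_on {0..1} H"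
    unfolding H_def
    by (intro continuous_on_compose2[OF cont] continuous_intros) auto
  then obtain n where n: "\<And>x. x \<in> {0..1} \<Longrightarrow> norm (H x - (\<Sum>k\<le>n. Bernstein n k x *\<^sub>R H (k / n))) \<le> e"
    using Bernstein_Weierstrass_vector e by blast
  have "cosine_polynomial (\<lambda>s. \<Sum>k\<le>n. Bernstein n k (u s) *\<^sub>R H (k / n))"
    unfolding u_def by (intro cosine_polynomial_sum cosine_polynomial_Bernstein)
  then obtain ps where ps: "\<And>s. (\<Sum>k\<le>n. Bernstein n k (u s) *\<^sub>R H (k / n)) = cpoly ps s"
    unfolding cosine_polynomial_def by blast
  show thesis
  proof
    fix s
    show "norm (cpoly ps s - G s) \<le> e" if "\<bar>s\<bar> \<le> L"
    proof -
      have "G s = H (u s)"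
        using fold_eq[OF that] even[of s] Hu[of s] by (cases "s \<ge> 0") auto
      then show ?thesis
        using n[OF u] ps[of s] by (metis norm_minus_commute)
    qed
    have "u s = u (fold s)" by (simp only: u_def fold_le)
    then have "cpoly ps s = cpoly ps (fold s)" using ps by metis
    then show "\<exists>s'. \<bar>s'\<bar> \<le> L \<and> cpoly ps s = cpoly ps s'" using fold_le by blast
  qed
qed

section \<open>Operators represented by functions\<close>

locale bounded_cosine =
  fixes Cos :: "real \<Rightarrow> 'a::complex_banach \<Rightarrow>\<^sub>L 'a" and M :: real
  assumes cosine: "cosine_function Cos"
    and norm_Cos: "norm (Cos t) \<le> M"
begin

lemma Cos_scaleC: "Cos t (a *\<^sub>C x) = a *\<^sub>C Cos t x"
  using cosine by (simp add: cosine_function_def)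

lemma Cos_continuous: "continuous_on UNIV (\<lambda>t. Cos t x)"
  using cosine by (simp add: cosine_function_def)

lemma Cos_0 [simp]: "Cos 0 x = x"
  using cosine by (simp add: cosine_function_def)

lemma Cos_Cos: "Cos (t + s) x + Cos (t - s) x = 2 *\<^sub>R Cos t (Cos s x)"
proof -
  have "Cos (t + s) + Cos (t - s) = 2 *\<^sub>R (Cos t o\<^sub>L Cos s)"
    using cosine by (simp add: cosine_function_def)
  from arg_cong[OF this, of "\<lambda>F. blinfun_apply F x"] show ?thesis
    by (simp add: blinfun.add_left blinfun.scaleR_left)
qed

lemma Cos_minus: "Cos (- s) x = Cos s x"
  using Cos_Cos[of 0 s x] by (simp add: scaleR_2)

lemma Cos_commute: "Cos t (Cos s x) = Cos s (Cos t x)"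
proof -
  have "Cos (t - s) x = Cos (s - t) x" using Cos_minus[of "s - t"] by simp
  then have "2 *\<^sub>R Cos t (Cos s x) = 2 *\<^sub>R Cos s (Cos t x)"
    using Cos_Cos[of t s x] Cos_Cos[of s t x] by (simp add: add.commute)
  then show ?thesis by simp
qed

lemma M_nonneg: "M \<ge> 0"
  using norm_Cos[of 0] norm_ge_zero order_trans by blast

lemma norm_Cos_le: "norm (Cos t x) \<le> M * norm x"
  using norm_blinfun[of "Cos t" x] norm_Cos[of t] mult_right_mono[OF norm_Cos[of t] norm_ge_zero[of x]]
  by linarith

lemma bounded_continuous_Cos: "bounded_continuous (\<lambda>s. Cos s x)"
  using Cos_continuous norm_Cos_le by (rule bounded_continuousI)

text \<open>
  A cosine polynomial follows an orbit closely on a bounded interval only; elsewhere all that can be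
  asked for is a crude bound, so two errors are recorded.
\<close>

definition cpoly_near :: "real \<Rightarrow> real \<Rightarrow> real \<Rightarrow> 'a \<Rightarrow> (real \<times> 'a) list \<Rightarrow> bool" where
  "cpoly_near L d K x ps \<longleftrightarrow>
     (\<forall>s. \<bar>s\<bar> \<le> L \<longrightarrow> norm (cpoly ps s - Cos s x) \<le> d) \<and> (\<forall>s. norm (cpoly ps s - Cos s x) \<le> K)"

text \<open>
  If \<open>f\<close> is the cosine transform of \<open>\<mu>\<close> and \<open>T\<close> averages \<open>Cos\<close> with respect to \<open>\<mu>\<close>, then the error of \<open>ceval f ps\<close> is the
  integral of \<open>cpoly ps s - Cos s x\<close>: the local error \<open>d\<close> is multiplied by the total mass of \<open>\<mu>\<close>, and the global error
  \<open>K\<close> only by the small mass outside \<open>[-L, L]\<close>. The predicate \<open>represents\<close> below, which expresses \<open>\<Phi> f = T\<close>, keeps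
  this property and no longer mentions \<open>\<mu>\<close>; products can therefore be formed without convolving measures.
\<close>

definition estimate :: "(real \<Rightarrow> complex) \<Rightarrow> ('a \<Rightarrow> 'a) \<Rightarrow> real \<Rightarrow> (real \<Rightarrow> real) \<Rightarrow> bool" where
  "estimate f T C L \<longleftrightarrow> C \<ge> 0 \<and> (\<forall>e>0. L e \<ge> 0 \<and>
     (\<forall>ps x d K. cpoly_near (L e) d K x ps \<longrightarrow> norm (ceval f ps - T x) \<le> C * d + e * K))"

definition represents :: "(real \<Rightarrow> complex) \<Rightarrow> ('a \<Rightarrow> 'a) \<Rightarrow> bool" where
  "represents f T \<longleftrightarrow> (\<forall>s x. T (Cos s x) = Cos s (T x)) \<and> (\<exists>C L. estimate f T C L)"

lemma
  assumes "estimate f T C L"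
  shows estimate_const: "C \<ge> 0"
    and estimate_length: "e > 0 \<Longrightarrow> L e \<ge> 0"
    and estimateD: "e > 0 \<Longrightarrow> cpoly_near (L e) d K x ps \<Longrightarrow> norm (ceval f ps - T x) \<le> C * d + e * K"
  using assms by (auto simp: estimate_def)

lemma cpoly_near_mono: "cpoly_near L d K x ps \<Longrightarrow> L' \<le> L \<Longrightarrow> cpoly_near L' d K x ps"
  by (auto simp: cpoly_near_def)

lemma cpoly_near_mono_right: "cpoly_near L d K x ps \<Longrightarrow> K \<le> K' \<Longrightarrow> cpoly_near L d K' x ps"
  unfolding cpoly_near_def using order_trans by blast

lemma cpoly_near_nonneg:
  assumes "cpoly_near L d K x ps" "L \<ge> 0"
  shows "d \<ge> 0" "K \<ge> 0"
  using assms norm_ge_zero order_trans unfolding cpoly_near_def by (metis abs_zero, blast)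

lemma cpoly_near_exists:
  assumes "d > 0"
  shows "\<exists>ps. cpoly_near L d (2 * M * norm x + d) x ps"
proof -
  obtain ps where ps: "\<And>s. \<bar>s\<bar> \<le> max L 1 \<Longrightarrow> norm (cpoly ps s - Cos s x) \<le> d"
    "\<And>s. \<exists>s'. \<bar>s'\<bar> \<le> max L 1 \<and> cpoly ps s = cpoly ps s'"
    using cosine_polynomial_approx[OF Cos_continuous[of x] Cos_minus, of "max L 1" d] assms
    by (metis less_max_iff_disj zero_less_one)
  have "norm (cpoly ps s - Cos s x) \<le> 2 * M * norm x + d" for s
  proof -
    obtain s' where s': "\<bar>s'\<bar> \<le> max L 1" "cpoly ps s = cpoly ps s'" using ps(2) by blast
    have "norm (cpoly ps s - Cos s x) \<le> norm (cpoly ps s' - Cos s' x) + norm (Cos s' x - Cos s x)"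
      using norm_triangle_ineq[of "cpoly ps s' - Cos s' x" "Cos s' x - Cos s x"] s'(2) by simp
    also have "\<dots> \<le> d + (M * norm x + M * norm x)"
      using ps(1)[OF s'(1)] norm_triangle_ineq4[of "Cos s' x" "Cos s x"] norm_Cos_le[of s x] norm_Cos_le[of s' x]
      by linarith
    finally show ?thesis by simp
  qed
  then show ?thesis using ps(1) unfolding cpoly_near_def by (meson max.coboundedI1)
qed

lemma represents_Cos: "represents f T \<Longrightarrow> T (Cos s x) = Cos s (T x)"
  by (simp add: represents_def)

lemma representsE:
  assumes "represents f T"
  obtains C L where "estimate f T C L"
  using assms by (auto simp: represents_def)

lemma eq_of_norm_le:
  fixes x y :: 'a
  assumes "\<And>e. e > 0 \<Longrightarrow> norm (x - y) \<le> C * e" "C \<ge> 0"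
  shows "x = y"
proof (rule ccontr)
  assume "x \<noteq> y"
  then have pos: "norm (x - y) > 0" by simp
  have "norm (x - y) \<le> C * (norm (x - y) / (C + 1) / 2)"
    using pos assms(2) by (intro assms(1)) simp
  also have "\<dots> = norm (x - y) * (C / (C + 1) / 2)" by simp
  also have "\<dots> < norm (x - y) * 1"
    using pos assms(2) by (intro mult_strict_left_mono) (auto simp: field_simps)
  finally show False by simp
qed

text \<open>
  The orbit of \<open>x\<close> has cosine polynomials with arbitrarily small local error and one fixed global
  error, and both \<open>S x\<close> and \<open>T x\<close> are the limit of the corresponding values of \<open>ceval f\<close>. This contains the
  injectivity of the cosine transform as far as the calculus needs it.
\<close>

lemma represents_unique:
  assumes "represents f S" and "represents f T"
  shows "S = T"
proof
  fix x :: 'a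
  obtain C L1 where S: "estimate f S C L1" using assms(1) by (rule representsE)
  obtain D L2 where T: "estimate f T D L2" using assms(2) by (rule representsE)
  define K where "K = 2 * M * norm x + 1"
  show "S x = T x"
  proof (rule eq_of_norm_le)
    show "C + D + 2 * K \<ge> 0"
      using estimate_const[OF S] estimate_const[OF T] M_nonneg by (simp add: K_def)
    fix e :: real assume e: "e > 0"
    \<comment> \<open>the cap at \<open>1\<close> makes the global error \<open>K\<close> independent of \<open>e\<close>\<close>
    define d where "d = min e 1"
    obtain ps where "cpoly_near (max (L1 e) (L2 e)) d (2 * M * norm x + d) x ps"
      using cpoly_near_exists[of d "max (L1 e) (L2 e)" x] e by (auto simp: d_def)
    then have ps: "cpoly_near (max (L1 e) (L2 e)) d K x ps"
      by (rule cpoly_near_mono_right) (simp add: K_def d_def)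
    have "norm (ceval f ps - S x) \<le> C * d + e * K"
      by (rule estimateD[OF S e], rule cpoly_near_mono[OF ps]) simp
    moreover have "norm (ceval f ps - T x) \<le> D * d + e * K"
      by (rule estimateD[OF T e], rule cpoly_near_mono[OF ps]) simp
    moreover have "norm (S x - T x) \<le> norm (ceval f ps - T x) + norm (ceval f ps - S x)"
      using norm_triangle_ineq4[of "ceval f ps - T x" "ceval f ps - S x"] by simp
    moreover have "C * d \<le> C * e" "D * d \<le> D * e"
      using estimate_const[OF S] estimate_const[OF T] by (auto simp: d_def intro: mult_left_mono)
    ultimately show "norm (S x - T x) \<le> (C + D + 2 * K) * e"
      by (simp add: algebra_simps)
  qed
qed

lemma representsI:
  assumes "\<And>s x. T (Cos s x) = Cos s (T x)" and C: "C \<ge> 0" and D: "D \<ge> 0"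
    and L: "\<And>e. e > 0 \<Longrightarrow> L e \<ge> 0"
    and est: "\<And>e ps x d K. e > 0 \<Longrightarrow> cpoly_near (L e) d K x ps \<Longrightarrow> norm (ceval f ps - T x) \<le> C * d + D * e * K"
  shows "represents f T"
proof -
  have "norm (ceval f ps - T x) \<le> C * d + e * K"
    if e: "e > 0" and near: "cpoly_near (L (e / (D + 1))) d K x ps" for e ps x d K
  proof -
    have e': "e / (D + 1) > 0" using e D by simp
    have "D * (e / (D + 1)) \<le> e" using e D by (simp add: field_simps)
    then have "D * (e / (D + 1)) * K \<le> e * K"
      using cpoly_near_nonneg(2)[OF near L[OF e']] by (rule mult_right_mono)
    then show ?thesis using est[OF e' near] by linarith
  qed
  then have "estimate f T C (\<lambda>e. L (e / (D + 1)))"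
    using C D L by (simp add: estimate_def)
  then show ?thesis using assms(1) by (auto simp: represents_def)
qed

lemma represents_scale:
  assumes T: "represents f T"
  shows "represents (\<lambda>t. a * f t) (\<lambda>x. a *\<^sub>C T x)"
proof -
  obtain C L where est: "estimate f T C L" using T by (rule representsE)
  show ?thesis
  proof (rule representsI[where C = "cmod a * C" and D = "cmod a" and L = L])
    fix e d K :: real and x :: 'a and ps assume "e > 0" "cpoly_near (L e) d K x ps"
    from mult_left_mono[OF estimateD[OF est this] norm_ge_zero[of a]]
    show "norm (ceval (\<lambda>t. a * f t) ps - a *\<^sub>C T x) \<le> cmod a * C * d + cmod a * e * K"
      by (simp add: ceval_scale scaleC_diff_right[symmetric] norm_scaleC algebra_simps)
  qed (use estimate_const[OF est] estimate_length[OF est] in \<open>auto simp: represents_Cos[OF T] Cos_scaleC\<close>)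
qed

lemma represents_add:
  assumes S: "represents f S" and T: "represents g T"
  shows "represents (\<lambda>t. f t + g t) (\<lambda>x. S x + T x)"
proof -
  obtain C L1 where estS: "estimate f S C L1" using S by (rule representsE)
  obtain D L2 where estT: "estimate g T D L2" using T by (rule representsE)
  show ?thesis
  proof (rule representsI[where C = "C + D" and D = 2 and L = "\<lambda>e. max (L1 e) (L2 e)"])
    fix e d K :: real and x :: 'a and ps
    assume e: "e > 0" and near: "cpoly_near (max (L1 e) (L2 e)) d K x ps"
    have "norm (ceval f ps - S x) \<le> C * d + e * K" "norm (ceval g ps - T x) \<le> D * d + e * K"
      by (rule estimateD[OF estS e], rule cpoly_near_mono[OF near], simp)
        (rule estimateD[OF estT e], rule cpoly_near_mono[OF near], simp)
    moreover have "ceval (\<lambda>t. f t + g t) ps - (S x + T x) = (ceval f ps - S x) + (ceval g ps - T x)"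
      by (simp add: ceval_add)
    ultimately show "norm (ceval (\<lambda>t. f t + g t) ps - (S x + T x)) \<le> (C + D) * d + 2 * e * K"
      using norm_triangle_ineq[of "ceval f ps - S x" "ceval g ps - T x"] by (simp add: algebra_simps)
  qed (use estimate_const[OF estS] estimate_const[OF estT] estimate_length[OF estS]
      in \<open>auto simp: represents_Cos[OF S] represents_Cos[OF T] blinfun.add_right le_max_iff_disj\<close>)
qed

lemma represents_diff:
  assumes "represents f S" "represents g T"
  shows "represents (\<lambda>t. f t - g t) (\<lambda>x. S x - T x)"
  using represents_add[OF assms(1) represents_scale[OF assms(2), of "-1"]] by simp

text \<open>
  If \<open>P\<close> approximates the orbit of \<open>x\<close>, then \<open>(P (s + r) + P (s - r)) / 2\<close>, as a function of \<open>s\<close>, approximates the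
  orbit of \<open>Cos r x\<close> by the functional equation. Its coefficients are those of \<open>P\<close> multiplied by
  \<open>cos (r \<theta>)\<close>. Hence \<open>ceval g\<close> of it, now as a function of \<open>r\<close>, is a cosine polynomial that approximates
  \<open>T (Cos r x) = Cos r (T x)\<close>, and the estimate for \<open>f\<close> applies to that polynomial.
\<close>

lemma represents_mult:
  assumes S: "represents f S" and T: "represents g T"
  shows "represents (\<lambda>t. f t * g t) (\<lambda>x. S (T x))"
proof -
  obtain C L1 where estS: "estimate f S C L1" using S by (rule representsE)
  obtain D L2 where estT: "estimate g T D L2" using T by (rule representsE)
  note C = estimate_const[OF estS] and D = estimate_const[OF estT]
  show ?thesis
  proof (rule representsI[where C = "C * D" and D = "C + D + 1" and L = "\<lambda>e. L1 (min e 1) + L2 (min e 1)"])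
    fix e0 d K :: real and x :: 'a and ps
    assume e0: "e0 > 0" and near: "cpoly_near (L1 (min e0 1) + L2 (min e0 1)) d K x ps"
    define e where "e = min e0 1"
    have e: "e > 0" "e \<le> 1" "e \<le> e0" using e0 by (auto simp: e_def)
    note near = near[folded e_def]
    note L1 = estimate_length[OF estS e(1)] and L2 = estimate_length[OF estT e(1)]
    have K: "K \<ge> 0" using cpoly_near_nonneg[OF near] L1 L2 by simp
    define qs where "qs = map (\<lambda>(\<theta>, c). (\<theta>, g \<theta> *\<^sub>C c)) ps"
    define rs where "rs r = map (\<lambda>(\<theta>, c). (\<theta>, complex_of_real (cos (r * \<theta>)) *\<^sub>C c)) ps" for r
    have rs: "cpoly (rs r) s - Cos s (Cos r x)
        = (1 / 2) *\<^sub>R ((cpoly ps (s + r) - Cos (s + r) x) + (cpoly ps (s - r) - Cos (s - r) x))" for r s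
    proof -
      have "ceval (\<lambda>\<theta>. complex_of_real (cos ((s + r) * \<theta>)) + complex_of_real (cos ((s - r) * \<theta>))) ps
          = ceval (\<lambda>\<theta>. 2 * (complex_of_real (cos (s * \<theta>)) * complex_of_real (cos (r * \<theta>)))) ps"
        by (rule arg_cong2[of _ _ _ _ ceval])
          (auto simp: fun_eq_iff distrib_right left_diff_distrib cos_add cos_diff)
      then have "cpoly ps (s + r) + cpoly ps (s - r) = 2 *\<^sub>C cpoly (rs r) s"
        by (simp add: ceval_add ceval_scale rs_def ceval_map_weight)
      then have "cpoly ps (s + r) + cpoly ps (s - r) = 2 *\<^sub>R cpoly (rs r) s"
        by (simp add: scaleR_scaleC)
      moreover have "Cos s (Cos r x) = (1 / 2) *\<^sub>R (Cos (s + r) x + Cos (s - r) x)"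
        using Cos_Cos[of s r x] by simp
      ultimately show ?thesis by (simp add: algebra_simps)
    qed
    have near_rs: "cpoly_near (L2 e) d' K (Cos r x) (rs r)"
      if "\<And>s. \<bar>s\<bar> \<le> \<bar>r\<bar> + L2 e \<Longrightarrow> norm (cpoly ps s - Cos s x) \<le> d'" for r d'
    proof -
      have half: "norm ((1 / 2) *\<^sub>R (y + z)) \<le> c" if "norm y \<le> c" "norm z \<le> c" for y z :: 'a and c
        using that norm_triangle_ineq[of y z] by simp
      show ?thesis
        unfolding cpoly_near_def rs
      proof (intro conjI allI impI half that)
        show "norm (cpoly ps (s + r) - Cos (s + r) x) \<le> K" "norm (cpoly ps (s - r) - Cos (s - r) x) \<le> K" for s
          using near by (auto simp: cpoly_near_def)
      qed auto
    qed
    have T_rs: "ceval g (rs r) = cpoly qs r" for r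
      by (simp add: rs_def qs_def ceval_map_weight mult.commute)
    have "cpoly_near (L1 e) (D * d + e * K) ((D + 1) * K) (T x) qs"
      unfolding cpoly_near_def
    proof (intro conjI allI impI)
      fix r :: real assume r: "\<bar>r\<bar> \<le> L1 e"
      have "cpoly_near (L2 e) d K (Cos r x) (rs r)"
        using near r by (intro near_rs) (auto simp: cpoly_near_def)
      from estimateD[OF estT e(1) this] show "norm (cpoly qs r - Cos r (T x)) \<le> D * d + e * K"
        by (simp add: T_rs represents_Cos[OF T])
    next
      fix r
      have "cpoly_near (L2 e) K K (Cos r x) (rs r)"
        using near by (intro near_rs) (auto simp: cpoly_near_def)
      from estimateD[OF estT e(1) this] have "norm (cpoly qs r - Cos r (T x)) \<le> D * K + e * K"
        by (simp add: T_rs represents_Cos[OF T])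
      also have "\<dots> \<le> (D + 1) * K"
        using e(2) K mult_right_mono[of e 1 K] by (simp add: algebra_simps)
      finally show "norm (cpoly qs r - Cos r (T x)) \<le> (D + 1) * K" .
    qed
    from estimateD[OF estS e(1) this]
    have "norm (ceval f qs - S (T x)) \<le> C * (D * d + e * K) + e * ((D + 1) * K)" .
    also have "\<dots> = C * D * d + (C + D + 1) * e * K" by (simp add: algebra_simps)
    also have "\<dots> \<le> C * D * d + (C + D + 1) * e0 * K"
      using e(3) K C D by (intro add_left_mono mult_right_mono mult_left_mono) auto
    finally show "norm (ceval (\<lambda>t. f t * g t) ps - S (T x)) \<le> C * D * d + (C + D + 1) * e0 * K"
      by (simp add: qs_def ceval_map_weight)
  qed (use C D estimate_length[OF estS] estimate_length[OF estT]
      in \<open>auto simp: represents_Cos[OF S] represents_Cos[OF T]\<close>)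
qed

lemma represents_commute:
  assumes S: "represents f S" and T: "represents g T"
  shows "S (T x) = T (S x)"
proof -
  have "(\<lambda>x. S (T x)) = (\<lambda>x. T (S x))"
    using represents_unique[OF represents_mult[OF S T]] represents_mult[OF T S]
    by (simp add: mult.commute)
  then show ?thesis by meson
qed

text \<open>
  Approximations of the orbits of \<open>x\<close> and \<open>y\<close> combine to one of the orbit of \<open>a x + y\<close>.
\<close>

lemma represents_linear_comb:
  assumes T: "represents f T"
  shows "T (a *\<^sub>C x + y) = a *\<^sub>C T x + T y"
proof -
  obtain C L where est: "estimate f T C L" using T by (rule representsE)
  define K where "K = 2 * M * norm x + 2 * M * norm y + 1"
  show ?thesis
  proof (rule eq_of_norm_le)
    show "2 * (cmod a + 1) * (C + K) \<ge> 0"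
      using estimate_const[OF est] M_nonneg by (simp add: K_def)
    fix e :: real assume e: "e > 0"
    define d where "d = min e 1"
    have d: "d > 0" "d \<le> 1" "d \<le> e" using e by (auto simp: d_def)
    have "\<exists>ps. cpoly_near (L e) d K v ps" if "v \<in> {x, y}" for v
    proof -
      obtain ps where "cpoly_near (L e) d (2 * M * norm v + d) v ps"
        using cpoly_near_exists[OF d(1)] by blast
      then have "cpoly_near (L e) d K v ps"
        by (rule cpoly_near_mono_right)
          (use d that mult_nonneg_nonneg[OF M_nonneg norm_ge_zero[of x]]
              mult_nonneg_nonneg[OF M_nonneg norm_ge_zero[of y]] in \<open>auto simp: K_def\<close>)
      then show ?thesis ..
    qed
    then obtain ps qs where ps: "cpoly_near (L e) d K x ps" and qs: "cpoly_near (L e) d K y qs"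
      by blast
    define rs where "rs = map (\<lambda>(\<theta>, c). (\<theta>, a *\<^sub>C c)) ps @ qs"
    have comb: "norm (a *\<^sub>C v + w) \<le> (cmod a + 1) * c" if "norm v \<le> c" "norm w \<le> c" for v w :: 'a and c
      using norm_triangle_ineq[of "a *\<^sub>C v" w] mult_left_mono[OF that(1) norm_ge_zero[of a]] that(2)
      by (simp add: norm_scaleC algebra_simps)
    have "cpoly rs s - Cos s (a *\<^sub>C x + y) = a *\<^sub>C (cpoly ps s - Cos s x) + (cpoly qs s - Cos s y)" for s
      by (simp add: rs_def ceval_map_scale blinfun.add_right Cos_scaleC scaleC_diff_right)
    then have "cpoly_near (L e) ((cmod a + 1) * d) ((cmod a + 1) * K) (a *\<^sub>C x + y) rs"
      using ps qs unfolding cpoly_near_def by (auto intro!: comb)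
    from estimateD[OF est e this]
    have "norm (ceval f rs - T (a *\<^sub>C x + y)) \<le> (cmod a + 1) * (C * d + e * K)"
      by (simp add: algebra_simps)
    moreover have "norm (ceval f rs - (a *\<^sub>C T x + T y)) \<le> (cmod a + 1) * (C * d + e * K)"
      using comb[OF estimateD[OF est e ps] estimateD[OF est e qs]]
      by (simp add: rs_def ceval_map_scale scaleC_diff_right algebra_simps)
    ultimately have "norm (T (a *\<^sub>C x + y) - (a *\<^sub>C T x + T y)) \<le> 2 * ((cmod a + 1) * (C * d + e * K))"
      using norm_triangle_ineq4[of "ceval f rs - (a *\<^sub>C T x + T y)" "ceval f rs - T (a *\<^sub>C x + y)"]
        norm_minus_commute[of "T (a *\<^sub>C x + y)" "a *\<^sub>C T x + T y"]
      by (simp add: algebra_simps)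
    also have "\<dots> \<le> 2 * ((cmod a + 1) * (C * e + e * K))"
      using estimate_const[OF est] d by (intro mult_left_mono add_right_mono) auto
    finally show "norm (T (a *\<^sub>C x + y) - (a *\<^sub>C T x + T y)) \<le> 2 * (cmod a + 1) * (C + K) * e"
      by (simp add: algebra_simps)
  qed
qed

lemma represents_add_right:
  assumes "represents f T"
  shows "T (x + y) = T x + T y"
  using represents_linear_comb[OF assms, of 1 x y] by simp

lemma represents_zero_right:
  assumes "represents f T"
  shows "T 0 = 0"
  using represents_add_right[OF assms, of 0 0] by simp

lemma represents_scaleC_right:
  assumes "represents f T"
  shows "T (a *\<^sub>C x) = a *\<^sub>C T x"
  using represents_linear_comb[OF assms, of a x 0] represents_zero_right[OF assms] by simp

lemma represents_diff_right:
  assumes "represents f T"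
  shows "T (x - y) = T x - T y"
  using represents_linear_comb[OF assms, of "-1" y x] by (simp add: add.commute)

end

section \<open>Measures with a density\<close>

text \<open>
  The image under \<open>\<phi>\<close> of the complex measure with density \<open>h\<close> with respect to \<open>N\<close>. In this form all
  integrals against it reduce to Lebesgue integrals over \<open>N\<close>.
\<close>

definition weighted_image :: "'m measure \<Rightarrow> ('m \<Rightarrow> real) \<Rightarrow> ('m \<Rightarrow> complex) \<Rightarrow> real set \<Rightarrow> complex" where
  "weighted_image N \<phi> h E = (\<integral>w. indicat_real E (\<phi> w) *\<^sub>R h w \<partial>N)"

lemma integrable_indicator_image:
  assumes "\<phi> \<in> borel_measurable N" "integrable N h" "E \<in> sets borel"
  shows "integrable N (\<lambda>w. indicat_real E (\<phi> w) *\<^sub>R (h w :: complex))"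
proof (rule Bochner_Integration.integrable_bound[OF assms(2)])
  show "(\<lambda>w. indicat_real E (\<phi> w) *\<^sub>R h w) \<in> borel_measurable N"
    using assms by measurable
qed (auto simp: indicator_def)

lemma complex_borel_measure_weighted_image:
  assumes \<phi>: "\<phi> \<in> borel_measurable N" and h: "integrable N h"
  shows "complex_borel_measure (weighted_image N \<phi> h)"
  unfolding complex_borel_measure_def
proof (intro allI impI)
  fix A :: "nat \<Rightarrow> real set" assume A: "range A \<subseteq> sets borel" "disjoint_family A"
  have Ai: "A i \<in> sets borel" for i using A by auto
  have sums: "(\<lambda>i. indicat_real (A i) x) sums indicator (\<Union>i. A i) x" for x
    using A(2) by (intro indicator_sums) (auto simp: disjoint_family_on_def)
  have le: "\<bar>\<Sum>i<n. indicat_real (A i) x\<bar> \<le> 1" for n x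
  proof -
    have "(\<Sum>i<n. indicat_real (A i) x) \<le> (\<Sum>i. indicat_real (A i) x)"
      using sums[of x] by (intro sum_le_suminf) (auto simp: sums_iff)
    also have "\<dots> \<le> 1" using sums[of x] by (simp add: sums_iff indicator_def)
    finally show ?thesis by (simp add: sum_nonneg del: sum_indicator_eq_card)
  qed
  have "(\<lambda>n. \<integral>w. (\<Sum>i<n. indicat_real (A i) (\<phi> w)) *\<^sub>R h w \<partial>N)
      \<longlonglongrightarrow> (\<integral>w. indicat_real (\<Union>i. A i) (\<phi> w) *\<^sub>R h w \<partial>N)"
  proof (rule integral_dominated_convergence[where w = "\<lambda>w. norm (h w)"])
    have int: "integrable N (\<lambda>w. indicat_real E (\<phi> w) *\<^sub>R h w)" if "E \<in> sets borel" for E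
      using integrable_indicator_image[OF \<phi> h that] .
    show "(\<lambda>w. indicat_real (\<Union>i. A i) (\<phi> w) *\<^sub>R h w) \<in> borel_measurable N"
      using Ai by (intro borel_measurable_integrable int) auto
    show "(\<lambda>w. (\<Sum>i<n. indicat_real (A i) (\<phi> w)) *\<^sub>R h w) \<in> borel_measurable N" for n
      unfolding scaleR_sum_left using Ai by (intro borel_measurable_sum borel_measurable_integrable int)
    show "AE w in N. (\<lambda>n. (\<Sum>i<n. indicat_real (A i) (\<phi> w)) *\<^sub>R h w)
        \<longlonglongrightarrow> indicat_real (\<Union>i. A i) (\<phi> w) *\<^sub>R h w"
      using sums by (intro AE_I2 tendsto_scaleR tendsto_const) (simp add: sums_def)
    show "AE w in N. norm ((\<Sum>i<n. indicat_real (A i) (\<phi> w)) *\<^sub>R h w) \<le> norm (h w)" for n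
      using mult_right_mono[OF le norm_ge_zero] by (intro AE_I2) auto
  qed (use h in auto)
  moreover have "(\<integral>w. (\<Sum>i<n. indicat_real (A i) (\<phi> w)) *\<^sub>R h w \<partial>N) = (\<Sum>i<n. weighted_image N \<phi> h (A i))" for n
    unfolding weighted_image_def scaleR_sum_left
    by (rule Bochner_Integration.integral_sum) (rule integrable_indicator_image[OF \<phi> h Ai])
  ultimately show "(\<lambda>n. weighted_image N \<phi> h (A n)) sums weighted_image N \<phi> h (\<Union>n. A n)"
    by (simp add: sums_def weighted_image_def)
qed

lemma total_variation_weighted_image:
  assumes \<phi>: "\<phi> \<in> borel_measurable N" and h: "integrable N h"
  shows "measure (total_variation (weighted_image N \<phi> h)) UNIV \<le> (\<integral>w. norm (h w) \<partial>N)"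
proof -
  let ?\<mu> = "weighted_image N \<phi> h"
  note \<mu> = complex_borel_measure_weighted_image[OF \<phi> h]
  have "variation ?\<mu> UNIV \<le> ennreal (\<integral>w. norm (h w) \<partial>N)"
  proof (rule variation_le)
    fix P :: "real set set" assume P: "finite P" "P \<subseteq> sets borel" "partition_on UNIV P"
    have int: "integrable N (\<lambda>w. norm (indicat_real A (\<phi> w) *\<^sub>R h w))" if "A \<in> P" for A
      using P that by (intro integrable_norm integrable_indicator_image[OF \<phi> h]) auto
    have "(\<Sum>A\<in>P. cmod (?\<mu> A)) \<le> (\<Sum>A\<in>P. \<integral>w. norm (indicat_real A (\<phi> w) *\<^sub>R h w) \<partial>N)"
      unfolding weighted_image_def by (intro sum_mono integral_norm_bound)
    also have "\<dots> = (\<integral>w. (\<Sum>A\<in>P. norm (indicat_real A (\<phi> w) *\<^sub>R h w)) \<partial>N)"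
      by (rule Bochner_Integration.integral_sum[symmetric]) (rule int)
    also have "\<dots> \<le> (\<integral>w. norm (h w) \<partial>N)"
    proof (rule integral_mono)
      show "integrable N (\<lambda>w. \<Sum>A\<in>P. norm (indicat_real A (\<phi> w) *\<^sub>R h w))"
        by (intro Bochner_Integration.integrable_sum int)
      fix w
      obtain B where B: "B \<in> P" "\<phi> w \<in> B"
        using P(3) unfolding partition_on_def by blast
      have "A = B" if "A \<in> P" "\<phi> w \<in> A" for A
        using disjointD[OF partition_onD2[OF P(3)] that(1) B(1)] that(2) B(2) by auto
      then have "\<phi> w \<in> A \<longleftrightarrow> A = B" if "A \<in> P" for A
        using that B by metis
      then have "(\<Sum>A\<in>P. norm (indicat_real A (\<phi> w) *\<^sub>R h w)) = (\<Sum>A\<in>P. if A = B then norm (h w) else 0)"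
        by (intro sum.cong) (simp_all add: indicator_def)
      then show "(\<Sum>A\<in>P. norm (indicat_real A (\<phi> w) *\<^sub>R h w)) \<le> norm (h w)"
        using P(1) by simp
    qed (use h in auto)
    finally show "(\<Sum>A\<in>P. ennreal (cmod (?\<mu> A))) \<le> ennreal (\<integral>w. norm (h w) \<partial>N)"
      by (simp add: sum_ennreal ennreal_leI)
  qed
  then show ?thesis
    by (simp add: measure_def emeasure_total_variation[OF \<mu>] enn2real_leI)
qed

lemma cm_integral_weighted_image:
  fixes f :: "real \<Rightarrow> complex"
  assumes \<phi>: "\<phi> \<in> borel_measurable N" and h: "integrable N h" and f: "bounded_continuous f"
  shows "cm_integral (weighted_image N \<phi> h) f = (\<integral>w. f (\<phi> w) * h w \<partial>N)"
proof -
  note \<mu> = complex_borel_measure_weighted_image[OF \<phi> h]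
  obtain K where K: "continuous_on UNIV f" "K \<ge> 0" "\<And>x. norm (f x) \<le> K"
    using bounded_continuousE[OF f] by metis
  have simple: "simple_cm_integral (weighted_image N \<phi> h) s = (\<integral>w. s (\<phi> w) * h w \<partial>N)"
    if s: "simple_function borel s" for s
  proof -
    have "(\<integral>w. s (\<phi> w) * h w \<partial>N) = (\<integral>w. (\<Sum>v\<in>range s. (indicat_real (s -` {v}) (\<phi> w) *\<^sub>R h w) * v) \<partial>N)"
    proof (rule Bochner_Integration.integral_cong[OF refl])
      fix w
      have "(\<Sum>v\<in>range s. (indicat_real (s -` {v}) (\<phi> w) *\<^sub>R h w) * v)
          = (\<Sum>v\<in>range s. if v = s (\<phi> w) then h w * v else 0)"
        by (rule sum.cong) auto
      then show "s (\<phi> w) * h w = (\<Sum>v\<in>range s. (indicat_real (s -` {v}) (\<phi> w) *\<^sub>R h w) * v)"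
        using simple_function_vimage(1)[OF s] by simp
    qed
    also have "\<dots> = (\<Sum>v\<in>range s. \<integral>w. (indicat_real (s -` {v}) (\<phi> w) *\<^sub>R h w) * v \<partial>N)"
      by (intro Bochner_Integration.integral_sum integrable_mult_left
          integrable_indicator_image[OF \<phi> h] simple_function_vimage(2)[OF s])
    also have "\<dots> = simple_cm_integral (weighted_image N \<phi> h) s"
      unfolding simple_cm_integral_def weighted_image_def scaleC_complex_def
      by (intro sum.cong refl integral_mult_left_zero)
    finally show ?thesis ..
  qed
  have meas: "(\<lambda>w. step i f (\<phi> w)) \<in> borel_measurable N" for i
    using borel_measurable_simple_function[OF simple_function_step] \<phi> by measurable
  have "(\<lambda>i. \<integral>w. step i f (\<phi> w) * h w \<partial>N) \<longlonglongrightarrow> (\<integral>w. f (\<phi> w) * h w \<partial>N)"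
  proof (rule integral_dominated_convergence[where w = "\<lambda>w. K * norm (h w)"])
    show "AE w in N. (\<lambda>i. step i f (\<phi> w) * h w) \<longlonglongrightarrow> f (\<phi> w) * h w"
      by (intro AE_I2 tendsto_mult tendsto_const step_tendsto K(1))
    show "AE w in N. norm (step i f (\<phi> w) * h w) \<le> K * norm (h w)" for i
      using norm_step_le[of f K i, OF K(3)] by (intro AE_I2) (simp add: norm_mult mult_right_mono)
    show "(\<lambda>w. f (\<phi> w) * h w) \<in> borel_measurable N"
      using borel_measurable_continuous_onI[OF K(1)] \<phi> h by measurable
    show "(\<lambda>w. step i f (\<phi> w) * h w) \<in> borel_measurable N" for i
      using meas[of i] h by measurable
  qed (use h in auto)
  then have "(\<lambda>i. simple_cm_integral (weighted_image N \<phi> h) (step i f)) \<longlonglongrightarrow> (\<integral>w. f (\<phi> w) * h w \<partial>N)"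
    by (simp add: simple[OF simple_function_step])
  then show ?thesis
    using cm_integral_tendsto[OF \<mu> f] LIMSEQ_unique by blast
qed

lemma bounded_continuous_cos: "bounded_continuous (\<lambda>s. complex_of_real (cos (s * t)))"
  by (rule bounded_continuousI[where K = 1]) (auto intro!: continuous_intros)

lemma cosine_transform_weighted_image:
  assumes "\<phi> \<in> borel_measurable N" "integrable N h"
  shows "cosine_transform (weighted_image N \<phi> h) t = (\<integral>w. complex_of_real (cos (\<phi> w * t)) * h w \<partial>N)"
  unfolding cosine_transform_def
  using cm_integral_weighted_image[OF assms bounded_continuous_cos] .

section \<open>Elementary measures and their cosine transforms\<close>

lemma integrable_exp_tail:
  assumes "a > 0"
  shows "integrable lborel (\<lambda>s. indicat_real {0<..} s * exp (- a * s))"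
    "(\<integral>s. indicat_real {0<..} s * exp (- a * s) \<partial>lborel) = 1 / a"
proof -
  have lim0: "((\<lambda>s. - exp (- a * s) / a) \<longlongrightarrow> - exp (- a * 0) / a) (at_right 0)"
    using assms by (intro tendsto_intros) auto
  have "filterlim (\<lambda>s. - a * s) at_bot at_top"
    using assms by (simp add: filterlim_uminus_at_bot filterlim_tendsto_pos_mult_at_top[OF tendsto_const _ filterlim_ident])
  then have "((\<lambda>s. - exp (- a * s) / a) \<longlongrightarrow> - 0 / a) at_top"
    using assms by (intro tendsto_intros filterlim_compose[OF exp_at_bot]) auto
  then have F: "set_integrable lborel (einterval 0 \<infinity>) (\<lambda>s. exp (- a * s))"
    "(LBINT s=0..\<infinity>. exp (- a * s)) = 0 - (- 1 / a)"
    using assms lim0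
    by (intro interval_integral_FTC_nonneg[where F = "\<lambda>s. - exp (- a * s) / a"];
      auto intro!: derivative_eq_intros continuous_intros simp: zero_ereal_def ereal_tendsto_simps)+
  from F(1) show "integrable lborel (\<lambda>s. indicat_real {0<..} s * exp (- a * s))"
    by (simp add: set_integrable_def zero_ereal_def)
  from F(2) show "(\<integral>s. indicat_real {0<..} s * exp (- a * s) \<partial>lborel) = 1 / a"
    by (simp add: interval_lebesgue_integral_def set_lebesgue_integral_def zero_ereal_def)
qed

lemma square_sum_nonzero:
  assumes "Re q > 0"
  shows "q\<^sup>2 + complex_of_real (t\<^sup>2) \<noteq> 0"
proof
  assume "q\<^sup>2 + complex_of_real (t\<^sup>2) = 0"
  then have "(q - \<i> * t) * (q + \<i> * t) = 0" by (simp add: algebra_simps power2_eq_square)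
  then have "q = \<i> * t \<or> q = - (\<i> * t)" by (auto simp: eq_neg_iff_add_eq_0)
  with assms show False by auto
qed

lemma exp_cos_integral:
  assumes q: "Re q > 0"
  shows "integrable lborel (\<lambda>s. indicat_real {0<..} s *\<^sub>R (complex_of_real (cos (s * t)) * exp (- q * s)))" (is ?int)
    "(\<integral>s. indicat_real {0<..} s *\<^sub>R (complex_of_real (cos (s * t)) * exp (- q * s)) \<partial>lborel) = q / (q\<^sup>2 + t\<^sup>2)"
proof -
  show int: ?int
  proof (rule Bochner_Integration.integrable_bound[OF integrable_exp_tail(1)[OF q]])
    show "AE s in lborel. norm (indicat_real {0<..} s *\<^sub>R (complex_of_real (cos (s * t)) * exp (- q * s)))
        \<le> norm (indicat_real {0<..} s * exp (- Re q * s))"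
      by (intro AE_I2) (auto simp: norm_mult indicator_def intro!: mult_left_le_one_le)
  qed measurable
  have nz: "q\<^sup>2 + (complex_of_real t)\<^sup>2 \<noteq> 0"
    using square_sum_nonzero[OF q, of t] by simp
  define F where "F s = exp (- q * complex_of_real s) * (complex_of_real t * complex_of_real (sin (s * t))
      - q * complex_of_real (cos (s * t))) / (q\<^sup>2 + t\<^sup>2)" for s
  have F: "(F has_vector_derivative (complex_of_real (cos (s * t)) * exp (- q * s))) (at s)" for s
  proof -
    have "((\<lambda>z. exp (- q * z) * (complex_of_real t * sin (z * complex_of_real t)
        - q * cos (z * complex_of_real t)) / (q\<^sup>2 + t\<^sup>2)) has_field_derivative
        (cos (complex_of_real s * t) * exp (- q * s))) (at (complex_of_real s))"
      by (rule derivative_eq_intros refl | simp add: nz)+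
        (use nz in \<open>simp add: field_simps power2_eq_square\<close>)
    from has_vector_derivative_real_field[OF this] show ?thesis
      by (simp add: F_def[abs_def] cos_of_real[symmetric] sin_of_real[symmetric])
  qed
  have cont: "isCont F 0"
    unfolding F_def using nz by (intro continuous_intros) auto
  then have lim0: "(F \<longlongrightarrow> F 0) (at_right 0)"
    unfolding isCont_def using filterlim_at_split by blast
  have "(F \<longlongrightarrow> 0) at_top"
  proof (rule Lim_null_comparison)
    have "filterlim (\<lambda>s. - Re q * s) at_bot at_top"
      using q by (simp add: filterlim_uminus_at_bot filterlim_tendsto_pos_mult_at_top[OF tendsto_const _ filterlim_ident])
    then have "((\<lambda>s. exp (- Re q * s) * ((\<bar>t\<bar> + cmod q) / cmod (q\<^sup>2 + t\<^sup>2))) \<longlongrightarrow> 0 * ((\<bar>t\<bar> + cmod q) / cmod (q\<^sup>2 + t\<^sup>2))) at_top"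
      by (intro tendsto_mult tendsto_const filterlim_compose[OF exp_at_bot])
    then show "((\<lambda>s. exp (- Re q * s) * ((\<bar>t\<bar> + cmod q) / cmod (q\<^sup>2 + t\<^sup>2))) \<longlongrightarrow> 0) at_top" by simp
    have "norm (F s) \<le> exp (- Re q * s) * ((\<bar>t\<bar> + cmod q) / cmod (q\<^sup>2 + t\<^sup>2))" for s
    proof -
      have "cmod (complex_of_real t * complex_of_real (sin (s * t)) - q * complex_of_real (cos (s * t))) \<le> \<bar>t\<bar> + cmod q"
      proof (rule order_trans[OF norm_triangle_ineq4 add_mono])
        show "cmod (complex_of_real t * complex_of_real (sin (s * t))) \<le> \<bar>t\<bar>"
          by (simp add: norm_mult mult_left_le)
        show "cmod (q * complex_of_real (cos (s * t))) \<le> cmod q"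
          by (simp add: norm_mult mult_left_le)
      qed
      then show ?thesis
        unfolding F_def norm_mult norm_divide norm_exp_eq_Re times_divide_eq_right
        by (intro divide_right_mono mult_mono) auto
    qed
    then show "\<forall>\<^sub>F s in at_top. norm (F s) \<le> exp (- Re q * s) * ((\<bar>t\<bar> + cmod q) / cmod (q\<^sup>2 + t\<^sup>2))"
      by simp
  qed
  then have "(LBINT s=0..\<infinity>. (complex_of_real (cos (s * t)) * exp (- q * s))) = 0 - F 0"
    using lim0 int F
    by (intro interval_integral_FTC_integrable[where F = F])
      (auto intro!: continuous_intros simp: zero_ereal_def ereal_tendsto_simps set_integrable_def)
  then show "(\<integral>s. indicat_real {0<..} s *\<^sub>R (complex_of_real (cos (s * t)) * exp (- q * s)) \<partial>lborel) = q / (q\<^sup>2 + t\<^sup>2)"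
    by (simp add: interval_lebesgue_integral_def set_lebesgue_integral_def zero_ereal_def F_def)
qed

text \<open>
  The antiderivative comes from the partial fraction decomposition in \<open>x\<^sup>2\<close>; in the confluent cases \<open>t = 0\<close> and
  \<open>t = m\<close> it has a different form.
\<close>

lemma rational_integral:
  fixes m t :: real
  assumes m: "m > 0" and t: "t \<ge> 0"
  defines "f \<equiv> \<lambda>x. x\<^sup>2 / ((m\<^sup>2 + x\<^sup>2) * (x\<^sup>2 + t\<^sup>2))"
  shows "integrable lborel (\<lambda>x. indicat_real {0<..} x * f x)"
    "(\<integral>x. indicat_real {0<..} x * f x \<partial>lborel) = pi / 2 / (m + t)"
proof -
  have atan: "((\<lambda>x. arctan (x / c)) \<longlongrightarrow> pi / 2) at_top" "((\<lambda>x. arctan (x / c)) \<longlongrightarrow> 0) (at_right 0)" if "c > 0" for c :: real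
  proof -
    have "filterlim (\<lambda>x. 1 / c * x) at_top at_top"
      using that by (intro filterlim_tendsto_pos_mult_at_top[OF tendsto_const _ filterlim_ident]) auto
    then show "((\<lambda>x. arctan (x / c)) \<longlongrightarrow> pi / 2) at_top"
      using filterlim_compose[OF tendsto_arctan_at_top, of "\<lambda>x. 1 / c * x"] by simp
    have "((\<lambda>x. arctan (x / c)) \<longlongrightarrow> arctan (0 / c)) (at_right 0)"
      using that by (intro tendsto_intros) auto
    then show "((\<lambda>x. arctan (x / c)) \<longlongrightarrow> 0) (at_right 0)" by simp
  qed
  have datan: "((\<lambda>x. arctan (x / c)) has_real_derivative c / (c\<^sup>2 + x\<^sup>2)) (at x)" if "c > 0" for c x :: real
    using that by (auto intro!: derivative_eq_intros simp: field_simps power2_eq_square)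
  have pos: "m\<^sup>2 + x\<^sup>2 > 0" for x using m by (simp add: add_pos_nonneg)
  obtain F where F: "\<And>x. x > 0 \<Longrightarrow> (F has_real_derivative f x) (at x)"
    "(F \<longlongrightarrow> 0) (at_right 0)" "(F \<longlongrightarrow> pi / 2 / (m + t)) at_top"
  proof -
    consider "t = 0" | "t > 0" "t \<noteq> m" | "t = m" using t by linarith
    then show ?thesis
    proof cases
      case 1
      show ?thesis
      proof (rule that[of "\<lambda>x. 1 / m * arctan (x / m)"])
        show "((\<lambda>x. 1 / m * arctan (x / m)) has_real_derivative f x) (at x)" if "x > 0" for x
          using that m pos[of x] 1
          by (intro DERIV_cong[OF DERIV_cmult[OF datan[OF m]]]) (simp add: f_def)
        show "((\<lambda>x. 1 / m * arctan (x / m)) \<longlongrightarrow> 0) (at_right 0)"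
          using tendsto_mult[OF tendsto_const[of "1 / m"] atan(2)[OF m]] by simp
        show "((\<lambda>x. 1 / m * arctan (x / m)) \<longlongrightarrow> pi / 2 / (m + t)) at_top"
          using tendsto_mult[OF tendsto_const[of "1 / m"] atan(1)[OF m]] 1 by (simp add: field_simps)
      qed
    next
      case 2
      have mt: "m\<^sup>2 - t\<^sup>2 \<noteq> 0" using 2 m by (simp add: power2_eq_iff)
      show ?thesis
      proof (rule that[of "\<lambda>x. (m * arctan (x / m) - t * arctan (x / t)) / (m\<^sup>2 - t\<^sup>2)"])
        show "((\<lambda>x. (m * arctan (x / m) - t * arctan (x / t)) / (m\<^sup>2 - t\<^sup>2)) has_real_derivative f x) (at x)" if "x > 0" for x
        proof (rule DERIV_cong[OF DERIV_cdivide[OF DERIV_diff[OF DERIV_cmult[OF datan[OF m]] DERIV_cmult[OF datan[OF 2(1)]]]]])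
          have p: "m\<^sup>2 + x\<^sup>2 \<noteq> 0" "t\<^sup>2 + x\<^sup>2 \<noteq> 0"
            using m 2(1) by (simp_all add: add_pos_nonneg less_imp_neq[symmetric] sum_power2_eq_zero_iff)
          have "m * (m / (m\<^sup>2 + x\<^sup>2)) - t * (t / (t\<^sup>2 + x\<^sup>2)) = (m\<^sup>2 - t\<^sup>2) * f x"
            using p by (simp add: f_def add.commute[of "x\<^sup>2" "t\<^sup>2"] divide_simps) (simp add: algebra_simps power2_eq_square)
          then show "(m * (m / (m\<^sup>2 + x\<^sup>2)) - t * (t / (t\<^sup>2 + x\<^sup>2))) / (m\<^sup>2 - t\<^sup>2) = f x"
            using mt by simp
        qed
        have "((\<lambda>x. (m * arctan (x / m) - t * arctan (x / t)) / (m\<^sup>2 - t\<^sup>2)) \<longlongrightarrow> (m * 0 - t * 0) / (m\<^sup>2 - t\<^sup>2)) (at_right 0)"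
          using mt by (intro tendsto_intros atan m 2(1)) auto
        then show "((\<lambda>x. (m * arctan (x / m) - t * arctan (x / t)) / (m\<^sup>2 - t\<^sup>2)) \<longlongrightarrow> 0) (at_right 0)" by simp
        have "((\<lambda>x. (m * arctan (x / m) - t * arctan (x / t)) / (m\<^sup>2 - t\<^sup>2)) \<longlongrightarrow> (m * (pi / 2) - t * (pi / 2)) / (m\<^sup>2 - t\<^sup>2)) at_top"
          using mt by (intro tendsto_intros atan m 2(1)) auto
        moreover have "(m * (pi / 2) - t * (pi / 2)) / (m\<^sup>2 - t\<^sup>2) = pi / 2 / (m + t)"
        proof -
          have "m\<^sup>2 - t\<^sup>2 = (m - t) * (m + t)" by (simp add: algebra_simps power2_eq_square)
          moreover have "m * (pi / 2) - t * (pi / 2) = (m - t) * (pi / 2)" by (simp add: algebra_simps)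
          moreover have "m - t \<noteq> 0" using 2 by simp
          ultimately show ?thesis by (metis nonzero_mult_divide_mult_cancel_left)
        qed
        ultimately show "((\<lambda>x. (m * arctan (x / m) - t * arctan (x / t)) / (m\<^sup>2 - t\<^sup>2)) \<longlongrightarrow> pi / 2 / (m + t)) at_top" by simp
      qed
    next
      case 3
      have nz: "m\<^sup>2 + x\<^sup>2 \<noteq> 0" for x using pos[of x] by linarith
      show ?thesis
      proof (rule that[of "\<lambda>x. 1 / (2 * m) * arctan (x / m) - x / (2 * (m\<^sup>2 + x\<^sup>2))"])
        show "((\<lambda>x. 1 / (2 * m) * arctan (x / m) - x / (2 * (m\<^sup>2 + x\<^sup>2))) has_real_derivative f x) (at x)" if "x > 0" for x
        proof -
          have "((\<lambda>x. x / (m\<^sup>2 + x\<^sup>2)) has_real_derivative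
              (1 * (m\<^sup>2 + x\<^sup>2) - x * (2 * x)) / ((m\<^sup>2 + x\<^sup>2) * (m\<^sup>2 + x\<^sup>2))) (at x)"
            using nz[of x] by (intro DERIV_divide) (auto intro!: derivative_eq_intros)
          from DERIV_diff[OF DERIV_cmult[OF datan[OF m], of "1 / (2 * m)"] DERIV_cmult[OF this, of "1 / 2"]]
          have "((\<lambda>x. 1 / (2 * m) * arctan (x / m) - x / (2 * (m\<^sup>2 + x\<^sup>2))) has_real_derivative
              1 / (2 * m) * (m / (m\<^sup>2 + x\<^sup>2))
                - 1 / 2 * ((1 * (m\<^sup>2 + x\<^sup>2) - x * (2 * x)) / ((m\<^sup>2 + x\<^sup>2) * (m\<^sup>2 + x\<^sup>2)))) (at x)"
            by simp
          moreover have "1 / (2 * m) * (m / D) - 1 / 2 * ((1 * D - x * (2 * x)) / (D * D)) = x\<^sup>2 / (D * D)"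
            if "D \<noteq> 0" for D
            using that m by (simp add: field_simps power2_eq_square)
          ultimately show ?thesis
            using nz[of x] 3 by (simp add: f_def add.commute)
        qed
        have "((\<lambda>x. 1 / (2 * m) * arctan (x / m) - x / (2 * (m\<^sup>2 + x\<^sup>2))) \<longlongrightarrow> 1 / (2 * m) * 0 - 0 / (2 * (m\<^sup>2 + 0\<^sup>2))) (at_right 0)"
          using m by (intro tendsto_intros atan m) auto
        then show "((\<lambda>x. 1 / (2 * m) * arctan (x / m) - x / (2 * (m\<^sup>2 + x\<^sup>2))) \<longlongrightarrow> 0) (at_right 0)" by simp
        have "((\<lambda>x. x / (2 * (m\<^sup>2 + x\<^sup>2))) \<longlongrightarrow> 0) at_top"
        proof (rule Lim_null_comparison)
          have "norm (x / (2 * (m\<^sup>2 + x\<^sup>2))) \<le> inverse x" if "x > 0" for x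
          proof -
            have "x * x \<le> 2 * (m\<^sup>2 + x\<^sup>2)" by (simp add: power2_eq_square)
            then show ?thesis using that pos[of x] by (simp add: divide_simps)
          qed
          then show "\<forall>\<^sub>F x in at_top. norm (x / (2 * (m\<^sup>2 + x\<^sup>2))) \<le> inverse x"
            using eventually_gt_at_top[of 0] by (rule eventually_mono[rotated])
          show "(inverse \<longlongrightarrow> (0::real)) at_top" by (rule tendsto_inverse_0_at_top[OF filterlim_ident])
        qed
        then have "((\<lambda>x. 1 / (2 * m) * arctan (x / m) - x / (2 * (m\<^sup>2 + x\<^sup>2))) \<longlongrightarrow> 1 / (2 * m) * (pi / 2) - 0) at_top"
          by (intro tendsto_diff tendsto_mult tendsto_const atan m)
        then show "((\<lambda>x. 1 / (2 * m) * arctan (x / m) - x / (2 * (m\<^sup>2 + x\<^sup>2))) \<longlongrightarrow> pi / 2 / (m + t)) at_top"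
          using 3 by (simp add: field_simps)
      qed
    qed
  qed
  have cont: "isCont f x" if "x > 0" for x
  proof -
    have "(m\<^sup>2 + x\<^sup>2) * (x\<^sup>2 + t\<^sup>2) \<noteq> 0"
      using that by (simp add: sum_power2_eq_zero_iff)
    then show ?thesis unfolding f_def by (intro continuous_intros)
  qed
  have FTC: "set_integrable lborel (einterval 0 \<infinity>) f" "(LBINT x=0..\<infinity>. f x) = pi / 2 / (m + t) - 0"
    using F cont
    by (intro interval_integral_FTC_nonneg[where F = F];
      auto simp: zero_ereal_def ereal_tendsto_simps f_def)+
  from FTC(1) show "integrable lborel (\<lambda>x. indicat_real {0<..} x * f x)"
    by (simp add: set_integrable_def zero_ereal_def)
  from FTC(2) show "(\<integral>x. indicat_real {0<..} x * f x \<partial>lborel) = pi / 2 / (m + t)"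
    by (simp add: interval_lebesgue_integral_def set_lebesgue_integral_def zero_ereal_def)
qed

definition half_line_density :: "complex \<Rightarrow> real \<Rightarrow> complex" where
  "half_line_density q s = (indicat_real {0<..} s *\<^sub>R exp (- q * s)) / q"

definition exponential_measure :: "complex \<Rightarrow> real set \<Rightarrow> complex" where
  "exponential_measure q = weighted_image lborel (\<lambda>s. s) (half_line_density q)"

lemma half_line_density:
  assumes "Re q > 0"
  shows "integrable lborel (half_line_density q)"
    "(\<integral>s. norm (half_line_density q s) \<partial>lborel) = 1 / (cmod q * Re q)"
proof -
  have *: "integrable lborel (\<lambda>s. indicat_real {0<..} s *\<^sub>R exp (- q * complex_of_real s))"
    using exp_cos_integral(1)[OF assms, of 0] by simp
  have "half_line_density q = (\<lambda>s. (indicat_real {0<..} s *\<^sub>R exp (- q * complex_of_real s)) / q)"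
    by (simp add: half_line_density_def fun_eq_iff)
  then show "integrable lborel (half_line_density q)"
    using integrable_divide[OF *, of q] by simp
  have "norm (half_line_density q s) = indicat_real {0<..} s * exp (- Re q * s) / cmod q" for s
    by (simp add: half_line_density_def norm_divide)
  then show "(\<integral>s. norm (half_line_density q s) \<partial>lborel) = 1 / (cmod q * Re q)"
    using integrable_exp_tail(2)[OF assms] by (simp add: field_simps)
qed

lemma exponential_measure:
  assumes "Re q > 0"
  shows "complex_borel_measure (exponential_measure q)"
    "measure (total_variation (exponential_measure q)) UNIV \<le> 1 / (cmod q * Re q)"
    "cosine_transform (exponential_measure q) t = 1 / (q\<^sup>2 + t\<^sup>2)"
proof -
  have m: "(\<lambda>s::real. s) \<in> borel_measurable lborel" by simp
  note d = half_line_density[OF assms]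
  show "complex_borel_measure (exponential_measure q)"
    unfolding exponential_measure_def by (rule complex_borel_measure_weighted_image[OF m d(1)])
  show "measure (total_variation (exponential_measure q)) UNIV \<le> 1 / (cmod q * Re q)"
    unfolding exponential_measure_def d(2)[symmetric] by (rule total_variation_weighted_image[OF m d(1)])
  have q: "q \<noteq> 0" using assms by auto
  have "cosine_transform (exponential_measure q) t = (\<integral>s. complex_of_real (cos (s * t)) * half_line_density q s \<partial>lborel)"
    unfolding exponential_measure_def by (rule cosine_transform_weighted_image[OF m d(1)])
  also have "\<dots> = (\<integral>s. (indicat_real {0<..} s *\<^sub>R (complex_of_real (cos (s * t)) * exp (- q * s))) / q \<partial>lborel)"
    unfolding half_line_density_def by (intro Bochner_Integration.integral_cong) (auto simp: indicator_def)
  also have "\<dots> = q / (q\<^sup>2 + t\<^sup>2) / q"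
    unfolding integral_divide_zero exp_cos_integral(2)[OF assms, of t] ..
  finally show "cosine_transform (exponential_measure q) t = 1 / (q\<^sup>2 + t\<^sup>2)"
    using q by simp
qed

text \<open>
  The function \<open>x\<^sup>2 / (x\<^sup>2 + t\<^sup>2)\<close> is the cosine transform of the density \<open>x exp (-x s)\<close> on the half line, and
  \<open>1 / (m + \<bar>t\<bar>)\<close> is the mixture of these functions with the weights \<open>(2 / \<pi>) / (m\<^sup>2 + x\<^sup>2)\<close>. The measure is positive,
  so its mass is the value \<open>1 / m\<close> of its transform at \<open>0\<close>.
\<close>

definition mixture_density :: "real \<Rightarrow> real \<times> real \<Rightarrow> real" where
  "mixture_density m = (\<lambda>(x, s). indicat_real {0<..} x * (2 / pi * x / (m\<^sup>2 + x\<^sup>2))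
     * (indicat_real {0<..} s * exp (- x * s)))"

definition mixture_measure :: "real \<Rightarrow> real set \<Rightarrow> complex" where
  "mixture_measure m = weighted_image (lborel \<Otimes>\<^sub>M lborel) snd (\<lambda>w. complex_of_real (mixture_density m w))"

lemma mixture_integral:
  assumes m: "m > 0"
  shows "integrable (lborel \<Otimes>\<^sub>M lborel) (\<lambda>w. cos (snd w * t) * mixture_density m w)" (is ?int)
    "(\<integral>w. cos (snd w * t) * mixture_density m w \<partial>(lborel \<Otimes>\<^sub>M lborel)) = 1 / (m + \<bar>t\<bar>)"
proof -
  define g where "g x = indicat_real {0<..} x * (2 / pi * x / (m\<^sup>2 + x\<^sup>2))" for x
  have g0: "g x = 0" if "x \<le> 0" for x using that by (simp add: g_def)
  have gnn: "g x \<ge> 0" for x using m by (auto simp: g_def indicator_def)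
  have inner_int: "integrable lborel (\<lambda>s. cos (s * t) * (indicat_real {0<..} s * exp (- x * s)))"
    and inner: "(\<integral>s. cos (s * t) * (indicat_real {0<..} s * exp (- x * s)) \<partial>lborel) = x / (x\<^sup>2 + t\<^sup>2)"
    if "x > 0" for x t :: real
  proof -
    have eq: "indicat_real {0<..} s *\<^sub>R (complex_of_real (cos (s * t)) * exp (- complex_of_real x * s))
        = complex_of_real (cos (s * t) * (indicat_real {0<..} s * exp (- x * s)))" for s
      by (simp add: scaleR_conv_of_real exp_of_real[symmetric])
    have "Re (complex_of_real x) > 0" using that by simp
    from exp_cos_integral[OF this, of t, unfolded eq]
    have *: "integrable lborel (\<lambda>s. complex_of_real (cos (s * t) * (indicat_real {0<..} s * exp (- x * s))))"
      "(\<integral>s. complex_of_real (cos (s * t) * (indicat_real {0<..} s * exp (- x * s))) \<partial>lborel)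
        = complex_of_real (x / (x\<^sup>2 + t\<^sup>2))" by simp_all
    from *(1) show "integrable lborel (\<lambda>s. cos (s * t) * (indicat_real {0<..} s * exp (- x * s)))"
      unfolding complex_of_real_integrable_eq .
    from *(2) show "(\<integral>s. cos (s * t) * (indicat_real {0<..} s * exp (- x * s)) \<partial>lborel) = x / (x\<^sup>2 + t\<^sup>2)"
      unfolding integral_complex_of_real of_real_eq_iff .
  qed
  have meas: "(\<lambda>w. cos (snd w * t) * mixture_density m w) \<in> borel_measurable (lborel \<Otimes>\<^sub>M lborel)" for t
    unfolding mixture_density_def split_beta by measurable
  have slice: "cos (snd (x, s) * t) * mixture_density m (x, s)
      = g x * (cos (s * t) * (indicat_real {0<..} s * exp (- x * s)))" for x s t
    by (simp add: mixture_density_def g_def)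
  have slice_int: "integrable lborel (\<lambda>s. cos (snd (x, s) * t) * mixture_density m (x, s))" for x t
    unfolding slice using inner_int[of x t] g0[of x] by (cases "x > 0") auto
  have slice_val: "(\<integral>s. cos (snd (x, s) * t) * mixture_density m (x, s) \<partial>lborel)
      = 2 / pi * (indicat_real {0<..} x * (x\<^sup>2 / ((m\<^sup>2 + x\<^sup>2) * (x\<^sup>2 + \<bar>t\<bar>\<^sup>2))))" for x t
  proof (cases "x > 0")
    case True
    then show ?thesis
      unfolding slice integral_mult_right_zero inner[OF True] by (simp add: g_def power2_eq_square)
  next
    case False
    then show ?thesis unfolding slice by (simp add: g0)
  qed
  have main: "integrable (lborel \<Otimes>\<^sub>M lborel) (mixture_density m)"
  proof (rule lborel_pair.Fubini_integrable)
    show "mixture_density m \<in> borel_measurable (lborel \<Otimes>\<^sub>M lborel)" using meas[of 0] by simp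
    have "norm (mixture_density m (x, s)) = mixture_density m (x, s)" for x s
    proof -
      have "mixture_density m (x, s) = g x * (indicat_real {0<..} s * exp (- x * s))"
        by (simp add: mixture_density_def g_def)
      then show ?thesis using gnn[of x] by simp
    qed
    then have "(\<integral>s. norm (mixture_density m (x, s)) \<partial>lborel)
        = 2 / pi * (indicat_real {0<..} x * (x\<^sup>2 / ((m\<^sup>2 + x\<^sup>2) * (x\<^sup>2 + 0\<^sup>2))))" for x
      using slice_val[of x 0] by simp
    moreover have "integrable lborel (\<lambda>x. 2 / pi * (indicat_real {0<..} x * (x\<^sup>2 / ((m\<^sup>2 + x\<^sup>2) * (x\<^sup>2 + 0\<^sup>2)))))"
      by (intro integrable_mult_right rational_integral(1) m) auto
    ultimately show "integrable lborel (\<lambda>x. \<integral>s. norm (mixture_density m (x, s)) \<partial>lborel)"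
      by presburger
    show "AE x in lborel. integrable lborel (\<lambda>s. mixture_density m (x, s))"
      using slice_int[of _ 0] by simp
  qed
  show ?int
    by (rule Bochner_Integration.integrable_bound[OF main meas])
      (auto simp: abs_mult intro!: AE_I2 mult_left_le_one_le)
  have "(\<integral>w. cos (snd w * t) * mixture_density m w \<partial>(lborel \<Otimes>\<^sub>M lborel))
      = (\<integral>x. (\<integral>s. cos (snd (x, s) * t) * mixture_density m (x, s) \<partial>lborel) \<partial>lborel)"
    using lborel_pair.integral_fst'[OF \<open>?int\<close>] by simp
  also have "\<dots> = 2 / pi * (pi / 2 / (m + \<bar>t\<bar>))"
    unfolding slice_val integral_mult_right_zero rational_integral(2)[OF m abs_ge_zero] ..
  finally show "(\<integral>w. cos (snd w * t) * mixture_density m w \<partial>(lborel \<Otimes>\<^sub>M lborel)) = 1 / (m + \<bar>t\<bar>)"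
    unfolding times_divide_eq_right by simp
qed

lemma mixture_measure:
  assumes "m > 0"
  shows "complex_borel_measure (mixture_measure m)"
    "measure (total_variation (mixture_measure m)) UNIV \<le> 1 / m"
    "cosine_transform (mixture_measure m) t = 1 / (complex_of_real m + complex_of_real \<bar>t\<bar>)"
proof -
  have m: "snd \<in> borel_measurable (lborel \<Otimes>\<^sub>M (lborel :: real measure))" by simp
  have int: "integrable (lborel \<Otimes>\<^sub>M lborel) (\<lambda>w. complex_of_real (mixture_density m w))"
    using mixture_integral(1)[OF assms, of 0] by simp
  show "complex_borel_measure (mixture_measure m)"
    unfolding mixture_measure_def by (rule complex_borel_measure_weighted_image[OF m int])
  have "norm (complex_of_real (mixture_density m w)) = mixture_density m w" for w
    using assms by (auto simp: mixture_density_def indicator_def split: prod.split)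
  then have "(\<integral>w. norm (complex_of_real (mixture_density m w)) \<partial>(lborel \<Otimes>\<^sub>M lborel)) = 1 / m"
    using mixture_integral(2)[OF assms, of 0] by simp
  then show "measure (total_variation (mixture_measure m)) UNIV \<le> 1 / m"
    unfolding mixture_measure_def using total_variation_weighted_image[OF m int] by simp
  have "cosine_transform (mixture_measure m) t
      = (\<integral>w. complex_of_real (cos (snd w * t)) * complex_of_real (mixture_density m w) \<partial>(lborel \<Otimes>\<^sub>M lborel))"
    unfolding mixture_measure_def by (rule cosine_transform_weighted_image[OF m int])
  also have "\<dots> = (\<integral>w. complex_of_real (cos (snd w * t) * mixture_density m w) \<partial>(lborel \<Otimes>\<^sub>M lborel))"
    by simp
  also have "\<dots> = complex_of_real (1 / (m + \<bar>t\<bar>))"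
    unfolding integral_complex_of_real mixture_integral(2)[OF assms] ..
  finally show "cosine_transform (mixture_measure m) t = 1 / (complex_of_real m + complex_of_real \<bar>t\<bar>)"
    by simp
qed

text \<open>
  The image of the uniform distribution on \<open>[0, 1]\<close> under a constant map is a point mass.
\<close>

definition unit_mass :: "real set \<Rightarrow> complex" where
  "unit_mass = weighted_image (lborel :: real measure) (\<lambda>_. 0) (indicator {0..1})"

lemma unit_mass:
  "complex_borel_measure unit_mass" "cosine_transform unit_mass t = 1"
proof -
  have m: "(\<lambda>_. 0) \<in> borel_measurable (lborel :: real measure)" by simp
  have *: "(\<lambda>x. indicator {0..1} x) = (\<lambda>x::real. complex_of_real (indicator {0..1} x))"
    by (auto simp: indicator_def)
  have int: "integrable lborel (indicator {0..1} :: real \<Rightarrow> complex)"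
    unfolding * complex_of_real_integrable_eq by simp
  show "complex_borel_measure unit_mass"
    unfolding unit_mass_def by (rule complex_borel_measure_weighted_image[OF m int])
  have "cosine_transform unit_mass t = (\<integral>w. complex_of_real (cos (0 * t)) * indicator {0..1} (w::real) \<partial>lborel)"
    unfolding unit_mass_def by (rule cosine_transform_weighted_image[OF m int])
  then show "cosine_transform unit_mass t = 1"
    unfolding * by (simp add: integral_complex_of_real)
qed

section \<open>Averages of the cosine function\<close>

lemma cm_integral_add:
  assumes \<mu>: "complex_borel_measure \<mu>" and f: "bounded_continuous f" and g: "bounded_continuous g"
  shows "cm_integral \<mu> (\<lambda>x. f x + g x) = cm_integral \<mu> f + cm_integral \<mu> g"
  using cm_integral_diff[OF \<mu> bounded_continuous_add[OF f g] g] by simp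

lemma bounded_linear_scaleC_left: "bounded_linear (\<lambda>z. z *\<^sub>C (c::'a::complex_banach))"
  by (rule bounded_bilinear.bounded_linear_left[OF bounded_bilinear_scaleC])

lemma
  fixes ps :: "(real \<times> 'a::complex_banach) list"
  assumes \<mu>: "complex_borel_measure \<mu>"
  shows bounded_continuous_cpoly: "bounded_continuous (cpoly ps)"
    and cm_integral_cpoly: "cm_integral \<mu> (cpoly ps) = ceval (cosine_transform \<mu>) ps"
proof -
  have "bounded_continuous (cpoly ps) \<and> cm_integral \<mu> (cpoly ps) = ceval (cosine_transform \<mu>) ps"
  proof (induction ps)
    case Nil
    have b: "bounded_continuous (\<lambda>s::real. 0 :: 'a)"
      by (rule bounded_continuousI[where K = 0]) auto
    show ?case
      using cm_integral_diff[OF \<mu> b b] b by simp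
  next
    case (Cons p ps)
    have bc: "bounded_continuous (\<lambda>s. complex_of_real (cos (s * fst p)) *\<^sub>C snd p)"
      by (rule bounded_continuous_linear[OF bounded_linear_scaleC_left bounded_continuous_cos])
    have "cm_integral \<mu> (\<lambda>s. complex_of_real (cos (s * fst p)) *\<^sub>C snd p) = cosine_transform \<mu> (fst p) *\<^sub>C snd p"
      unfolding cosine_transform_def
      by (rule cm_integral_linear[OF \<mu> bounded_continuous_cos bounded_linear_scaleC_left])
        (simp add: scaleC_complex_def scaleC_scaleC)
    then show ?case
      using Cons cm_integral_add[OF \<mu> bc] bounded_continuous_add[OF bc] by simp
  qed
  then show "bounded_continuous (cpoly ps)" "cm_integral \<mu> (cpoly ps) = ceval (cosine_transform \<mu>) ps"
    by auto
qed

context bounded_cosine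
begin

lemma norm_cos_average_le:
  assumes \<mu>: "complex_borel_measure \<mu>"
  shows "norm (cos_average Cos \<mu> x) \<le> M * norm x * measure (total_variation \<mu>) UNIV"
  unfolding cos_average_def
  using norm_cm_integral_le[OF \<mu> bounded_continuous_Cos, of UNIV _ 0 "M * norm x"] norm_Cos_le by auto

lemma represents_cos_average:
  assumes \<mu>: "complex_borel_measure \<mu>"
  shows "represents (cosine_transform \<mu>) (cos_average Cos \<mu>)"
proof -
  obtain L where L: "\<And>e. e > 0 \<Longrightarrow> L e \<ge> 0 \<and> measure (total_variation \<mu>) (- {- L e..L e}) < e"
    using total_variation_tail[OF \<mu>] by metis
  show ?thesis
  proof (rule representsI[where C = "measure (total_variation \<mu>) UNIV" and D = 1 and L = L])
    show "cos_average Cos \<mu> (Cos s x) = Cos s (cos_average Cos \<mu> x)" for s x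
      unfolding cos_average_def Cos_commute[of _ s x]
      by (rule cm_integral_linear[OF \<mu> bounded_continuous_Cos]) (auto simp: Cos_scaleC blinfun.bounded_linear_right)
    fix e d K :: real and x :: 'a and ps
    assume e: "e > 0" and near: "cpoly_near (L e) d K x ps"
    note nn = cpoly_near_nonneg[OF near] and Le = L[OF e]
    have "ceval (cosine_transform \<mu>) ps - cos_average Cos \<mu> x = cm_integral \<mu> (\<lambda>s. cpoly ps s - Cos s x)"
      unfolding cos_average_def cm_integral_cpoly[OF \<mu>, symmetric]
      by (rule cm_integral_diff[OF \<mu> bounded_continuous_cpoly[OF \<mu>] bounded_continuous_Cos, symmetric])
    also have "norm \<dots> \<le> d * measure (total_variation \<mu>) UNIV + K * measure (total_variation \<mu>) (- {- L e..L e})"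
      using near nn Le
      by (intro norm_cm_integral_le[OF \<mu>] bounded_continuous_diff[OF bounded_continuous_cpoly[OF \<mu>] bounded_continuous_Cos])
        (auto simp: cpoly_near_def)
    also have "K * measure (total_variation \<mu>) (- {- L e..L e}) \<le> K * e"
      using nn Le by (intro mult_left_mono) auto
    finally show "norm (ceval (cosine_transform \<mu>) ps - cos_average Cos \<mu> x)
        \<le> measure (total_variation \<mu>) UNIV * d + 1 * e * K"
      by (simp add: mult.commute)
  qed (use L in auto)
qed

lemma represents_elementary_calculus:
  assumes "f \<in> elementary_functions"
  shows "represents f (elementary_calculus Cos f)"
proof -
  have "\<exists>\<mu>. complex_borel_measure \<mu> \<and> cosine_transform \<mu> = f"
    using assms by (auto simp: elementary_functions_def)
  from someI_ex[OF this] show ?thesis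
    unfolding elementary_calculus_def using represents_cos_average by metis
qed

text \<open>
  This is where the Laplace transform that defines the generator enters. The weight \<open>exp (-r s)\<close> plays the
  role of the measure; beyond \<open>L\<close> it is at most \<open>exp (-r L / 2)\<close> times the integrable function \<open>exp (-r s / 2)\<close>.
\<close>

lemma represents_resolvent:
  fixes R :: "'a \<Rightarrow>\<^sub>L 'a"
  assumes r: "r > 0"
    and R: "\<And>x. ((\<lambda>t. exp (- (r * t)) *\<^sub>R Cos t x) has_integral r *\<^sub>R R x) {0..}"
  shows "represents (\<lambda>t. 1 / ((complex_of_real r)\<^sup>2 + t\<^sup>2)) R"
proof -
  have exp: "((\<lambda>x. exp (- (a * x))) has_integral 1 / a) {0..}" if "a > 0" for a :: real
    using has_integral_exp_minus_to_infinity[OF that, of 0] by simp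
  have R_Cos: "R (Cos s x) = Cos s (R x)" for s x
  proof -
    have "((\<lambda>t. Cos s (exp (- (r * t)) *\<^sub>R Cos t x)) has_integral Cos s (r *\<^sub>R R x)) {0..}"
      using has_integral_linear[OF R[of x] blinfun.bounded_linear_right[of "Cos s"]] by (simp add: o_def)
    then have "((\<lambda>t. exp (- (r * t)) *\<^sub>R Cos t (Cos s x)) has_integral r *\<^sub>R Cos s (R x)) {0..}"
      by (simp add: blinfun.scaleR_right Cos_commute[of s])
    then have "r *\<^sub>R R (Cos s x) = r *\<^sub>R Cos s (R x)"
      using R[of "Cos s x"] has_integral_unique by blast
    then show ?thesis using r by simp
  qed
  have cpoly_integral: "((\<lambda>s. exp (- (r * s)) *\<^sub>R cpoly ps s) has_integral
      r *\<^sub>R ceval (\<lambda>t. 1 / ((complex_of_real r)\<^sup>2 + t\<^sup>2)) ps) {0..}" for ps :: "(real \<times> 'a) list"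
  proof (induction ps)
    case (Cons p ps)
    have q: "Re (complex_of_real r) > 0" using r by simp
    have ind: "indicat_real {0<..} s *\<^sub>R z = (if s \<in> {0<..} then z else 0)" for s and z :: complex
      by (simp add: indicator_def)
    have "((\<lambda>s. if s \<in> {0<..} then complex_of_real (cos (s * fst p)) * exp (- complex_of_real r * s) else 0)
        has_integral complex_of_real r / ((complex_of_real r)\<^sup>2 + (complex_of_real (fst p))\<^sup>2)) UNIV"
      using has_integral_integral_lborel[OF exp_cos_integral(1)[OF q, of "fst p"],
        unfolded exp_cos_integral(2)[OF q, of "fst p"]]
      unfolding ind by simp
    then have "((\<lambda>s. complex_of_real (cos (s * fst p)) * exp (- complex_of_real r * s))
        has_integral complex_of_real r / ((complex_of_real r)\<^sup>2 + (complex_of_real (fst p))\<^sup>2)) {0<..}"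
      unfolding has_integral_restrict_UNIV .
    then have "((\<lambda>s. complex_of_real (cos (s * fst p)) * exp (- complex_of_real r * s))
        has_integral complex_of_real r / ((complex_of_real r)\<^sup>2 + (complex_of_real (fst p))\<^sup>2)) {0..}"
      by (rule has_integral_spike_set_eq[THEN iffD1, rotated 2])
        (auto intro!: negligible_subset[OF negligible_sing[of 0]])
    from has_integral_linear[OF this bounded_linear_scaleC_left[of "snd p"]]
    have "((\<lambda>s. exp (- (r * s)) *\<^sub>R (complex_of_real (cos (s * fst p)) *\<^sub>C snd p)) has_integral
        r *\<^sub>R ((1 / ((complex_of_real r)\<^sup>2 + (complex_of_real (fst p))\<^sup>2)) *\<^sub>C snd p)) {0..}"
      by (simp add: o_def scaleR_scaleC scaleC_scaleC exp_of_real[symmetric] mult.commute)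
    from has_integral_add[OF this Cons.IH] show ?case
      by (simp add: scaleR_add_right)
  qed simp
  have "\<exists>L\<ge>0. exp (- (r / 2 * L)) < e" if e: "e > 0" for e :: real
  proof -
    have "filterlim (\<lambda>L. (r / 2) * L) at_top at_top"
      using r by (intro filterlim_tendsto_pos_mult_at_top[OF tendsto_const _ filterlim_ident]) auto
    then have "((\<lambda>L. exp (- (r / 2 * L))) \<longlongrightarrow> 0) at_top"
      by (intro filterlim_compose[OF exp_at_bot]) (simp add: filterlim_uminus_at_bot)
    then have "eventually (\<lambda>L. exp (- (r / 2 * L)) < e \<and> 0 \<le> L) at_top"
      using e by (intro eventually_conj eventually_ge_at_top order_tendstoD)
    then show ?thesis
      using eventually_happens by force
  qed
  then obtain L where L: "\<And>e. e > 0 \<Longrightarrow> L e \<ge> 0 \<and> exp (- (r / 2 * L e)) < e"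
    by metis
  show ?thesis
  proof (rule representsI[where C = "1 / r\<^sup>2" and D = "2 / r\<^sup>2" and L = L])
    fix e d K :: real and x :: 'a and ps
    assume e: "e > 0" and near: "cpoly_near (L e) d K x ps"
    note Le = L[OF e]
    have nn: "d \<ge> 0" "K \<ge> 0" using cpoly_near_nonneg[OF near] Le by auto
    let ?z = "ceval (\<lambda>t. 1 / ((complex_of_real r)\<^sup>2 + t\<^sup>2)) ps - R x"
    have int: "((\<lambda>s. exp (- (r * s)) *\<^sub>R (cpoly ps s - Cos s x)) has_integral r *\<^sub>R ?z) {0..}"
      using has_integral_diff[OF cpoly_integral[of ps] R[of x]] by (simp add: scaleR_diff_right)
    have bound: "((\<lambda>s. d * exp (- (r * s)) + (K * e) * exp (- ((r / 2) * s))) has_integral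
        d * (1 / r) + (K * e) * (1 / (r / 2))) {0..}"
      using r by (intro has_integral_add has_integral_mult_right exp) auto
    have le: "norm (exp (- (r * s)) *\<^sub>R (cpoly ps s - Cos s x)) \<le> d * exp (- (r * s)) + (K * e) * exp (- ((r / 2) * s))"
      if "s \<in> {0..}" for s
    proof (cases "s \<le> L e")
      case True
      then have "norm (cpoly ps s - Cos s x) \<le> d"
        using near that by (auto simp: cpoly_near_def)
      then have "norm (exp (- (r * s)) *\<^sub>R (cpoly ps s - Cos s x)) \<le> d * exp (- (r * s))"
        by (simp add: mult.commute)
      then show ?thesis using nn e by (simp add: add_increasing2)
    next
      case False
      have "exp (- (r * s)) = exp (- (r / 2 * s)) * exp (- (r / 2 * s))"
        by (simp add: exp_add[symmetric])
      also have "\<dots> \<le> e * exp (- (r / 2 * s))"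
      proof (rule mult_right_mono)
        have "exp (- (r / 2 * s)) \<le> exp (- (r / 2 * L e))" using False r by simp
        then show "exp (- (r / 2 * s)) \<le> e" using Le by linarith
      qed simp
      finally have "norm (exp (- (r * s)) *\<^sub>R (cpoly ps s - Cos s x)) \<le> (e * exp (- (r / 2 * s))) * K"
        using near e unfolding norm_scaleR cpoly_near_def by (intro mult_mono) auto
      then show ?thesis using nn by (simp add: algebra_simps add_increasing)
    qed
    have "norm (r *\<^sub>R ?z) \<le> d * (1 / r) + (K * e) * (1 / (r / 2))"
      using integral_norm_bound_integral[OF has_integral_integrable[OF int] has_integral_integrable[OF bound] le]
      by (simp only: integral_unique[OF int] integral_unique[OF bound])
    moreover have "norm (r *\<^sub>R ?z) = r * norm ?z"
      using r by (simp only: norm_scaleR abs_of_pos)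
    moreover have "d * (1 / r) + (K * e) * (1 / (r / 2)) = r * (1 / r\<^sup>2 * d + 2 / r\<^sup>2 * e * K)"
      using r by (simp add: field_simps power2_eq_square)
    ultimately have "r * norm ?z \<le> r * (1 / r\<^sup>2 * d + 2 / r\<^sup>2 * e * K)"
      by (simp only:)
    then show "norm ?z \<le> 1 / r\<^sup>2 * d + 2 / r\<^sup>2 * e * K" using r by simp
  qed (use r L R_Cos in auto)
qed

end

section \<open>Resolvents\<close>

lemma resolvent_graph_iff:
  "(shift_op z C)\<inverse> = op_graph R \<longleftrightarrow> (\<forall>x y. (x, z *\<^sub>C x - y) \<in> C \<longleftrightarrow> x = R y)"
proof -
  have 1: "(y, x) \<in> (shift_op z C)\<inverse> \<longleftrightarrow> (x, z *\<^sub>C x - y) \<in> C" for x y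
  proof
    assume "(x, z *\<^sub>C x - y) \<in> C"
    moreover have "y = z *\<^sub>C x - (z *\<^sub>C x - y)" by simp
    ultimately show "(y, x) \<in> (shift_op z C)\<inverse>" unfolding shift_op_def by blast
  qed (auto simp: shift_op_def)
  have 2: "(y, x) \<in> op_graph R \<longleftrightarrow> x = R y" for x y
    by (auto simp: op_graph_def)
  show ?thesis
    using 1 2 by (auto simp: set_eq_iff simp del: converse_iff)
qed

lemma resolvent_eq:
  fixes R :: "'a::complex_banach \<Rightarrow>\<^sub>L 'a"
  assumes "\<And>x y. (x, z *\<^sub>C x - y) \<in> C \<longleftrightarrow> x = R y"
  shows "z \<in> resolvent_set C" "resolvent z C = R"
proof -
  have *: "(shift_op z C)\<inverse> = op_graph (blinfun_apply R)"
    using assms by (simp add: resolvent_graph_iff)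
  then show "z \<in> resolvent_set C" by (auto simp: resolvent_set_def)
  show "resolvent z C = R"
    unfolding resolvent_def
  proof (rule the_equality)
    show "(shift_op z C)\<inverse> = op_graph (blinfun_apply R)" by (rule *)
    fix R' :: "'a \<Rightarrow>\<^sub>L 'a" assume "(shift_op z C)\<inverse> = op_graph (blinfun_apply R')"
    then show "R' = R"
      using assms unfolding resolvent_graph_iff by (intro blinfun_eqI) metis
  qed
qed

lemma resolvent_iff:
  assumes "z \<in> resolvent_set C"
  shows "(x, z *\<^sub>C x - y) \<in> C \<longleftrightarrow> x = resolvent z C y"
proof -
  obtain R :: "'a \<Rightarrow>\<^sub>L 'a" where R: "\<And>x y. (x, z *\<^sub>C x - y) \<in> C \<longleftrightarrow> x = R y"
    using assms unfolding resolvent_set_def resolvent_graph_iff by blast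
  show ?thesis using R resolvent_eq(2)[of z C R] by simp
qed

lemma
  assumes "linear_operator C"
  shows linear_operator_add: "(x, y) \<in> C \<Longrightarrow> (x', y') \<in> C \<Longrightarrow> (x + x', y + y') \<in> C"
    and linear_operator_scaleC: "(x, y) \<in> C \<Longrightarrow> (a *\<^sub>C x, a *\<^sub>C y) \<in> C"
  using assms by (auto simp: linear_operator_def)

lemma linear_operator_diff:
  assumes C: "linear_operator C" and "(x, y) \<in> C" "(x', y') \<in> C"
  shows "(x - x', y - y') \<in> C"
  using linear_operator_add[OF C assms(2) linear_operator_scaleC[OF C assms(3), of "-1"]] by simp

text \<open>
  Solvability and an a priori bound suffice, because the bound applied to a difference of two
  solutions gives uniqueness, and with it the linearity of the solution map.
\<close>

lemma resolvent_setI: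
  assumes C: "linear_operator C"
    and ex: "\<And>y. \<exists>x. (x, z *\<^sub>C x - y) \<in> C"
    and bound: "\<And>x y. (x, z *\<^sub>C x - y) \<in> C \<Longrightarrow> norm x \<le> K * norm y"
    and K: "K \<ge> 0"
  shows "z \<in> resolvent_set C" "norm (resolvent z C) \<le> K"
proof -
  have uniq: "x = x'" if "(x, z *\<^sub>C x - y) \<in> C" "(x', z *\<^sub>C x' - y) \<in> C" for x x' y
  proof -
    have "(x - x', z *\<^sub>C (x - x') - 0) \<in> C"
      using linear_operator_diff[OF C that] by (simp add: scaleC_diff_right)
    from bound[OF this] show ?thesis by simp
  qed
  obtain r where r: "\<And>y. (r y, z *\<^sub>C r y - y) \<in> C"
    using ex by metis
  have lin: "bounded_linear r"
  proof (rule bounded_linear_intro)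
    show "r (x + y) = r x + r y" for x y
    proof (rule uniq[OF r])
      show "(r x + r y, z *\<^sub>C (r x + r y) - (x + y)) \<in> C"
        using linear_operator_add[OF C r[of x] r[of y]] by (simp add: scaleC_add_right algebra_simps)
    qed
    show "r (c *\<^sub>R x) = c *\<^sub>R r x" for c x
    proof (rule uniq[OF r])
      show "(c *\<^sub>R r x, z *\<^sub>C (c *\<^sub>R r x) - c *\<^sub>R x) \<in> C"
        using linear_operator_scaleC[OF C r[of x], of "complex_of_real c"]
        by (simp add: scaleC_diff_right scaleC_scaleC scaleR_scaleC mult.commute)
    qed
    show "norm (r x) \<le> norm x * K" for x
      using bound[OF r[of x]] by (simp add: mult.commute)
  qed
  have *: "(x, z *\<^sub>C x - y) \<in> C \<longleftrightarrow> x = Blinfun r y" for x y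
    using uniq r by (metis bounded_linear_Blinfun_apply[OF lin])
  from resolvent_eq[OF *] show "z \<in> resolvent_set C" "norm (resolvent z C) \<le> K"
    using K bound[OF r] by (auto intro!: norm_blinfun_bound simp: bounded_linear_Blinfun_apply[OF lin])
qed

section \<open>Uniqueness of sectorial square roots\<close>

definition right_half_plane :: "complex set" where
  "right_half_plane = {z. 0 \<le> Re z \<and> z \<noteq> 0}"

text \<open>
  The operators \<open>N z = (z + C)\<^sup>-\<^sup>1\<close> for \<open>z\<close> in the closed right half plane without the origin: this is the part of
  sectoriality of angle less than \<open>\<pi> / 2\<close> on which uniqueness of the square root depends.
\<close>

locale half_plane_resolvent =
  fixes C :: "'a::complex_banach operator" and N :: "complex \<Rightarrow> 'a \<Rightarrow>\<^sub>L 'a" and K :: real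
  assumes linear: "linear_operator C"
    and graph: "z \<in> right_half_plane \<Longrightarrow> (x, y - z *\<^sub>C x) \<in> C \<longleftrightarrow> x = N z y"
    and norm_N: "z \<in> right_half_plane \<Longrightarrow> norm (N z) \<le> K / cmod z"
begin

lemma K_nonneg: "K \<ge> 0"
  using order_trans[OF norm_ge_zero norm_N[of 1]] by (simp add: right_half_plane_def)

lemma N_scaleC:
  assumes "z \<in> right_half_plane"
  shows "N z (a *\<^sub>C y) = a *\<^sub>C N z y"
proof -
  have "(N z y, y - z *\<^sub>C N z y) \<in> C" using graph[OF assms] by simp
  from linear_operator_scaleC[OF linear this, of a]
  have "(a *\<^sub>C N z y, a *\<^sub>C y - z *\<^sub>C (a *\<^sub>C N z y)) \<in> C"
    by (simp add: scaleC_diff_right scaleC_scaleC mult.commute)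
  then show ?thesis using graph[OF assms] by simp
qed

lemma resolvent_identity:
  assumes z: "z \<in> right_half_plane" and w: "w \<in> right_half_plane"
  shows "N z y - N w y = (w - z) *\<^sub>C N z (N w y)"
proof -
  let ?u = "N w y"
  have "(?u, y - w *\<^sub>C ?u) \<in> C" using graph[OF w] by simp
  then have "(?u, (y + (z - w) *\<^sub>C ?u) - z *\<^sub>C ?u) \<in> C"
    by (simp add: scaleC_diff_left)
  then have "?u = N z (y + (z - w) *\<^sub>C ?u)" using graph[OF z] by simp
  then have "?u = N z y + (z - w) *\<^sub>C N z ?u"
    by (simp add: blinfun.add_right N_scaleC[OF z])
  then show ?thesis by (simp add: scaleC_diff_left algebra_simps)
qed

lemma norm_N_le:
  assumes "z \<in> right_half_plane"
  shows "norm (N z y) \<le> K / cmod z * norm y"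
  using norm_blinfun[of "N z" y] mult_right_mono[OF norm_N[OF assms] norm_ge_zero[of y]] by linarith

lemma continuous_on_N: "continuous_on right_half_plane N"
  unfolding continuous_on_def
proof
  fix w assume w: "w \<in> right_half_plane"
  then have w0: "w \<noteq> 0" by (simp add: right_half_plane_def)
  have "(N \<longlongrightarrow> N w) (at w within right_half_plane)"
  proof (rule LIM_zero_cancel, rule Lim_null_comparison)
    show "\<forall>\<^sub>F z in at w within right_half_plane. norm (N z - N w) \<le> cmod (w - z) * (K / cmod z * (K / cmod w))"
    proof (rule eventually_mono[OF eventually_at_filter[THEN iffD2]])
      show "\<forall>\<^sub>F z in nhds w. z \<noteq> w \<longrightarrow> z \<in> right_half_plane \<longrightarrow> z \<in> right_half_plane" by simp
      fix z assume z: "z \<in> right_half_plane"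
      show "norm (N z - N w) \<le> cmod (w - z) * (K / cmod z * (K / cmod w))"
      proof (rule norm_blinfun_bound)
        show "0 \<le> cmod (w - z) * (K / cmod z * (K / cmod w))" using K_nonneg by simp
        fix y
        have "norm (N z (N w y)) \<le> K / cmod z * (K / cmod w * norm y)"
          using norm_N_le[OF z, of "N w y"] norm_N_le[OF w, of y] K_nonneg
          by (meson divide_nonneg_nonneg mult_left_mono norm_ge_zero order_trans)
        then show "norm ((N z - N w) y) \<le> cmod (w - z) * (K / cmod z * (K / cmod w)) * norm y"
          using mult_left_mono[of _ _ "cmod (w - z)"]
          by (simp add: blinfun.diff_left resolvent_identity[OF z w] norm_scaleC mult.assoc del: times_divide_eq_left times_divide_eq_right)
      qed
    qed
    have "((\<lambda>z. cmod (w - z) * (K / cmod z * (K / cmod w))) \<longlongrightarrow> cmod (w - w) * (K / cmod w * (K / cmod w)))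
        (at w within right_half_plane)"
      using w0 by (intro tendsto_intros) auto
    then show "((\<lambda>z. cmod (w - z) * (K / cmod z * (K / cmod w))) \<longlongrightarrow> 0) (at w within right_half_plane)"
      by simp
  qed
  then show "(N \<longlongrightarrow> N w) (at w within right_half_plane)" .
qed

lemma continuous_on_N_apply:
  assumes "continuous_on S g" "continuous_on S v" "\<And>t. t \<in> S \<Longrightarrow> g t \<in> right_half_plane"
  shows "continuous_on S (\<lambda>t. N (g t) (v t))"
  by (intro blinfun.continuous_on continuous_on_compose2[OF continuous_on_N] assms) (use assms in auto)

lemma has_derivative_N:
  assumes w: "w \<in> right_half_plane"
  shows "((\<lambda>z. N z y) has_derivative (\<lambda>h. - (h *\<^sub>C N w (N w y)))) (at w within right_half_plane)"
  unfolding has_derivative_iff_norm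
proof (intro conjI)
  show "bounded_linear (\<lambda>h. - (h *\<^sub>C N w (N w y)))"
    by (intro bounded_linear_minus bounded_linear_scaleC_left)
  have "continuous_on right_half_plane (\<lambda>z. norm (N z (N w y) - N w (N w y)))"
    by (intro continuous_on_norm continuous_on_diff continuous_on_N_apply continuous_on_id continuous_on_const)
  then have "((\<lambda>z. norm (N z (N w y) - N w (N w y))) \<longlongrightarrow> norm (N w (N w y) - N w (N w y))) (at w within right_half_plane)"
    using w unfolding continuous_on_def by blast
  then have lim: "((\<lambda>z. norm (N z (N w y) - N w (N w y))) \<longlongrightarrow> 0) (at w within right_half_plane)" by simp
  have "norm (N z y - N w y - - ((z - w) *\<^sub>C N w (N w y))) / norm (z - w) = norm (N z (N w y) - N w (N w y))"
    if z: "z \<in> right_half_plane" "z \<noteq> w" for z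
  proof -
    have "N z y - N w y - - ((z - w) *\<^sub>C N w (N w y)) = (w - z) *\<^sub>C (N z (N w y) - N w (N w y))"
      by (simp only: resolvent_identity[OF z(1) w, of y]) (simp add: scaleC_diff_left scaleC_diff_right)
    then show ?thesis using z(2) by (simp add: norm_scaleC norm_minus_commute)
  qed
  then have "\<forall>\<^sub>F z in at w within right_half_plane.
      norm (N z (N w y) - N w (N w y)) = norm (N z y - N w y - - ((z - w) *\<^sub>C N w (N w y))) / norm (z - w)"
    unfolding eventually_at_filter by (intro always_eventually) auto
  then show "((\<lambda>z. norm (N z y - N w y - - ((z - w) *\<^sub>C N w (N w y))) / norm (z - w)) \<longlongrightarrow> 0) (at w within right_half_plane)"
    by (rule Lim_transform_eventually[OF lim])
qed

text \<open>
  The factorization \<open>r\<^sup>2 + C\<^sup>2 = (i r + C) (- i r + C)\<close>: the product of the two resolvents is determined by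
  the square of the operator.
\<close>

lemma square_graph:
  fixes y :: 'a
  assumes r: "r > (0::real)"
  defines "u \<equiv> N (\<i> * r) (N (- \<i> * r) y)"
  shows "(u, y - (complex_of_real r)\<^sup>2 *\<^sub>C u) \<in> C O C"
    and "(v, y - (complex_of_real r)\<^sup>2 *\<^sub>C v) \<in> C O C \<Longrightarrow> v = u"
proof -
  have z: "\<i> * r \<in> right_half_plane" "- \<i> * r \<in> right_half_plane"
    using r by (auto simp: right_half_plane_def)
  have sq: "\<i> * r * (\<i> * r) = - ((complex_of_real r)\<^sup>2)"
    by (simp add: power2_eq_square mult_ac)
  let ?w = "N (- \<i> * r) y"
  have 1: "(?w, y - (- \<i> * r) *\<^sub>C ?w) \<in> C" using graph[OF z(2)] by blast
  have 2: "(u, ?w - (\<i> * r) *\<^sub>C u) \<in> C" unfolding u_def using graph[OF z(1)] by blast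
  have "(?w - (\<i> * r) *\<^sub>C u, (y - (- \<i> * r) *\<^sub>C ?w) - (\<i> * r) *\<^sub>C (?w - (\<i> * r) *\<^sub>C u)) \<in> C"
    by (rule linear_operator_diff[OF linear 1 linear_operator_scaleC[OF linear 2]])
  moreover have "(y - (- \<i> * r) *\<^sub>C ?w) - (\<i> * r) *\<^sub>C (?w - (\<i> * r) *\<^sub>C u) = y - (complex_of_real r)\<^sup>2 *\<^sub>C u"
    unfolding scaleC_diff_right scaleC_scaleC sq by simp
  ultimately have "(?w - (\<i> * r) *\<^sub>C u, y - (complex_of_real r)\<^sup>2 *\<^sub>C u) \<in> C"
    by (simp only:)
  with 2 show "(u, y - (complex_of_real r)\<^sup>2 *\<^sub>C u) \<in> C O C"
    by (rule relcompI)
  assume "(v, y - (complex_of_real r)\<^sup>2 *\<^sub>C v) \<in> C O C"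
  then obtain w where w: "(v, w) \<in> C" "(w, y - (complex_of_real r)\<^sup>2 *\<^sub>C v) \<in> C" by auto
  define v' where "v' = w + (\<i> * r) *\<^sub>C v"
  have "(v', (y - (complex_of_real r)\<^sup>2 *\<^sub>C v) + (\<i> * r) *\<^sub>C w) \<in> C"
    unfolding v'_def by (rule linear_operator_add[OF linear w(2) linear_operator_scaleC[OF linear w(1)]])
  moreover have "(y - (complex_of_real r)\<^sup>2 *\<^sub>C v) + (\<i> * r) *\<^sub>C w = y - (- \<i> * r) *\<^sub>C v'"
    unfolding v'_def scaleC_add_right mult_minus_left scaleC_minus_left scaleC_scaleC sq by simp
  ultimately have "v' = ?w" using graph[OF z(2)] by simp
  moreover have "v = N (\<i> * r) v'" using graph[OF z(1), of v v'] w(1) by (simp add: v'_def)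
  ultimately show "v = u" by (simp add: u_def)
qed

end

lemma half_plane_resolvent_sectorial:
  assumes C: "sectorial \<omega> C" and \<omega>: "\<omega> < pi / 2"
  shows "\<exists>N K. half_plane_resolvent C N K"
proof -
  define \<omega>' where "\<omega>' = (\<omega> + pi / 2) / 2"
  have \<omega>': "\<omega> < \<omega>'" "0 < \<omega>'" "\<omega>' < pi / 2" "\<omega>' < pi"
    using C \<omega> pi_gt_zero by (auto simp: \<omega>'_def sectorial_def)
  have lin: "linear_operator C" using C by (simp add: sectorial_def)
  have "sector \<omega>' \<subseteq> {z. cos \<omega>' * cmod z \<le> Re z}"
  proof safe
    fix z assume "z \<in> sector \<omega>'"
    then have z: "z \<noteq> 0" "\<bar>Arg z\<bar> < \<omega>'" using \<omega>' by (auto simp: sector_def)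
    have "cos \<omega>' \<le> cos \<bar>Arg z\<bar>"
      using z \<omega>' by (intro cos_monotone_0_pi_le) auto
    then have "cos \<omega>' * cmod z \<le> cos (Arg z) * cmod z"
      by (intro mult_right_mono) auto
    then show "cos \<omega>' * cmod z \<le> Re z"
      using z(1) by (simp add: cos_Arg)
  qed
  moreover have "closed {z. cos \<omega>' * cmod z \<le> Re z}"
    by (intro closed_Collect_le continuous_intros)
  ultimately have sub: "closure (sector \<omega>') \<subseteq> {z. cos \<omega>' * cmod z \<le> Re z}"
    by (rule closure_minimal)
  have out: "- z \<notin> closure (sector \<omega>')" if "z \<in> right_half_plane" for z
  proof
    assume "- z \<in> closure (sector \<omega>')"
    then have "cos \<omega>' * cmod z \<le> - Re z" using sub by auto
    moreover have "cos \<omega>' * cmod z > 0"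
      using that \<omega>' by (intro mult_pos_pos cos_gt_zero) (auto simp: right_half_plane_def)
    ultimately show False using that by (auto simp: right_half_plane_def)
  qed
  have "sector \<omega> \<subseteq> sector \<omega>'"
    using \<omega>' by (auto simp: sector_def)
  then have "closure (sector \<omega>) \<subseteq> closure (sector \<omega>')" by (rule closure_mono)
  then have res: "- z \<in> resolvent_set C" if "z \<in> right_half_plane" for z
    using out[OF that] C by (auto simp: sectorial_def spectrum_def)
  obtain K where K: "\<And>z. z \<notin> closure (sector \<omega>') \<Longrightarrow> cmod z * norm (resolvent z C) \<le> K"
  proof -
    have "bdd_above ((\<lambda>z. cmod z * norm (resolvent z C)) ` (- closure (sector \<omega>')))"
      using C \<omega>' by (simp add: sectorial_def)
    then obtain K where K: "\<forall>y\<in>(\<lambda>z. cmod z * norm (resolvent z C)) ` (- closure (sector \<omega>')). y \<le> K"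
      unfolding bdd_above_def by blast
    show ?thesis
      by (rule that[of K]) (use K in blast)
  qed
  have "half_plane_resolvent C (\<lambda>z. - resolvent (- z) C) K"
  proof
    fix z assume z: "z \<in> right_half_plane"
    show "(x, y - z *\<^sub>C x) \<in> C \<longleftrightarrow> x = (- resolvent (- z) C) y" for x y
      using resolvent_iff[OF res[OF z], of x "- y"] by (simp add: blinfun.minus_left blinfun.minus_right)
    show "norm (- resolvent (- z) C) \<le> K / cmod z"
      using K[OF out[OF z]] z by (simp add: field_simps right_half_plane_def)
  qed (rule lin)
  then show ?thesis by blast
qed

text \<open>
  Let \<open>d z = (z + B)\<^sup>-\<^sup>1 x - (z + C)\<^sup>-\<^sup>1 x\<close>. By the resolvent identity and the preceding factorization, \<open>B\<^sup>2 = C\<^sup>2\<close> means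
  \<open>d (i r) = d (- i r)\<close> for \<open>r > 0\<close>: as a function of \<open>z\<^sup>2\<close>, \<open>d\<close> extends across the cut from the slit plane to the
  punctured plane. It is of order \<open>1 / \<bar>z\<bar>\<close>, so it must vanish by Liouville's theorem.

  To obtain \<open>d p = 0\<close> for vector-valued functions directly, the argument is applied to
  \<open>f z = - z\<^sup>2 (d z - d p) / (z\<^sup>2 - p\<^sup>2)\<close>, which has no singularity at \<open>p\<close>, again by the resolvent identity. Its integral over the half
  circle of radius \<open>r\<close> does not depend on \<open>r\<close>, because \<open>f\<close> has the same value at both endpoints. It tends to
  \<open>0\<close> for \<open>r \<rightarrow> 0\<close> and to \<open>\<pi> d p\<close> for \<open>r \<rightarrow> \<infinity>\<close>.
\<close>

lemma resolvents_agree: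
  assumes B: "half_plane_resolvent B N K" and C: "half_plane_resolvent C S L" and eq: "B O B = C O C"
    and p: "(p::real) > 0"
  shows "N p x = S p x"
proof -
  interpret B: half_plane_resolvent B N K by fact
  interpret C: half_plane_resolvent C S L by fact
  let ?H = right_half_plane
  define a where "a = N p x"
  define b where "b = S p x"
  define d where "d z = N z x - S z x" for z
  define g where "g z = z\<^sup>2 / (z + p)" for z :: complex
  define g' where "g' z = (2 * z * (z + p) - z\<^sup>2) / (z + p)\<^sup>2" for z :: complex
  define f where "f z = g z *\<^sub>C (N z a - S z b)" for z
  define f' where "f' z = g' z *\<^sub>C (N z a - S z b) - g z *\<^sub>C (N z (N z a) - S z (S z b))" for z
  have pH: "complex_of_real p \<in> ?H" using p by (simp add: right_half_plane_def)
  have zp: "z + p \<noteq> 0" "cmod (z + p) \<ge> p" if "z \<in> ?H" for z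
  proof -
    have "Re (z + p) \<ge> p" using that by (simp add: right_half_plane_def)
    then show "cmod (z + p) \<ge> p" using complex_Re_le_cmod order_trans by blast
    then show "z + p \<noteq> 0" using p by auto
  qed
  have df: "(f has_derivative (\<lambda>h. h *\<^sub>C f' w)) (at w within ?H)" if w: "w \<in> ?H" for w
  proof -
    have "(g has_field_derivative g' w) (at w within ?H)"
      unfolding g_def g'_def using zp(1)[OF w]
      by (auto intro!: derivative_eq_intros simp: power2_eq_square)
    then have dg: "(g has_derivative (\<lambda>h. g' w * h)) (at w within ?H)"
      by (simp add: has_field_derivative_def mult_commute_abs)
    have "(f has_derivative (\<lambda>h. g w *\<^sub>C (- (h *\<^sub>C N w (N w a)) - - (h *\<^sub>C S w (S w b)))
        + (g' w * h) *\<^sub>C (N w a - S w b))) (at w within ?H)"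
      unfolding f_def
      by (rule bounded_bilinear.FDERIV[OF bounded_bilinear_scaleC dg
          has_derivative_diff[OF B.has_derivative_N[OF w] C.has_derivative_N[OF w]]])
    moreover have "g w *\<^sub>C (- (h *\<^sub>C N w (N w a)) - - (h *\<^sub>C S w (S w b))) + (g' w * h) *\<^sub>C (N w a - S w b)
        = h *\<^sub>C f' w" for h
      by (simp add: f'_def scaleC_diff_right scaleC_scaleC mult.commute)
    ultimately show ?thesis by simp
  qed
  have cf: "continuous_on ?H f"
    by (rule has_derivative_continuous_on[OF df])
  have cf': "continuous_on ?H f'"
  proof -
    have cN: "continuous_on ?H (\<lambda>z. N z (v z))" if "continuous_on ?H v" for v
      by (rule B.continuous_on_N_apply[OF continuous_on_id that])
    have cS: "continuous_on ?H (\<lambda>z. S z (v z))" if "continuous_on ?H v" for v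
      by (rule C.continuous_on_N_apply[OF continuous_on_id that])
    have "continuous_on ?H g" "continuous_on ?H g'"
      unfolding g_def g'_def by (intro continuous_intros; use zp in simp)+
    then show ?thesis
      unfolding f'_def
      by (intro continuous_on_diff bounded_bilinear.continuous_on[OF bounded_bilinear_scaleC]
          cN cS continuous_on_const)
  qed
  have arc: "complex_of_real r * cis \<theta> \<in> ?H" if "r > 0" "\<theta> \<in> {- (pi / 2)..pi / 2}" for r \<theta>
  proof -
    have "cos \<theta> \<ge> 0" using that by (intro cos_ge_zero) auto
    then show ?thesis using that by (simp add: right_half_plane_def)
  qed
  have path: "((\<lambda>t. f (\<gamma> t)) has_vector_derivative (\<gamma>' *\<^sub>C f' (\<gamma> t))) (at t within T)"
    if "(\<gamma> has_vector_derivative \<gamma>') (at t within T)" "\<And>t. t \<in> T \<Longrightarrow> \<gamma> t \<in> ?H" "t \<in> T" for \<gamma> \<gamma>' t T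
  proof -
    have "((\<lambda>t. f (\<gamma> t)) has_derivative (\<lambda>h. (h *\<^sub>R \<gamma>') *\<^sub>C f' (\<gamma> t))) (at t within T)"
      using that by (intro has_derivative_in_compose2[of ?H f "\<lambda>w h. h *\<^sub>C f' w" \<gamma> T t] df)
        (auto simp: has_vector_derivative_def)
    then show ?thesis
      by (simp add: has_vector_derivative_def bounded_bilinear.scaleR_left[OF bounded_bilinear_scaleC])
  qed
  have fd: "f z = - ((z\<^sup>2 / (z\<^sup>2 - p\<^sup>2)) *\<^sub>C (d z - d p))" if z: "z \<in> ?H" "z \<noteq> p" for z
  proof -
    have "d z - d p = (complex_of_real p - z) *\<^sub>C (N z a - S z b)"
      using B.resolvent_identity[OF z(1) pH, of x] C.resolvent_identity[OF z(1) pH, of x]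
      by (simp add: d_def a_def b_def scaleC_diff_right algebra_simps)
    moreover have "- (z\<^sup>2 / (z\<^sup>2 - p\<^sup>2)) * (complex_of_real p - z) = g z"
    proof -
      have "z\<^sup>2 - p\<^sup>2 = (z - p) * (z + p)" by (simp add: algebra_simps power2_eq_square)
      moreover have "z - p \<noteq> 0" using z(2) by simp
      ultimately show ?thesis using zp(1)[OF z(1)] by (simp add: g_def divide_simps) (simp add: algebra_simps)
    qed
    ultimately show ?thesis
      unfolding f_def by (simp add: scaleC_scaleC flip: scaleC_minus_left)
  qed
  have match: "f (\<i> * r) = f (- \<i> * r)" if r: "r > 0" for r :: real
  proof -
    have z: "\<i> * r \<in> ?H" "- \<i> * r \<in> ?H" "\<i> * r \<noteq> p" "- \<i> * r \<noteq> p"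
      using r p by (auto simp: right_half_plane_def complex_eq_iff)
    have "N (\<i> * r) (N (- \<i> * r) x) = S (\<i> * r) (S (- \<i> * r) x)"
      using B.square_graph(1)[OF r, of x] unfolding eq by (rule C.square_graph(2)[OF r])
    then have "N (\<i> * r) x - N (- \<i> * r) x = S (\<i> * r) x - S (- \<i> * r) x"
      by (simp only: B.resolvent_identity[OF z(1,2), of x] C.resolvent_identity[OF z(1,2), of x])
    then have "d (\<i> * r) = d (- \<i> * r)"
      unfolding d_def by (simp only: diff_eq_eq) (simp add: algebra_simps)
    then show ?thesis
      unfolding fd[OF z(1,3)] fd[OF z(2,4)] by simp
  qed
  define m where "m r = integral {- (pi / 2)..pi / 2} (\<lambda>\<theta>. f (complex_of_real r * cis \<theta>))" for r
  have int: "(\<lambda>\<theta>. f (complex_of_real r * cis \<theta>)) integrable_on {- (pi / 2)..pi / 2}" if "r > 0" for r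
    using arc[OF that]
    by (intro integrable_continuous_interval continuous_on_compose2[OF cf] continuous_intros) auto
  have dm: "(m has_vector_derivative 0) (at r within {0<..})" if r: "r \<in> {0<..}" for r
  proof -
    let ?F = "\<lambda>r \<theta>. cis \<theta> *\<^sub>C f' (complex_of_real r * cis \<theta>)"
    have "((\<lambda>r. integral (cbox (- (pi / 2)) (pi / 2)) (\<lambda>\<theta>. f (complex_of_real r * cis \<theta>)))
        has_vector_derivative integral (cbox (- (pi / 2)) (pi / 2)) (?F r)) (at r within {0<..})"
    proof (rule leibniz_rule_vector_derivative)
      fix s \<theta> :: real assume s: "s \<in> {0<..}" "\<theta> \<in> cbox (- (pi / 2)) (pi / 2)"
      show "((\<lambda>r. f (complex_of_real r * cis \<theta>)) has_vector_derivative ?F s \<theta>) (at s within {0<..})"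
      proof (rule path)
        show "((\<lambda>r. complex_of_real r * cis \<theta>) has_vector_derivative cis \<theta>) (at s within {0<..})"
          by (auto intro!: derivative_eq_intros simp: has_vector_derivative_def scaleR_conv_of_real)
      qed (use s arc in auto)
    next
      fix s :: real assume "s \<in> {0<..}"
      then show "(\<lambda>\<theta>. f (complex_of_real s * cis \<theta>)) integrable_on cbox (- (pi / 2)) (pi / 2)"
        using int by simp
    next
      have "continuous_on ({0<..} \<times> cbox (- (pi / 2)) (pi / 2)) (\<lambda>q. ?F (fst q) (snd q))"
        by (intro bounded_bilinear.continuous_on[OF bounded_bilinear_scaleC]
            continuous_on_compose2[OF cf'] continuous_intros) (use arc in auto)
      then show "continuous_on ({0<..} \<times> cbox (- (pi / 2)) (pi / 2)) (\<lambda>(r, \<theta>). ?F r \<theta>)"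
        by (simp add: split_beta)
    qed (use r in auto)
    \<comment> \<open>up to the factor \<open>i r\<close> the integrand is the derivative of \<open>f (r cis \<theta>)\<close> in \<open>\<theta>\<close>\<close>
    moreover have "integral (cbox (- (pi / 2)) (pi / 2)) (?F r) = 0"
    proof -
      have intF: "?F r integrable_on {- (pi / 2)..pi / 2}"
        using arc r by (intro integrable_continuous_interval bounded_bilinear.continuous_on[OF bounded_bilinear_scaleC]
            continuous_on_compose2[OF cf'] continuous_intros) auto
      have "((\<lambda>\<theta>. (\<i> * r * cis \<theta>) *\<^sub>C f' (complex_of_real r * cis \<theta>)) has_integral
          (f (complex_of_real r * cis (pi / 2)) - f (complex_of_real r * cis (- (pi / 2))))) {- (pi / 2)..pi / 2}"
      proof (rule fundamental_theorem_of_calculus)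
        fix \<theta> :: real assume "\<theta> \<in> {- (pi / 2)..pi / 2}"
        then show "((\<lambda>\<theta>. f (complex_of_real r * cis \<theta>)) has_vector_derivative
            (\<i> * r * cis \<theta>) *\<^sub>C f' (complex_of_real r * cis \<theta>)) (at \<theta> within {- (pi / 2)..pi / 2})"
          using r arc
          by (intro path) (auto intro!: derivative_eq_intros simp: has_vector_derivative_def scaleR_conv_of_real)
      qed simp
      moreover have "f (complex_of_real r * cis (pi / 2)) - f (complex_of_real r * cis (- (pi / 2))) = 0"
        using match[of r] r by (simp add: mult.commute)
      ultimately have "((\<lambda>\<theta>. (\<i> * r * cis \<theta>) *\<^sub>C f' (complex_of_real r * cis \<theta>)) has_integral 0) {- (pi / 2)..pi / 2}"
        by (simp only:)
      moreover have "((\<lambda>\<theta>. (\<i> * r) *\<^sub>C ?F r \<theta>) has_integral (\<i> * r) *\<^sub>C integral {- (pi / 2)..pi / 2} (?F r)) {- (pi / 2)..pi / 2}"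
        using has_integral_linear[OF integrable_integral[OF intF]
            bounded_bilinear.bounded_linear_right[OF bounded_bilinear_scaleC, of "\<i> * r"]]
        by (simp add: o_def)
      ultimately have "(\<i> * r) *\<^sub>C integral {- (pi / 2)..pi / 2} (?F r) = (\<i> * r) *\<^sub>C 0"
        using has_integral_unique by (auto simp: scaleC_scaleC)
      moreover have "\<i> * complex_of_real r \<noteq> 0" using r by simp
      ultimately have "integral {- (pi / 2)..pi / 2} (?F r) = 0"
        using scaleC_cancel by blast
      then show ?thesis by simp
    qed
    ultimately show ?thesis by (simp add: m_def[abs_def])
  qed
  then obtain c where c: "\<And>r. r > 0 \<Longrightarrow> m r = c"
    using has_vector_derivative_zero_constant[of "{0<..}" m] by auto
  have mean: "norm (m r - pi *\<^sub>R v) \<le> e * pi"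
    if r: "r > 0" and e: "\<And>z. z \<in> ?H \<Longrightarrow> cmod z = r \<Longrightarrow> norm (f z - v) \<le> e" for r v e
  proof -
    have "((\<lambda>\<theta>. v) has_integral (pi / 2 - - (pi / 2)) *\<^sub>R v) {- (pi / 2)..pi / 2}"
      using has_integral_const_real[of v "- (pi / 2)" "pi / 2"] by simp
    then have "((\<lambda>\<theta>. f (complex_of_real r * cis \<theta>) - v) has_integral m r - pi *\<^sub>R v) {- (pi / 2)..pi / 2}"
      unfolding m_def using has_integral_diff[OF integrable_integral[OF int[OF r]]] by simp
    moreover have "0 \<le> e"
      using order_trans[OF norm_ge_zero e[of "complex_of_real r"]] r by (simp add: right_half_plane_def)
    ultimately have "norm (m r - pi *\<^sub>R v) \<le> e * measure lborel {- (pi / 2)..pi / 2}"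
      using arc r by (intro has_integral_bound_real) (auto intro!: e simp: norm_mult)
    then show ?thesis by simp
  qed
  have small: "norm c \<le> r * ((K * norm a + L * norm b) / p * pi)" if r: "r > 0" for r
  proof -
    have "norm (f z - 0) \<le> r * ((K * norm a + L * norm b) / p)" if z: "z \<in> ?H" "cmod z = r" for z
    proof -
      have "norm (N z a - S z b) \<le> K / r * norm a + L / r * norm b"
        using norm_triangle_ineq4[of "N z a" "S z b"] B.norm_N_le[OF z(1), of a] C.norm_N_le[OF z(1), of b] z(2)
        by simp
      moreover have "cmod (g z) \<le> r\<^sup>2 / p"
        unfolding g_def norm_divide norm_power z(2) using zp[OF z(1)] p by (intro divide_left_mono mult_pos_pos) auto
      ultimately have "norm (f z) \<le> r\<^sup>2 / p * (K / r * norm a + L / r * norm b)"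
        unfolding f_def norm_scaleC using p by (intro mult_mono) auto
      also have "\<dots> = r * ((K * norm a + L * norm b) / p)"
        using r p by (simp add: field_simps power2_eq_square)
      finally show ?thesis by simp
    qed
    from mean[OF r this] show ?thesis using c[OF r] by (simp add: mult.assoc)
  qed
  have "((\<lambda>r. r * ((K * norm a + L * norm b) / p * pi)) \<longlongrightarrow> 0 * ((K * norm a + L * norm b) / p * pi)) (at_right 0)"
    by (intro tendsto_intros)
  then have "norm c \<le> 0 * ((K * norm a + L * norm b) / p * pi)"
    by (rule tendsto_lowerbound) (rule eventually_mono[OF eventually_at_right_less small], auto)
  then have "c = 0" by simp
  define h where "h r = (r\<^sup>2 * ((K + L) * norm x / r) + p\<^sup>2 * norm (d p)) / (r\<^sup>2 - p\<^sup>2)" for r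
  have "norm (pi *\<^sub>R d p) \<le> h r * pi" if r: "r > p" for r
  proof -
    have r0: "r > 0" and rp: "r\<^sup>2 - p\<^sup>2 > 0" using r p by (auto simp: power_strict_mono)
    have "norm (f z - d p) \<le> h r" if z: "z \<in> ?H" "cmod z = r" for z
    proof -
      have z': "z \<noteq> p" using z(2) r p by auto
      have den: "cmod (z\<^sup>2 - p\<^sup>2) \<ge> r\<^sup>2 - p\<^sup>2"
        using norm_triangle_ineq2[of "z\<^sup>2" "(complex_of_real p)\<^sup>2"] z(2) by (simp add: norm_power)
      then have nz: "z\<^sup>2 - p\<^sup>2 \<noteq> 0" using rp by auto
      have "f z - d p = (1 / (z\<^sup>2 - p\<^sup>2)) *\<^sub>C ((complex_of_real p)\<^sup>2 *\<^sub>C d p - z\<^sup>2 *\<^sub>C d z)"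
      proof -
        have "(z\<^sup>2 / (z\<^sup>2 - p\<^sup>2)) *\<^sub>C d p - d p = (p\<^sup>2 / (z\<^sup>2 - p\<^sup>2)) *\<^sub>C d p"
        proof -
          have "z\<^sup>2 / (z\<^sup>2 - p\<^sup>2) - 1 = p\<^sup>2 / (z\<^sup>2 - p\<^sup>2)" using nz by (simp add: field_simps)
          then show ?thesis using scaleC_diff_left[of "z\<^sup>2 / (z\<^sup>2 - p\<^sup>2)" 1 "d p"] by simp
        qed
        then show ?thesis
          unfolding fd[OF z(1) z'] scaleC_diff_right scaleC_scaleC by simp
      qed
      then have "norm (f z - d p) = norm ((complex_of_real p)\<^sup>2 *\<^sub>C d p - z\<^sup>2 *\<^sub>C d z) / cmod (z\<^sup>2 - p\<^sup>2)"
        by (simp add: norm_scaleC norm_divide)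
      also have "\<dots> \<le> (p\<^sup>2 * norm (d p) + r\<^sup>2 * norm (d z)) / (r\<^sup>2 - p\<^sup>2)"
        using norm_triangle_ineq4[of "(complex_of_real p)\<^sup>2 *\<^sub>C d p" "z\<^sup>2 *\<^sub>C d z"] rp den z(2)
        by (intro frac_le) (auto simp: norm_scaleC norm_power)
      also have "\<dots> \<le> h r"
      proof -
        have "norm (d z) \<le> (K + L) * norm x / r"
          unfolding d_def
          using norm_triangle_ineq4[of "N z x" "S z x"] B.norm_N_le[OF z(1), of x] C.norm_N_le[OF z(1), of x] z(2)
          by (simp add: add_divide_distrib distrib_right)
        then have "r\<^sup>2 * norm (d z) \<le> r\<^sup>2 * ((K + L) * norm x / r)"
          by (rule mult_left_mono) simp
        then show ?thesis
          unfolding h_def using rp by (intro divide_right_mono) linarith+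
      qed
      finally show ?thesis .
    qed
    from mean[OF r0 this] show ?thesis using c[OF r0] \<open>c = 0\<close> by simp
  qed
  moreover have "((\<lambda>r. h r * pi) \<longlongrightarrow> 0) at_top"
  proof -
    define c1 where "c1 = (K + L) * norm x"
    define c2 where "c2 = p\<^sup>2 * norm (d p)"
    have inv: "((\<lambda>r. inverse r) \<longlongrightarrow> (0::real)) at_top" by (rule tendsto_inverse_0_at_top[OF filterlim_ident])
    have lim: "((\<lambda>r. (c1 * inverse r + c2 * (inverse r)\<^sup>2) / (1 - p\<^sup>2 * (inverse r)\<^sup>2) * pi) \<longlongrightarrow>
        (c1 * 0 + c2 * 0\<^sup>2) / (1 - p\<^sup>2 * 0\<^sup>2) * pi) at_top"
      by (intro tendsto_intros inv) auto
    have "(c1 * inverse r + c2 * (inverse r)\<^sup>2) / (1 - p\<^sup>2 * (inverse r)\<^sup>2) * pi = h r * pi" if "r > 0" for r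
    proof -
      have "(c1 * inverse r + c2 * (inverse r)\<^sup>2) / (1 - p\<^sup>2 * (inverse r)\<^sup>2)
          = (r\<^sup>2 * (c1 * inverse r + c2 * (inverse r)\<^sup>2)) / (r\<^sup>2 * (1 - p\<^sup>2 * (inverse r)\<^sup>2))"
        using that by simp
      also have "r\<^sup>2 * (c1 * inverse r + c2 * (inverse r)\<^sup>2) = r\<^sup>2 * (c1 / r) + c2"
        using that by (simp add: field_simps power2_eq_square)
      also have "r\<^sup>2 * (1 - p\<^sup>2 * (inverse r)\<^sup>2) = r\<^sup>2 - p\<^sup>2"
        using that by (simp add: field_simps power2_eq_square)
      finally show ?thesis by (simp add: h_def c1_def c2_def)
    qed
    then have "\<forall>\<^sub>F r in at_top. (c1 * inverse r + c2 * (inverse r)\<^sup>2) / (1 - p\<^sup>2 * (inverse r)\<^sup>2) * pi = h r * pi"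
      by (rule eventually_mono[OF eventually_gt_at_top[of 0]])
    from Lim_transform_eventually[OF lim this] show ?thesis by simp
  qed
  ultimately have "norm (pi *\<^sub>R d p) \<le> 0"
    by (intro tendsto_lowerbound[where f = "\<lambda>r. h r * pi" and F = at_top])
      (auto intro: eventually_mono[OF eventually_gt_at_top[of p]])
  then have "d p = 0" using pi_gt_zero by (auto simp: mult_le_0_iff)
  then show ?thesis by (simp add: d_def)
qed

lemma sectorial_square_root_unique:
  assumes "sectorial \<alpha> B" "\<alpha> < pi / 2" "sectorial \<beta> C" "\<beta> < pi / 2" "B O B = C O C"
  shows "B = C"
proof -
  obtain N K where B: "half_plane_resolvent B N K"
    using half_plane_resolvent_sectorial[OF assms(1,2)] by blast
  obtain S L where C: "half_plane_resolvent C S L"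
    using half_plane_resolvent_sectorial[OF assms(3,4)] by blast
  interpret B: half_plane_resolvent B N K by fact
  interpret C: half_plane_resolvent C S L by fact
  have one: "1 \<in> right_half_plane" by (simp add: right_half_plane_def)
  have "N 1 y = S 1 y" for y
    using resolvents_agree[OF B C assms(5), of 1 y] by simp
  then have "(x, y) \<in> B \<longleftrightarrow> (x, y) \<in> C" for x y
    using B.graph[OF one, of x "y + x"] C.graph[OF one, of x "y + x"] by simp
  then show ?thesis by auto
qed

section \<open>The operator of the absolute value\<close>

lemma closure_sector_bound:
  assumes "z \<notin> closure (sector (pi / 4))"
  shows "z \<noteq> 0" "Re z \<le> \<bar>Im z\<bar>"
proof -
  have "(0::complex) \<in> closure (sector (pi / 4))"
    unfolding closure_sequential
  proof (intro exI conjI allI)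
    show "complex_of_real (inverse (real (Suc n))) \<in> sector (pi / 4)" for n
    proof -
      have "Arg (complex_of_real (inverse (real (Suc n)))) = 0"
        unfolding Arg_eq_0 by (simp del: of_nat_Suc)
      then show ?thesis by (simp add: sector_def del: of_nat_Suc)
    qed
    show "(\<lambda>n. complex_of_real (inverse (real (Suc n)))) \<longlonglongrightarrow> 0"
      using tendsto_of_real[OF LIMSEQ_inverse_real_of_nat, where ?'a = complex] by (simp only: of_real_0)
  qed
  then show z0: "z \<noteq> 0" using assms by auto
  have "z \<notin> sector (pi / 4)" using assms closure_subset by blast
  then have arg: "\<bar>Arg z\<bar> \<ge> pi / 4" using z0 by (auto simp: sector_def)
  show "Re z \<le> \<bar>Im z\<bar>"
  proof (rule ccontr)
    assume "\<not> ?thesis"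
    then have re: "Re z > 0" "\<bar>Im z\<bar> < Re z" by auto
    then have "Arg z = arctan (Im z / Re z)" by (intro arg_conv_arctan) auto
    moreover have "\<bar>Im z / Re z\<bar> < 1" using re by (simp add: abs_divide)
    then have "arctan (Im z / Re z) < arctan 1" "arctan (- 1) < arctan (Im z / Re z)"
      by (simp_all only: arctan_less_iff abs_less_iff) linarith+
    ultimately show False using arg by (simp add: arctan_one arctan_minus)
  qed
qed

lemma generator_resolvent_one:
  assumes gen: "generates_cosine (neg_op A) Cos"
  obtains R :: "'a::complex_banach \<Rightarrow>\<^sub>L 'a"
  where "\<And>x y. (x, y) \<in> A \<longleftrightarrow> x = R (x + y)"
    and "\<And>x. ((\<lambda>t. exp (- (1 * t)) *\<^sub>R Cos t x) has_integral 1 *\<^sub>R R x) {0..}"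
proof
  have neg: "(x, y) \<in> neg_op A \<longleftrightarrow> (x, - y) \<in> A" for x y
    by (force simp: neg_op_def)
  have one: "1 \<in> resolvent_set (neg_op A)"
    using gen unfolding generates_cosine_def by (auto dest: spec[of _ 1])
  show "(x, y) \<in> A \<longleftrightarrow> x = resolvent 1 (neg_op A) (x + y)" for x y
    using resolvent_iff[OF one, of x "x + y"] by (simp add: neg)
  show "((\<lambda>t. exp (- (1 * t)) *\<^sub>R Cos t x) has_integral 1 *\<^sub>R resolvent 1 (neg_op A) x) {0..}" for x
    using gen unfolding generates_cosine_def by (auto dest: spec[of _ 1])
qed

text \<open>
  The resolvent identity carries the description of the graph of \<open>T\<close> from one point to another, so
  an operator whose resolvent is known at one point has every compatible family as its resolvent.
\<close>

lemma graph_resolvent_transfer: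
  assumes S: "\<And>x y. (x, y - \<nu> *\<^sub>C x) \<in> T \<longleftrightarrow> x = S y"
    and S_linear: "\<And>a x y. S (a *\<^sub>C x + y) = a *\<^sub>C S x + S y"
    and R_linear: "\<And>a x y. R (a *\<^sub>C x + y) = a *\<^sub>C R x + R y"
    and RS: "\<And>y. R y - S y = (\<nu> - \<mu>) *\<^sub>C R (S y)" and SR: "\<And>y. S (R y) = R (S y)"
  shows "(x, y - \<mu> *\<^sub>C x) \<in> T \<longleftrightarrow> x = R (y :: 'a::complex_banach)"
proof -
  define z where "z = (\<nu> - \<mu>) *\<^sub>C x + y"
  have "y - \<mu> *\<^sub>C x = z - \<nu> *\<^sub>C x"
    by (simp add: z_def scaleC_diff_left)
  then have "(x, y - \<mu> *\<^sub>C x) \<in> T \<longleftrightarrow> x = S z"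
    using S[of x z] by simp
  also have "\<dots> \<longleftrightarrow> x = R y"
  proof
    assume x: "x = S z"
    have "R z - x = (\<nu> - \<mu>) *\<^sub>C R x" using RS[of z] x by simp
    moreover have "R z = (\<nu> - \<mu>) *\<^sub>C R x + R y" by (simp only: z_def R_linear)
    ultimately show "x = R y" by simp
  next
    assume x: "x = R y"
    have "S z = (\<nu> - \<mu>) *\<^sub>C R (S y) + S y" by (simp add: z_def S_linear x SR)
    then show "x = S z" using RS[of y] x by (simp add: algebra_simps)
  qed
  finally show ?thesis .
qed

text \<open>
  A bound \<open>M \<ge> 1\<close> keeps the constants below uniform; it can always be enlarged.
\<close>

locale cosine_generator = bounded_cosine Cos M for Cos :: "real \<Rightarrow> 'a::complex_banach \<Rightarrow>\<^sub>L 'a" and M +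
  fixes A :: "'a operator"
  assumes M_ge_1: "M \<ge> 1"
    and generates: "generates_cosine (neg_op A) Cos"
begin

definition Q :: "complex \<Rightarrow> 'a \<Rightarrow> 'a" where
  "Q q = cos_average Cos (exponential_measure q)"

definition N :: "real \<Rightarrow> 'a \<Rightarrow> 'a" where
  "N m = cos_average Cos (mixture_measure m)"

text \<open>
  The operator with \<open>(1 + B)\<^sup>-\<^sup>1 = N 1\<close>, that is, \<open>\<Phi>(\<bar>t\<bar>)\<close> computed with the regularizer \<open>1 / (1 + \<bar>t\<bar>)\<close>.
\<close>

definition B :: "'a operator" where
  "B = {(x, y). x = N 1 (x + y)}"

lemma represents_Q:
  assumes "Re q > 0"
  shows "represents (\<lambda>t. 1 / (q\<^sup>2 + complex_of_real (t\<^sup>2))) (Q q)"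
proof -
  have "cosine_transform (exponential_measure q) = (\<lambda>t. 1 / (q\<^sup>2 + complex_of_real (t\<^sup>2)))"
    by (rule ext) (rule exponential_measure(3)[OF assms])
  with represents_cos_average[OF exponential_measure(1)[OF assms]] show ?thesis
    unfolding Q_def by simp
qed

lemma represents_N:
  assumes "m > 0"
  shows "represents (\<lambda>t. 1 / (complex_of_real m + complex_of_real \<bar>t\<bar>)) (N m)"
proof -
  have "cosine_transform (mixture_measure m) = (\<lambda>t. 1 / (complex_of_real m + complex_of_real \<bar>t\<bar>))"
    by (rule ext) (rule mixture_measure(3)[OF assms])
  with represents_cos_average[OF mixture_measure(1)[OF assms]] show ?thesis
    unfolding N_def by simp
qed

lemma norm_Q_le:
  assumes "Re q > 0"
  shows "norm (Q q y) \<le> M / (cmod q * Re q) * norm y"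
proof -
  have "norm (Q q y) \<le> M * norm y * measure (total_variation (exponential_measure q)) UNIV"
    unfolding Q_def by (rule norm_cos_average_le[OF exponential_measure(1)[OF assms]])
  also have "\<dots> \<le> M * norm y * (1 / (cmod q * Re q))"
    using M_nonneg by (intro mult_left_mono exponential_measure(2)[OF assms]) auto
  finally show ?thesis by simp
qed

lemma norm_N_le:
  assumes "m > 0"
  shows "norm (N m y) \<le> M / m * norm y"
proof -
  have "norm (N m y) \<le> M * norm y * measure (total_variation (mixture_measure m)) UNIV"
    unfolding N_def by (rule norm_cos_average_le[OF mixture_measure(1)[OF assms]])
  also have "\<dots> \<le> M * norm y * (1 / m)"
    using M_nonneg by (intro mult_left_mono mixture_measure(2)[OF assms]) auto
  finally show ?thesis by simp
qed

text \<open>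
  Both the resolvent in the definition of the generator and \<open>Q 1\<close> are represented by \<open>1 / (1 + t\<^sup>2)\<close>.
\<close>

lemma A_graph_one: "(x, y) \<in> A \<longleftrightarrow> x = Q 1 (x + y)"
proof -
  obtain R :: "'a \<Rightarrow>\<^sub>L 'a" where R: "\<And>x y. (x, y) \<in> A \<longleftrightarrow> x = R (x + y)"
    "\<And>x. ((\<lambda>t. exp (- (1 * t)) *\<^sub>R Cos t x) has_integral 1 *\<^sub>R R x) {0..}"
    using generator_resolvent_one[OF generates] by metis
  have "represents (\<lambda>t. 1 / ((complex_of_real 1)\<^sup>2 + t\<^sup>2)) R"
    by (rule represents_resolvent[OF _ R(2)]) simp
  moreover have "represents (\<lambda>t. 1 / ((complex_of_real 1)\<^sup>2 + t\<^sup>2)) (Q 1)"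
    using represents_Q[of 1] by simp
  ultimately have "blinfun_apply R = Q 1"
    by (rule represents_unique)
  then show ?thesis using R(1) by simp
qed

lemma A_graph:
  assumes q: "Re q > 0"
  shows "(x, y - q\<^sup>2 *\<^sub>C x) \<in> A \<longleftrightarrow> x = Q q y"
proof (rule graph_resolvent_transfer[where \<nu> = 1 and S = "Q 1"])
  have one: "Re 1 > 0" by simp
  note rep = represents_Q[OF q] represents_Q[OF one]
  show "(x, y - 1 *\<^sub>C x) \<in> A \<longleftrightarrow> x = Q 1 y" for x y
    using A_graph_one[of x "y - x"] by simp
  have "1 / (q\<^sup>2 + complex_of_real (t\<^sup>2)) - 1 / (1\<^sup>2 + complex_of_real (t\<^sup>2))
      = (1 - q\<^sup>2) * (1 / (q\<^sup>2 + complex_of_real (t\<^sup>2)) * (1 / (1\<^sup>2 + complex_of_real (t\<^sup>2))))" for t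
    using square_sum_nonzero[OF q, of t] square_sum_nonzero[OF one, of t] by (simp add: divide_simps)
  then have "(\<lambda>y. Q q y - Q 1 y) = (\<lambda>y. (1 - q\<^sup>2) *\<^sub>C Q q (Q 1 y))"
    using represents_unique[OF represents_diff[OF rep]] represents_scale[OF represents_mult[OF rep], of "1 - q\<^sup>2"]
    by simp
  then show "Q q y - Q 1 y = (1 - q\<^sup>2) *\<^sub>C Q q (Q 1 y)" for y by meson
qed (use represents_linear_comb[OF represents_Q[OF q]] represents_linear_comb[OF represents_Q[of 1]]
    represents_commute[OF represents_Q[of 1] represents_Q[OF q]] in auto)

lemma B_graph:
  assumes m: "m > 0"
  shows "(x, y - complex_of_real m *\<^sub>C x) \<in> B \<longleftrightarrow> x = N m y"
proof (rule graph_resolvent_transfer[where \<nu> = 1 and S = "N 1"])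
  note rep = represents_N[OF m] represents_N[OF zero_less_one]
  show "(x, y - 1 *\<^sub>C x) \<in> B \<longleftrightarrow> x = N 1 y" for x y
    by (simp add: B_def)
  have "1 / (complex_of_real m + complex_of_real \<bar>t\<bar>) - 1 / (complex_of_real 1 + complex_of_real \<bar>t\<bar>)
      = (1 - complex_of_real m) * (1 / (complex_of_real m + complex_of_real \<bar>t\<bar>) * (1 / (complex_of_real 1 + complex_of_real \<bar>t\<bar>)))" for t
  proof -
    have "complex_of_real (m + \<bar>t\<bar>) \<noteq> 0" "complex_of_real (1 + \<bar>t\<bar>) \<noteq> 0"
      unfolding of_real_eq_0_iff using m by linarith+
    then show ?thesis by (simp add: divide_simps)
  qed
  then have "(\<lambda>y. N m y - N 1 y) = (\<lambda>y. (1 - complex_of_real m) *\<^sub>C N m (N 1 y))"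
    using represents_unique[OF represents_diff[OF rep]] represents_scale[OF represents_mult[OF rep], of "1 - complex_of_real m"]
    by simp
  then show "N m y - N 1 y = (1 - complex_of_real m) *\<^sub>C N m (N 1 y)" for y by meson
qed (use represents_linear_comb[OF represents_N[OF m]] represents_linear_comb[OF represents_N[of 1]]
    represents_commute[OF represents_N[of 1] represents_N[OF m]] in auto)

lemma Q_inject: "Q 1 x = Q 1 y \<Longrightarrow> x = y"
proof -
  assume eq: "Q 1 x = Q 1 y"
  have "generates_cosine (neg_op A) Cos" by (rule generates)
  then have "linear_operator (neg_op A)" by (simp add: generates_cosine_def)
  then have sv: "single_valued (neg_op A)" by (simp add: linear_operator_def)
  have neg: "(u, - v) \<in> neg_op A" if "(u, v) \<in> A" for u v
    using that by (auto simp: neg_op_def)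
  have "(Q 1 x, x - Q 1 x) \<in> A" "(Q 1 x, y - Q 1 x) \<in> A"
    using A_graph_one eq by auto
  from single_valuedD[OF sv neg[OF this(1)] neg[OF this(2)]] show "x = y" by simp
qed

abbreviation "N1 \<equiv> N 1"
abbreviation "Q1 \<equiv> Q 1"

lemma rep1: "represents (\<lambda>t. 1 / (1 + complex_of_real \<bar>t\<bar>)) N1" "represents (\<lambda>t. 1 / (1 + (complex_of_real \<bar>t\<bar>)\<^sup>2)) Q1"
proof -
  show "represents (\<lambda>t. 1 / (1 + complex_of_real \<bar>t\<bar>)) N1"
    using represents_N[of 1] by simp
  have "complex_of_real (t\<^sup>2) = (complex_of_real \<bar>t\<bar>)\<^sup>2" for t
    by (simp flip: of_real_power)
  then show "represents (\<lambda>t. 1 / (1 + (complex_of_real \<bar>t\<bar>)\<^sup>2)) Q1"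
    using represents_Q[of 1] by simp
qed

text \<open>
  With \<open>n = 1 / (1 + \<bar>t\<bar>)\<close> and \<open>q = 1 / (1 + t\<^sup>2)\<close> this is \<open>n\<^sup>2 = q (1 - 2 n + 2 n\<^sup>2)\<close>. Together with commutation
  it is what connects the two resolvents: it links \<open>B\<close> to \<open>A\<close> and transfers injectivity from \<open>Q 1\<close> to \<open>N 1\<close>.
\<close>

lemma N_Q_identity: "N1 (N1 x) = Q1 x - 2 *\<^sub>C N1 (Q1 x) + 2 *\<^sub>C N1 (N1 (Q1 x))"
proof -
  let ?n = "\<lambda>t. 1 / (1 + complex_of_real \<bar>t\<bar>)" and ?q = "\<lambda>t. 1 / (1 + (complex_of_real \<bar>t\<bar>)\<^sup>2)"
  note n = rep1(1) and q = rep1(2)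
  have "?n t * ?n t = ?q t - 2 * (?n t * ?q t) + 2 * (?n t * (?n t * ?q t))" for t
  proof -
    have "complex_of_real (1 + \<bar>t\<bar>) \<noteq> 0" "complex_of_real (1 + \<bar>t\<bar>\<^sup>2) \<noteq> 0"
      unfolding of_real_eq_0_iff using zero_le_power2[of "\<bar>t\<bar>"] by linarith+
    then have nz: "1 + complex_of_real \<bar>t\<bar> \<noteq> 0" "1 + (complex_of_real \<bar>t\<bar>)\<^sup>2 \<noteq> 0"
      by (simp_all only: of_real_add of_real_1 of_real_power not_False_eq_True)
    have "1 / a * (1 / a) = 1 / b - 2 * (1 / a * (1 / b)) + 2 * (1 / a * (1 / a * (1 / b)))"
      if "a \<noteq> 0" "b \<noteq> 0" "b = a * a - 2 * a + 2" for a b :: complex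
    proof -
      have "1 / b - 2 * (1 / a * (1 / b)) + 2 * (1 / a * (1 / a * (1 / b))) = (a * a - 2 * a + 2) / (a * a * b)"
        using that(1,2) by (simp add: field_simps)
      also have "\<dots> = 1 / a * (1 / a)"
        unfolding that(3)[symmetric] using that(1,2) by simp
      finally show ?thesis ..
    qed
    from this[OF nz] show ?thesis by (simp add: algebra_simps power2_eq_square)
  qed
  then have eq: "(\<lambda>t. ?n t * ?n t) = (\<lambda>t. ?q t - 2 * (?n t * ?q t) + 2 * (?n t * (?n t * ?q t)))" by (rule ext)
  have "(\<lambda>x. N1 (N1 x)) = (\<lambda>x. Q1 x - 2 *\<^sub>C N1 (Q1 x) + 2 *\<^sub>C N1 (N1 (Q1 x)))"
  proof (rule represents_unique)
    show "represents (\<lambda>t. ?n t * ?n t) (\<lambda>x. N1 (N1 x))" by (rule represents_mult[OF n n])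
    show "represents (\<lambda>t. ?n t * ?n t) (\<lambda>x. Q1 x - 2 *\<^sub>C N1 (Q1 x) + 2 *\<^sub>C N1 (N1 (Q1 x)))"
      unfolding eq
      by (rule represents_add[OF represents_diff[OF q represents_scale[OF represents_mult[OF n q]]]
            represents_scale[OF represents_mult[OF n represents_mult[OF n q]]]])
  qed
  then show ?thesis by meson
qed

lemmas N_linear = represents_add_right[OF rep1(1)] represents_diff_right[OF rep1(1)]
  represents_scaleC_right[OF rep1(1)] represents_zero_right[OF rep1(1)]

lemmas Q_linear = represents_add_right[OF rep1(2)] represents_diff_right[OF rep1(2)]
  represents_scaleC_right[OF rep1(2)] represents_zero_right[OF rep1(2)]

lemma Q_N_commute: "Q1 (N1 x) = N1 (Q1 x)"
  by (rule represents_commute[OF rep1(2) rep1(1)])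

lemma two_scaleC: "2 *\<^sub>C x = x + (x::'a)"
  using scaleC_add_left[of 1 1 x] by simp

lemma N_inject: "N1 x = N1 y \<Longrightarrow> x = y"
proof -
  assume "N1 x = N1 y"
  then have z: "N1 (x - y) = 0" by (simp add: N_linear)
  have "N1 (Q1 (x - y)) = 0" using z Q_N_commute[of "x - y"] by (simp add: Q_linear)
  then have "Q1 (x - y) = Q1 0"
    using N_Q_identity[of "x - y"] z by (simp add: N_linear Q_linear)
  from Q_inject[OF this] show "x = y" by simp
qed

lemma linear_B: "linear_operator B"
  unfolding linear_operator_def single_valued_def B_def
proof (safe, goal_cases)
  case (1 x y z)
  then have "N1 (x + y) = N1 (x + z)" by simp
  from N_inject[OF this] show "y = z" by simp
next
  case 2 show "0 = N1 (0 + 0)" by (simp add: N_linear)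
next
  case (3 x y x' y')
  have "x + x' + (y + y') = (x + y) + (x' + y')" by simp
  then show "x + x' = N1 (x + x' + (y + y'))" using 3 N_linear(1)[of "x + y" "x' + y'"] by metis
next
  case (4 a x y)
  then show "a *\<^sub>C x = N1 (a *\<^sub>C x + a *\<^sub>C y)"
    using N_linear(3)[of a "x + y"] by (simp add: scaleC_add_right)
qed

text \<open>
  For one inclusion, \<open>E = 1 - 2 N + 2 N\<^sup>2\<close> is the image of \<open>(1 + t\<^sup>2) / (1 + \<bar>t\<bar>)\<^sup>2\<close>; it satisfies \<open>E Q = N\<^sup>2\<close>, so it is injective and can be
  cancelled. For the other one, \<open>w\<close> is the image of \<open>\<bar>t\<bar> / (1 + t\<^sup>2) = q + n - 2 n q\<close> applied to \<open>x + y\<close>.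
\<close>

lemma B_square: "B O B = A"
proof (intro equalityI subsetI; clarify)
  fix x w y assume "(x, w) \<in> B" "(w, y) \<in> B"
  define a where "a = x + w"
  define b where "b = w + y"
  define E where "E v = v - 2 *\<^sub>C N1 v + 2 *\<^sub>C N1 (N1 v)" for v
  have x: "x = N1 a" and w: "w = N1 b"
    using \<open>(x, w) \<in> B\<close> \<open>(w, y) \<in> B\<close> by (simp_all add: B_def a_def b_def)
  have EQ: "E (Q1 v) = N1 (N1 v)" for v
    using N_Q_identity[of v] by (simp add: E_def)
  have QE: "Q1 (E v) = E (Q1 v)" for v
    by (simp add: E_def Q_linear Q_N_commute)
  have Nb: "N1 b = a - N1 a" using x w by (simp add: a_def)
  have "x + y = b - w + x" by (simp add: b_def)
  then have xy: "x + y = b - a + 2 *\<^sub>C N1 a" using x w Nb by (simp add: two_scaleC)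
  have "N1 (N1 (x + y)) = N1 (N1 b) - N1 (N1 a) + 2 *\<^sub>C N1 (N1 (N1 a))"
    by (simp add: xy N_linear)
  also have "\<dots> = E (N1 a)"
    by (simp add: Nb N_linear E_def two_scaleC)
  finally have "E (Q1 (x + y)) = E x" using EQ x by simp
  then have "E (Q1 (Q1 (x + y))) = E (Q1 x)" using QE by metis
  then have "N1 (N1 (Q1 (x + y))) = N1 (N1 x)" using EQ by simp
  then have "Q1 (x + y) = x" using N_inject by blast
  then show "(x, y) \<in> A" using A_graph_one by simp
next
  fix x y assume "(x, y) \<in> A"
  define v where "v = x + y"
  define w where "w = Q1 v + N1 v - 2 *\<^sub>C N1 (Q1 v)"
  have x: "x = Q1 v" using \<open>(x, y) \<in> A\<close> A_graph_one by (simp add: v_def)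
  have "N1 (x + w) = Q1 v"
    using N_Q_identity[of v] by (simp add: w_def x N_linear two_scaleC)
  then have "(x, w) \<in> B" using x by (simp add: B_def)
  moreover have "N1 (w + y) = w"
  proof -
    have "w + y = v + N1 v - 2 *\<^sub>C N1 (Q1 v)" using x by (simp add: w_def v_def)
    then have "N1 (w + y) = N1 (v + N1 v - 2 *\<^sub>C N1 (Q1 v))" by (simp only:)
    also have "\<dots> = w" using N_Q_identity[of v] by (simp add: w_def N_linear two_scaleC)
    finally show ?thesis .
  qed
  then have "(w, y) \<in> B" by (simp add: B_def)
  ultimately show "(x, y) \<in> B O B" by blast
qed

text \<open>
  The factorization \<open>B\<^sup>2 - z\<^sup>2 = (B - z) (B + z)\<close> gives \<open>(B - z)\<^sup>-\<^sup>1 = (B + z) (A - z\<^sup>2)\<^sup>-\<^sup>1\<close>, and \<open>A - z\<^sup>2 = A + q\<^sup>2\<close> for \<open>q = - i z\<close> or \<open>q = i z\<close>,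
  whichever has positive real part. With \<open>u = (A - z\<^sup>2)\<^sup>-\<^sup>1 y\<close> the term \<open>B u\<close> is estimated by
  \<open>B u = r u + (B + r)\<^sup>-\<^sup>1 (A u - r\<^sup>2 u)\<close> with \<open>r = \<bar>z\<bar>\<close>.
\<close>

lemma B_resolvent_nonreal:
  assumes z: "Im z \<noteq> 0"
  shows "\<exists>x. (x, z *\<^sub>C x - y) \<in> B"
    and "(x, z *\<^sub>C x - y) \<in> B \<Longrightarrow> norm x \<le> ((2 + 2 * M) * M * (cmod z / \<bar>Im z\<bar>) + M) / cmod z * norm y"
proof -
  have z0: "z \<noteq> 0" using z by auto
  define q where "q = (if Im z > 0 then - \<i> * z else \<i> * z)"
  have q: "Re q = \<bar>Im z\<bar>" "Re q > 0" "cmod q = cmod z" "q\<^sup>2 = - (z\<^sup>2)"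
    using z by (auto simp: q_def norm_mult power_mult_distrib)
  have solution: "\<exists>u w. (w + z *\<^sub>C u, z *\<^sub>C (w + z *\<^sub>C u) - y) \<in> B \<and> u = Q q (- y) \<and> (u, w) \<in> B \<and> (w, z\<^sup>2 *\<^sub>C u - y) \<in> B" for y
  proof -
    define u where "u = Q q (- y)"
    have "(u, - y - q\<^sup>2 *\<^sub>C u) \<in> A" using A_graph[OF q(2)] u_def by blast
    then have "(u, z\<^sup>2 *\<^sub>C u - y) \<in> B O B" unfolding B_square by (simp add: q(4))
    then obtain w where w: "(u, w) \<in> B" "(w, z\<^sup>2 *\<^sub>C u - y) \<in> B" by auto
    have "(w + z *\<^sub>C u, (z\<^sup>2 *\<^sub>C u - y) + z *\<^sub>C w) \<in> B"
      by (rule linear_operator_add[OF linear_B w(2) linear_operator_scaleC[OF linear_B w(1)]])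
    moreover have "(z\<^sup>2 *\<^sub>C u - y) + z *\<^sub>C w = z *\<^sub>C (w + z *\<^sub>C u) - y"
      by (simp add: scaleC_add_right scaleC_scaleC power2_eq_square)
    ultimately show ?thesis using w u_def by metis
  qed
  then show "\<exists>x. (x, z *\<^sub>C x - y) \<in> B" by blast
  assume x: "(x, z *\<^sub>C x - y) \<in> B"
  obtain u w where uw: "(w + z *\<^sub>C u, z *\<^sub>C (w + z *\<^sub>C u) - y) \<in> B" "u = Q q (- y)" "(u, w) \<in> B" "(w, z\<^sup>2 *\<^sub>C u - y) \<in> B"
    using solution by blast
  define v where "v = x - (w + z *\<^sub>C u)"
  have v: "(v, z *\<^sub>C v) \<in> B"
    using linear_operator_diff[OF linear_B x uw(1)] by (simp add: v_def scaleC_diff_right)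
  have "(z *\<^sub>C v, z *\<^sub>C (z *\<^sub>C v)) \<in> B" by (rule linear_operator_scaleC[OF linear_B v])
  with v have "(v, z *\<^sub>C (z *\<^sub>C v)) \<in> A" unfolding B_square[symmetric] by (rule relcompI)
  moreover have "z *\<^sub>C (z *\<^sub>C v) = 0 - q\<^sup>2 *\<^sub>C v"
    by (simp only: q(4) scaleC_minus_left scaleC_scaleC) (simp only: power2_eq_square, simp)
  ultimately have "(v, 0 - q\<^sup>2 *\<^sub>C v) \<in> A" by (simp only:)
  then have "v = Q q 0" using A_graph[OF q(2)] by blast
  then have "v = 0" using represents_zero_right[OF represents_Q[OF q(2)]] by simp
  then have x_eq: "x = w + z *\<^sub>C u" by (simp add: v_def)
  define r where "r = cmod z"
  have r: "r > 0" using z0 by (simp add: r_def)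
  have u: "norm u \<le> M / (r * \<bar>Im z\<bar>) * norm y"
    using norm_Q_le[OF q(2), of "- y"] by (simp add: uw(2) q r_def)
  define s where "s = z\<^sup>2 *\<^sub>C u - y"
  have "(w - complex_of_real r *\<^sub>C u, s - complex_of_real r *\<^sub>C w) \<in> B"
    unfolding s_def by (rule linear_operator_diff[OF linear_B uw(4) linear_operator_scaleC[OF linear_B uw(3)]])
  moreover have "s - complex_of_real r *\<^sub>C w
      = (s - (complex_of_real r * complex_of_real r) *\<^sub>C u) - complex_of_real r *\<^sub>C (w - complex_of_real r *\<^sub>C u)"
    by (simp add: scaleC_diff_right scaleC_scaleC)
  ultimately have "w - complex_of_real r *\<^sub>C u = N r (s - (complex_of_real r * complex_of_real r) *\<^sub>C u)"
    using B_graph[OF r] by simp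
  then have "norm (w - complex_of_real r *\<^sub>C u) \<le> M / r * norm (s - (complex_of_real r * complex_of_real r) *\<^sub>C u)"
    using norm_N_le[OF r] by simp
  also have "\<dots> \<le> M / r * (2 * r\<^sup>2 * norm u + norm y)"
  proof (rule mult_left_mono)
    have "norm (s - (complex_of_real r * complex_of_real r) *\<^sub>C u) \<le> norm (z\<^sup>2 *\<^sub>C u) + norm y + norm ((complex_of_real r * complex_of_real r) *\<^sub>C u)"
      unfolding s_def by (meson norm_triangle_ineq4 add_right_mono order_trans)
    then show "norm (s - (complex_of_real r * complex_of_real r) *\<^sub>C u) \<le> 2 * r\<^sup>2 * norm u + norm y"
      using r by (simp add: norm_scaleC norm_power norm_mult r_def power2_eq_square mult.commute)
  qed (use M_nonneg r in simp)
  also have "\<dots> = 2 * M * r * norm u + M / r * norm y"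
    using r by (simp add: field_simps power2_eq_square)
  finally have w: "norm (w - complex_of_real r *\<^sub>C u) \<le> 2 * M * r * norm u + M / r * norm y" .
  have "x = (w - complex_of_real r *\<^sub>C u) + (complex_of_real r *\<^sub>C u + z *\<^sub>C u)" by (simp add: x_eq)
  also have "norm \<dots> \<le> norm (w - complex_of_real r *\<^sub>C u) + (norm (complex_of_real r *\<^sub>C u) + norm (z *\<^sub>C u))"
    by (meson norm_triangle_ineq add_left_mono order_trans)
  also have "\<dots> \<le> (2 + 2 * M) * r * norm u + M / r * norm y"
    using w r by (simp add: norm_scaleC r_def algebra_simps)
  also have "\<dots> \<le> (2 + 2 * M) * r * (M / (r * \<bar>Im z\<bar>) * norm y) + M / r * norm y"
    using u r M_nonneg by (intro add_right_mono mult_left_mono) auto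
  also have "\<dots> = ((2 + 2 * M) * M * (r / \<bar>Im z\<bar>) + M) / r * norm y"
    using r z by (simp add: field_simps)
  finally show "norm x \<le> ((2 + 2 * M) * M * (cmod z / \<bar>Im z\<bar>) + M) / cmod z * norm y"
    by (simp add: r_def)
qed

text \<open>
  Near the negative real axis the previous bound deteriorates. There \<open>z\<close> is a small perturbation of
  \<open>- m = Re z\<close>, and the resolvent equation is solved as a fixed point of a contraction with constant \<open>1 / 2\<close>.
\<close>

lemma B_resolvent_negative:
  assumes z: "Re z < 0" "2 * M * \<bar>Im z\<bar> \<le> - Re z"
  shows "\<exists>x. (x, z *\<^sub>C x - y) \<in> B"
    and "(x, z *\<^sub>C x - y) \<in> B \<Longrightarrow> norm x \<le> 4 * M / cmod z * norm y"
proof -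
  define m where "m = - Re z"
  have m: "m > 0" using z by (simp add: m_def)
  have graph: "(x, z *\<^sub>C x - y) \<in> B \<longleftrightarrow> x = N m ((\<i> * Im z) *\<^sub>C x - y)" for x y
  proof -
    have "\<i> * Im z = z + complex_of_real m" by (simp add: complex_eq_iff m_def)
    then have "(\<i> * Im z) *\<^sub>C x = z *\<^sub>C x + complex_of_real m *\<^sub>C x"
      by (simp only: scaleC_add_left)
    then have "z *\<^sub>C x - y = ((\<i> * Im z) *\<^sub>C x - y) - complex_of_real m *\<^sub>C x"
      by (simp only:) simp
    then show ?thesis by (simp only: B_graph[OF m])
  qed
  have small: "M / m * \<bar>Im z\<bar> \<le> 1 / 2"
    using z m by (simp add: m_def field_simps)
  have contraction: "norm (N m ((\<i> * Im z) *\<^sub>C x - y)) \<le> 1 / 2 * norm x + M / m * norm y" for x y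
  proof -
    have "norm (N m ((\<i> * Im z) *\<^sub>C x - y)) \<le> M / m * (\<bar>Im z\<bar> * norm x + norm y)"
      using norm_N_le[OF m, of "(\<i> * Im z) *\<^sub>C x - y"] M_nonneg m
        mult_left_mono[OF norm_triangle_ineq4[of "(\<i> * Im z) *\<^sub>C x" y], of "M / m"]
      by (simp add: norm_scaleC norm_mult)
    also have "\<dots> \<le> 1 / 2 * norm x + M / m * norm y"
      using mult_right_mono[OF small norm_ge_zero[of x]] by (simp add: distrib_left mult.assoc)
    finally show ?thesis .
  qed
  have "\<exists>!x. N m ((\<i> * Im z) *\<^sub>C x - y) = x"
  proof (rule banach_fix_type)
    show "\<forall>x x'. dist (N m ((\<i> * Im z) *\<^sub>C x - y)) (N m ((\<i> * Im z) *\<^sub>C x' - y)) \<le> 1 / 2 * dist x x'"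
    proof (intro allI)
      fix x x'
      have "N m ((\<i> * Im z) *\<^sub>C x - y) - N m ((\<i> * Im z) *\<^sub>C x' - y) = N m ((\<i> * Im z) *\<^sub>C (x - x') - 0)"
        using represents_linear_comb[OF represents_N[OF m], of "-1" "(\<i> * Im z) *\<^sub>C x' - y" "(\<i> * Im z) *\<^sub>C x - y"]
        by (simp add: scaleC_diff_right)
      then show "dist (N m ((\<i> * Im z) *\<^sub>C x - y)) (N m ((\<i> * Im z) *\<^sub>C x' - y)) \<le> 1 / 2 * dist x x'"
        using contraction[of "x - x'" 0] by (simp add: dist_norm)
    qed
  qed auto
  then show "\<exists>x. (x, z *\<^sub>C x - y) \<in> B"
    unfolding graph by (metis)
  assume "(x, z *\<^sub>C x - y) \<in> B"
  then have "x = N m ((\<i> * Im z) *\<^sub>C x - y)" unfolding graph .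
  then have "norm x \<le> 1 / 2 * norm x + M / m * norm y" using contraction[of x y] by simp
  then have "norm x \<le> 2 * M / m * norm y" by simp
  also have "\<dots> \<le> 4 * M / cmod z * norm y"
  proof (rule mult_right_mono)
    have "1 * \<bar>Im z\<bar> \<le> 2 * M * \<bar>Im z\<bar>" using M_ge_1 by (intro mult_right_mono) auto
    then have "cmod z \<le> 2 * m" using cmod_le[of z] z by (simp add: m_def)
    then have "M * cmod z \<le> M * (2 * m)" using M_nonneg by (rule mult_left_mono)
    moreover have "cmod z > 0" using z by auto
    ultimately show "2 * M / m \<le> 4 * M / cmod z" using m by (simp add: field_simps)
  qed simp
  finally show "norm x \<le> 4 * M / cmod z * norm y" .
qed

text \<open>
  Together the two preceding bounds cover the complement of the sector.
\<close>

lemma sectorial_B: "sectorial (pi / 4) B"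
proof -
  define K where "K = (2 + 2 * M) * M * (1 + 2 * M) + M + 4 * M"
  have K: "K \<ge> 0" using M_nonneg by (simp add: K_def)
  have res: "z \<in> resolvent_set B \<and> cmod z * norm (resolvent z B) \<le> K"
    if z: "z \<notin> closure (sector (pi / 4))" for z
  proof -
    note b = closure_sector_bound[OF z]
    have "(\<exists>x. (x, z *\<^sub>C x - y) \<in> B) \<and> (\<forall>x. (x, z *\<^sub>C x - y) \<in> B \<longrightarrow> norm x \<le> K / cmod z * norm y)" for y
    proof (cases "2 * M * \<bar>Im z\<bar> \<le> - Re z")
      case True
      have "Re z < 0"
      proof (cases "Im z = 0")
        case True
        then show ?thesis using b by (auto simp: complex_eq_iff less_le)
      next
        case False
        then have "0 < 2 * M * \<bar>Im z\<bar>" using M_ge_1 by simp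
        with \<open>2 * M * \<bar>Im z\<bar> \<le> - Re z\<close> show ?thesis by linarith
      qed
      note neg = B_resolvent_negative[OF this True]
      have "4 * M / cmod z * norm y \<le> K / cmod z * norm y"
        using M_nonneg by (intro mult_right_mono divide_right_mono) (auto simp: K_def)
      then show ?thesis using neg order_trans by blast
    next
      case False
      then have im: "Im z \<noteq> 0" using b by (auto simp: complex_eq_iff)
      have "1 * \<bar>Im z\<bar> \<le> 2 * M * \<bar>Im z\<bar>" using M_ge_1 by (intro mult_right_mono) auto
      then have "\<bar>Re z\<bar> \<le> 2 * M * \<bar>Im z\<bar>" using b(2) False by linarith
      then have "cmod z \<le> (1 + 2 * M) * \<bar>Im z\<bar>" using cmod_le[of z] by (simp add: distrib_right)
      then have "cmod z / \<bar>Im z\<bar> \<le> 1 + 2 * M" using im by (simp add: field_simps)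
      then have "(2 + 2 * M) * M * (cmod z / \<bar>Im z\<bar>) + M \<le> K"
        using M_nonneg mult_left_mono[of "cmod z / \<bar>Im z\<bar>" "1 + 2 * M" "(2 + 2 * M) * M"] unfolding K_def
        by (smt (verit) mult_nonneg_nonneg)
      then have "((2 + 2 * M) * M * (cmod z / \<bar>Im z\<bar>) + M) / cmod z * norm y \<le> K / cmod z * norm y"
        by (intro mult_right_mono divide_right_mono) auto
      then show ?thesis using B_resolvent_nonreal[OF im] order_trans by blast
    qed
    then have ex: "\<exists>x. (x, z *\<^sub>C x - y) \<in> B"
      and le: "(x, z *\<^sub>C x - y) \<in> B \<Longrightarrow> norm x \<le> K / cmod z * norm y" for x y by blast+
    have "z \<in> resolvent_set B" "norm (resolvent z B) \<le> K / cmod z"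
      using K by (auto intro: resolvent_setI[OF linear_B ex le])
    then show ?thesis using b(1) by (simp add: field_simps)
  qed
  show ?thesis
    unfolding sectorial_def
  proof (intro conjI allI impI)
    show "spectrum B \<subseteq> closure (sector (pi / 4))" using res by (auto simp: spectrum_def)
    fix \<omega>' assume "pi / 4 < \<omega>'" "\<omega>' < pi"
    then have "sector (pi / 4) \<subseteq> sector \<omega>'" by (auto simp: sector_def)
    then have "closure (sector (pi / 4)) \<subseteq> closure (sector \<omega>')" by (rule closure_mono)
    then show "bdd_above ((\<lambda>z. cmod z * norm (resolvent z B)) ` (- closure (sector \<omega>')))"
      using res by (intro bdd_aboveI2[where M = K]) auto
  qed (use linear_B in auto)
qed

text \<open>
  The function \<open>\<bar>t\<bar> / (1 + \<bar>t\<bar>) = 1 - 1 / (1 + \<bar>t\<bar>)\<close> is the transform of the unit mass minus the mixture.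
\<close>

lemma regularizer_exists: "\<exists>e. regularizer Cos (\<lambda>t. complex_of_real \<bar>t\<bar>) e"
proof
  let ?e = "\<lambda>t. 1 / (1 + complex_of_real \<bar>t\<bar>)"
  have ct: "cosine_transform (mixture_measure 1) = ?e"
    using mixture_measure(3)[OF zero_less_one] by auto
  then have e: "?e \<in> elementary_functions"
    unfolding elementary_functions_def
    by (intro CollectI exI[of _ "mixture_measure 1"]) (simp only: ct mixture_measure(1)[OF zero_less_one])
  have "?e t * complex_of_real \<bar>t\<bar> = cosine_transform (\<lambda>E. unit_mass E - mixture_measure 1 E) t" for t
  proof -
    have "cosine_transform (\<lambda>E. unit_mass E - mixture_measure 1 E) t = 1 - ?e t"
      unfolding cosine_transform_def
      using cm_integral_diff_measure[OF unit_mass(1) mixture_measure(1)[OF zero_less_one] bounded_continuous_cos]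
        unit_mass(2)[of t] fun_cong[OF ct, of t] by (simp add: cosine_transform_def)
    moreover have "complex_of_real (1 + \<bar>t\<bar>) \<noteq> 0" unfolding of_real_eq_0_iff by linarith
    ultimately show ?thesis by (simp add: field_simps)
  qed
  then have "(\<lambda>t. ?e t * complex_of_real \<bar>t\<bar>) \<in> elementary_functions"
    unfolding elementary_functions_def
    using complex_borel_measure_diff[OF unit_mass(1) mixture_measure(1)[OF zero_less_one]] by blast
  moreover have "elementary_calculus Cos ?e = N1"
    by (rule represents_unique[OF represents_elementary_calculus[OF e] rep1(1)])
  then have "inj (elementary_calculus Cos ?e)"
    using N_inject by (auto intro: injI)
  ultimately show "regularizer Cos (\<lambda>t. complex_of_real \<bar>t\<bar>) ?e"
    using e by (simp add: regularizer_def)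
qed

text \<open>
  Let \<open>S = \<Phi>(e)\<close> and \<open>T = \<Phi>(e \<bar>t\<bar>)\<close> for an arbitrary regularizer \<open>e\<close>. The identity \<open>(e + e \<bar>t\<bar>) / (1 + \<bar>t\<bar>) = e\<close> says
  \<open>N (S + T) = S\<close> for \<open>N = N 1\<close>, and since \<open>N\<close> and \<open>S\<close> are injective and commute, \<open>S y = T x\<close> is equivalent to \<open>N (x + y) = x\<close>.
\<close>

lemma calculus_abs: "calculus Cos (\<lambda>t. complex_of_real \<bar>t\<bar>) = B"
proof -
  define e where "e = (SOME e. regularizer Cos (\<lambda>t. complex_of_real \<bar>t\<bar>) e)"
  have reg: "regularizer Cos (\<lambda>t. complex_of_real \<bar>t\<bar>) e"
    unfolding e_def by (rule someI_ex[OF regularizer_exists])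
  define S where "S = elementary_calculus Cos e"
  define T where "T = elementary_calculus Cos (\<lambda>t. e t * complex_of_real \<bar>t\<bar>)"
  have S: "represents e S" and T: "represents (\<lambda>t. e t * complex_of_real \<bar>t\<bar>) T" and inj: "inj S"
    using reg represents_elementary_calculus by (auto simp: regularizer_def S_def T_def)
  have "1 / (1 + complex_of_real \<bar>t\<bar>) * (e t + e t * complex_of_real \<bar>t\<bar>) = e t" for t
  proof -
    have "complex_of_real (1 + \<bar>t\<bar>) \<noteq> 0" unfolding of_real_eq_0_iff by linarith
    then show ?thesis by (simp add: field_simps)
  qed
  then have "(\<lambda>x. N1 (S x + T x)) = S"
    using represents_unique[OF represents_mult[OF rep1(1) represents_add[OF S T]]] S by simp
  from fun_cong[OF this] have key: "N1 (S x + T x) = S x" for x .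
  have comm: "N1 (S x) = S (N1 x)" for x by (rule represents_commute[OF rep1(1) S])
  have "S y = T x \<longleftrightarrow> (x, y) \<in> B" for x y
  proof -
    have "S y = T x \<longleftrightarrow> N1 (S x + S y) = N1 (S x + T x)"
      using N_inject[of "S x + S y" "S x + T x"] by auto
    also have "\<dots> \<longleftrightarrow> S (N1 (x + y)) = S x"
      using comm[of "x + y"] represents_add_right[OF S, of x y] key[of x] by simp
    also have "\<dots> \<longleftrightarrow> (x, y) \<in> B"
      using inj by (auto simp: B_def inj_eq)
    finally show ?thesis .
  qed
  moreover have "calculus Cos (\<lambda>t. complex_of_real \<bar>t\<bar>) = op_graph T O (op_graph S)\<inverse>"
    by (simp add: calculus_def Let_def e_def S_def T_def)
  ultimately show ?thesis
    by (auto simp: op_graph_def set_eq_iff relcomp_unfold) metis+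
qed

end

section \<open>The square root\<close>

theorem mainTheorem4:
  fixes Cos :: "real \<Rightarrow> 'a::complex_banach \<Rightarrow>\<^sub>L 'a"
    and A :: "'a operator"
  assumes "linear_operator A"
    and "bounded_cosine_function Cos"
    and "generates_cosine (neg_op A) Cos"
  shows "sqrt_op A = calculus Cos (\<lambda>t. complex_of_real \<bar>t\<bar>)"
proof -
  obtain M where M: "\<And>t. norm (Cos t) \<le> M"
    using assms(2) by (auto simp: bounded_cosine_function_def bounded_iff)
  interpret cosine_generator Cos "max M 1" A
    using assms M by unfold_locales (auto simp: bounded_cosine_function_def intro: max.coboundedI1)
  have "sqrt_op A = B"
    unfolding sqrt_op_def
  proof (rule the_equality)
    show "(\<exists>\<omega>. \<omega> < pi / 2 \<and> sectorial \<omega> B) \<and> B O B = A"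
      using sectorial_B B_square by (auto intro!: exI[of _ "pi / 4"])
    fix C assume "(\<exists>\<omega>. \<omega> < pi / 2 \<and> sectorial \<omega> C) \<and> C O C = A"
    then obtain \<omega> where "\<omega> < pi / 2" "sectorial \<omega> C" "C O C = A" by blast
    then show "C = B"
      using B_square by (intro sectorial_square_root_unique[OF _ _ sectorial_B]) auto
  qed
  then show ?thesis by (simp add: calculus_abs)
qed

end
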